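(* Let $M$ be a positive integer, let $0<\epsilon<1$, and let $k<\infty$ be a positive integer. Suppose that $\mu\in\mathcal U_M$ is $(k,\epsilon)$-hyperfinite. Then there is an open neighborhood of $\mu$ (in the topology of weak convergence on $\mathfrak M_M$) such that every $\mu'\in\mathcal U_M$ within that neighborhood is $(k,\tilde\epsilon)$-hyperfinite, where $$\tilde\epsilon:=3\,\log(2M/\epsilon)\,\epsilon .$$
   Context: Graphs are undirected; $\log$ is the natural logarithm. For a set of edges $S\subset E(G)$, $G\setminus S$ is the graph with vertex set $V(G)$ and edge set $E(G)\setminus S$. A graph is locally finite if each vertex is incident with only finitely many edges. **Spaces of rooted graphs and measures.** A rooted graph is a pair $(G,o)$ with $o\in V(G)$; an isomorphism of rooted graphs $(G,o)\to(G',o')$ is a graph isomorphism mapping $o$ to $o'$. Let $\widehat{\mathcal G}$ be the set of isomorphism classes of connected, locally finite rooted graphs, and $\widehat{\mathcal G}_M\subset\widehat{\mathcal G}$ the subset of those with maximal degree at most $M$. For $r\ge 0$ let $B_G(o,r)$ be the subgraph of $G$ spanned by the vertices at distance at most $r$ from $o$. Metrize $\widehat{\mathcal G}$ by $\rho((G,o),(G',o'))=1/(r+1)$, where $r\ge 0$ is the largest integer such that $(B_G(o,r),o)$ and $(B_{G'}(o',r),o')$ are isomorphic as rooted graphs, and $\rho=0$ if $(G,o)$ and $(G',o')$ are isomorphic. Let $\mathfrak M$ (respectively $\mathfrak M_M$) be the space of Borel probability measures on $\widehat{\mathcal G}$ (respectively $\widehat{\mathcal G}_M$) with respect to $\rho$,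 with the topology of weak convergence. **Unimodular measures.** A measure $\mu\in\mathfrak M$ is unimodular (satisfies the intrinsic Mass Transport Principle) if for every non-negative Borel function $f(G,x,y)$ of a connected locally finite graph $G$ and two vertices $x,y$ of it, depending only on the isomorphism type of the triple $(G,x,y)$, $$\int \sum_{x\in V(G)} f(G,x,o)\,d\mu(G,o)=\int \sum_{y\in V(G)} f(G,o,y)\,d\mu(G,o).$$ Let $\mathcal U$ be the set of unimodular $\mu\in\mathfrak M$ and $\mathcal U_M:=\mathcal U\cap\mathfrak M_M$. A probability measure $\nu$ on (isomorphism classes of) triples $(G,o,S)$, with $(G,o)$ a connected locally finite rooted graph and $S\subset E(G)$ (with the analogous local topology, isomorphisms being required to preserve $S$, and its Borel $\sigma$-field), is called unimodular if for every non-negative Borel function $f(G,S,x,y)$ depending only on the isomorphism type of $(G,S,x,y)$, $$\int \sum_{x\in V(G)} f(G,S,x,o)\,d\nu(G,o,S)=\int \sum_{y\in V(G)} f(G,S,o,y)\,d\nu(G,o,S).$$ **$(k,\epsilon)$-hyperfinite measures.** For $\epsilon>0$ and a positive integer $k$, a measure $\mu\in\mathcal U$ is $(k,\epsilon)$-hyperfinite if there is a unimodular probability measure $\nu$ on triples $(G,o,S)$ with $S\subset E(G)$ such that the projection of $\nu$ to $(G,o)$ is $\mu$, $\nu$-almost surely every connected component of $G\setminus S$ has at most $k$ vertices, and the $\nu$-expected number of edges of $S$ incident to $o$ is at most $2\epsilon$. *)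

theory Defs
  imports "HOL-Probability.Probability" "HOL-Library.Diagonal_Subsequence"
begin

section \<open>Rooted graphs with distinguished vertex and edge sets\<close>

text \<open>
  Graphs are simple: an edge is a two-element set of vertices. A connected locally finite graph
  is countable, so up to isomorphism its vertices are natural numbers.

  One type accommodates all the tuples over which measures and Borel functions are taken. The
  fields \<open>vsets\<close> and \<open>esets\<close> are the further components of the tuple, namely sets of vertices
  and sets of edges, where a second vertex \<open>y\<close> is given as the singleton \<open>{y}\<close>:
    \<^item> \<open>(G, o)\<close> has \<open>vsets = []\<close> and \<open>esets = []\<close>,
    \<^item> \<open>(G, o, S)\<close> has \<open>vsets = []\<close> and \<open>esets = [S]\<close>,
    \<^item> \<open>(G, x, y)\<close> has root \<open>x\<close>, \<open>vsets = [{y}]\<close> and \<open>esets = []\<close>,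
    \<^item> \<open>(G, S, x, y)\<close> has root \<open>x\<close>, \<open>vsets = [{y}]\<close> and \<open>esets = [S]\<close>.
\<close>

record pre_rgraph =
  verts :: "nat set"
  edges :: "nat set set"
  origin :: nat
  vsets :: "nat set list"
  esets :: "nat set set list"

definition adj :: "nat set set \<Rightarrow> (nat \<times> nat) set" where
  "adj E = {(u, v). {u, v} \<in> E}"

definition wf_rgraph :: "pre_rgraph \<Rightarrow> bool" where
  "wf_rgraph X \<longleftrightarrow>
     (\<forall>e\<in>edges X. e \<subseteq> verts X \<and> card e = 2) \<and>
     (\<forall>u\<in>verts X. \<forall>v\<in>verts X. (u, v) \<in> (adj (edges X))\<^sup>*) \<and>
     (\<forall>v\<in>verts X. finite {e \<in> edges X. v \<in> e}) \<and>
     origin X \<in> verts X \<and>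
     (\<forall>A\<in>set (vsets X). A \<subseteq> verts X) \<and>
     (\<forall>S\<in>set (esets X). S \<subseteq> edges X)"

definition iso_via :: "(nat \<Rightarrow> nat) \<Rightarrow> pre_rgraph \<Rightarrow> pre_rgraph \<Rightarrow> bool" where
  "iso_via f X Y \<longleftrightarrow>
     bij_betw f (verts X) (verts Y) \<and>
     edges Y = image f ` edges X \<and>
     origin Y = f (origin X) \<and>
     vsets Y = map (image f) (vsets X) \<and>
     esets Y = map (image (image f)) (esets X)"

definition iso_rgraph :: "pre_rgraph \<Rightarrow> pre_rgraph \<Rightarrow> bool" where
  "iso_rgraph X Y \<longleftrightarrow> (\<exists>f. iso_via f X Y)"

definition ball_verts :: "nat set set \<Rightarrow> nat \<Rightarrow> nat \<Rightarrow> nat set" where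
  "ball_verts E a r = {v. \<exists>n\<le>r. (a, v) \<in> adj E ^^ n}"

definition rball :: "pre_rgraph \<Rightarrow> nat \<Rightarrow> pre_rgraph" where
  "rball X r = (let B = ball_verts (edges X) (origin X) r in
     \<lparr>verts = B,
      edges = {e \<in> edges X. e \<subseteq> B},
      origin = origin X,
      vsets = map (\<lambda>A. A \<inter> B) (vsets X),
      esets = map (\<lambda>S. {e \<in> S. e \<subseteq> B}) (esets X)\<rparr>)"

lemma ball_verts_0: "ball_verts E a 0 = {a}"
  by (auto simp: ball_verts_def)

lemma ball_verts_Suc:
  "ball_verts E a (Suc r) = ball_verts E a r \<union> {v. \<exists>u\<in>ball_verts E a r. {u, v} \<in> E}"
proof -
  have "v \<in> ball_verts E a (Suc r) \<longleftrightarrow>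
      v \<in> ball_verts E a r \<or> (\<exists>u\<in>ball_verts E a r. {u, v} \<in> E)" for v
  proof
    assume "v \<in> ball_verts E a (Suc r)"
    then obtain n where n: "n \<le> Suc r" "(a, v) \<in> adj E ^^ n"
      by (auto simp: ball_verts_def)
    show "v \<in> ball_verts E a r \<or> (\<exists>u\<in>ball_verts E a r. {u, v} \<in> E)"
    proof (cases n)
      case 0
      then show ?thesis using n by (auto simp: ball_verts_def)
    next
      case (Suc m)
      then obtain u where "(a, u) \<in> adj E ^^ m" "(u, v) \<in> adj E"
        using n(2) by auto
      moreover have "m \<le> r" using n(1) Suc by simp
      ultimately show ?thesis by (auto simp: ball_verts_def adj_def)
    qed
  next
    assume "v \<in> ball_verts E a r \<or> (\<exists>u\<in>ball_verts E a r. {u, v} \<in> E)"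
    then show "v \<in> ball_verts E a (Suc r)"
    proof
      assume "v \<in> ball_verts E a r"
      then show ?thesis by (auto simp: ball_verts_def intro: le_SucI)
    next
      assume "\<exists>u\<in>ball_verts E a r. {u, v} \<in> E"
      then obtain u n where "n \<le> r" "(a, u) \<in> adj E ^^ n" "(u, v) \<in> adj E"
        by (auto simp: ball_verts_def adj_def)
      then have "Suc n \<le> Suc r" "(a, v) \<in> adj E ^^ Suc n" by auto
      then show ?thesis unfolding ball_verts_def by blast
    qed
  qed
  then show ?thesis by blast
qed

lemma ball_verts_mono: "r \<le> s \<Longrightarrow> ball_verts E a r \<subseteq> ball_verts E a s"
  unfolding ball_verts_def using order_trans by blast

lemma ball_verts_center: "a \<in> ball_verts E a r"
  using ball_verts_mono[of 0 r E a] by (auto simp: ball_verts_0)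

lemma ball_verts_restrict:
  assumes "s \<le> r"
  shows "ball_verts {e \<in> E. e \<subseteq> ball_verts E a r} a s = ball_verts E a s"
  using assms
proof (induction s)
  case 0
  show ?case by (simp add: ball_verts_0)
next
  case (Suc s)
  have IH: "ball_verts {e \<in> E. e \<subseteq> ball_verts E a r} a s = ball_verts E a s"
    using Suc by simp
  have sub: "ball_verts E a (Suc s) \<subseteq> ball_verts E a r"
    using Suc.prems by (rule ball_verts_mono)
  show ?case
    unfolding ball_verts_Suc IH using sub unfolding ball_verts_Suc by blast
qed

lemma ball_verts_subset:
  assumes "a \<in> V" "\<And>e. e \<in> E \<Longrightarrow> e \<subseteq> V"
  shows "ball_verts E a r \<subseteq> V"
proof (induction r)
  case 0
  show ?case using assms by (simp add: ball_verts_0)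
next
  case (Suc r)
  show ?case unfolding ball_verts_Suc using Suc assms(2) by blast
qed

lemma ball_verts_image:
  assumes "inj_on f V" "a \<in> V" "\<And>e. e \<in> E \<Longrightarrow> e \<subseteq> V"
  shows "ball_verts (image f ` E) (f a) r = f ` ball_verts E a r"
proof (induction r)
  case 0
  show ?case by (simp add: ball_verts_0)
next
  case (Suc r)
  have sub: "ball_verts E a r \<subseteq> V" using ball_verts_subset assms by blast
  have "{w. \<exists>u\<in>f ` ball_verts E a r. {u, w} \<in> image f ` E} =
      f ` {v. \<exists>u\<in>ball_verts E a r. {u, v} \<in> E}" (is "?L = ?R")
  proof
    show "?L \<subseteq> ?R"
    proof
      fix w assume "w \<in> ?L"
      then obtain u e where u: "u \<in> ball_verts E a r" "e \<in> E" "{f u, w} = f ` e" by auto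
      then obtain v where v: "v \<in> e" "w = f v" by blast
      have "f ` e = f ` {u, v}" using u v by auto
      then have "e = {u, v}"
        using inj_on_image_eq_iff[OF assms(1), of e "{u, v}"] assms(3) u v sub by blast
      then show "w \<in> ?R" using u v by blast
    qed
  next
    show "?R \<subseteq> ?L"
    proof
      fix w assume "w \<in> ?R"
      then obtain u v where uv: "u \<in> ball_verts E a r" "{u, v} \<in> E" "w = f v" by blast
      have "{f u, w} = f ` {u, v}" using uv by simp
      then show "w \<in> ?L" using uv by blast
    qed
  qed
  then show ?case unfolding ball_verts_Suc Suc image_Un by simp
qed

lemma rball_simps:
  "verts (rball X r) = ball_verts (edges X) (origin X) r"
  "edges (rball X r) = {e \<in> edges X. e \<subseteq> ball_verts (edges X) (origin X) r}"
  "origin (rball X r) = origin X"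
  "vsets (rball X r) = map (\<lambda>A. A \<inter> ball_verts (edges X) (origin X) r) (vsets X)"
  "esets (rball X r) = map (\<lambda>S. {e \<in> S. e \<subseteq> ball_verts (edges X) (origin X) r}) (esets X)"
  by (simp_all add: rball_def Let_def)

lemma rball_rball:
  assumes "s \<le> r"
  shows "rball (rball X r) s = rball X s"
proof -
  have *: "ball_verts {e \<in> edges X. e \<subseteq> ball_verts (edges X) (origin X) r} (origin X) s =
      ball_verts (edges X) (origin X) s"
    using assms by (rule ball_verts_restrict)
  have sub: "ball_verts (edges X) (origin X) s \<subseteq> ball_verts (edges X) (origin X) r"
    using assms by (rule ball_verts_mono)
  show ?thesis
    unfolding rball_def[of "rball X r"] rball_simps Let_def *
    unfolding rball_def Let_def using sub by (auto simp: o_def)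
qed

text \<open>The part of \<open>wf_rgraph\<close> that balls inherit without further hypotheses.\<close>

definition pre_wf :: "pre_rgraph \<Rightarrow> bool" where
  "pre_wf X \<longleftrightarrow>
     (\<forall>e\<in>edges X. e \<subseteq> verts X) \<and> origin X \<in> verts X \<and>
     (\<forall>A\<in>set (vsets X). A \<subseteq> verts X) \<and>
     (\<forall>S\<in>set (esets X). S \<subseteq> edges X)"

lemma wf_imp_pre_wf: "wf_rgraph X \<Longrightarrow> pre_wf X"
  by (simp add: wf_rgraph_def pre_wf_def)

lemma pre_wf_rball: "pre_wf X \<Longrightarrow> pre_wf (rball X r)"
  by (auto simp: pre_wf_def rball_simps ball_verts_center)

lemma iso_via_rball:
  assumes iso: "iso_via f X Y" and wf: "pre_wf X"
  shows "iso_via f (rball X r) (rball Y r)"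
proof -
  define B where "B = ball_verts (edges X) (origin X) r"
  have inj: "inj_on f (verts X)" and eY: "edges Y = image f ` edges X"
    and rY: "origin Y = f (origin X)" and vY: "vsets Y = map (image f) (vsets X)"
    and sY: "esets Y = map (image (image f)) (esets X)"
    using iso by (auto simp: iso_via_def bij_betw_def)
  have eX: "\<And>e. e \<in> edges X \<Longrightarrow> e \<subseteq> verts X" and rX: "origin X \<in> verts X"
    using wf by (auto simp: pre_wf_def)
  have BV: "B \<subseteq> verts X" unfolding B_def using ball_verts_subset[OF rX eX] .
  have BY: "ball_verts (edges Y) (origin Y) r = f ` B"
    unfolding B_def eY rY using ball_verts_image[OF inj rX eX] .
  have sub: "f ` e \<subseteq> f ` B \<longleftrightarrow> e \<subseteq> B" if "e \<subseteq> verts X" for e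
    using inj_on_image_subset_iff[OF inj that BV] .
  have edg: "{e \<in> image f ` T. e \<subseteq> f ` B} = image f ` {e \<in> T. e \<subseteq> B}" if "T \<subseteq> edges X" for T
    using sub eX that by (smt (verit) Collect_cong Setcompr_eq_image image_iff mem_Collect_eq subsetD)
  have ver: "f ` A \<inter> f ` B = f ` (A \<inter> B)" if "A \<subseteq> verts X" for A
    using inj_on_image_Int[OF inj that BV] by simp
  show ?thesis
    unfolding iso_via_def rball_simps BY B_def[symmetric] unfolding eY vY sY rY
  proof (intro conjI)
    show "bij_betw f B (f ` B)" using inj BV by (auto simp: bij_betw_def inj_on_subset)
    show "{e \<in> (`) f ` edges X. e \<subseteq> f ` B} = (`) f ` {e \<in> edges X. e \<subseteq> B}" using edg by blast
    show "map (\<lambda>A. A \<inter> f ` B) (map ((`) f) (vsets X)) = map ((`) f) (map (\<lambda>A. A \<inter> B) (vsets X))"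
      using wf ver by (auto simp: pre_wf_def)
    show "map (\<lambda>S. {e \<in> S. e \<subseteq> f ` B}) (map ((`) ((`) f)) (esets X)) =
        map ((`) ((`) f)) (map (\<lambda>S. {e \<in> S. e \<subseteq> B}) (esets X))"
      using wf edg by (auto simp: pre_wf_def)
  qed simp
qed

lemma iso_via_rball_mono:
  assumes "iso_via f (rball X r) (rball Y r)" "pre_wf X" "s \<le> r"
  shows "iso_via f (rball X s) (rball Y s)"
  using iso_via_rball[OF assms(1) pre_wf_rball[OF assms(2)], of s] rball_rball[OF assms(3)] by simp

lemma iso_via_cong:
  assumes "iso_via f X Y" "pre_wf X" "\<And>v. v \<in> verts X \<Longrightarrow> f v = g v"
  shows "iso_via g X Y"
proof -
  have img: "f ` A = g ` A" if "A \<subseteq> verts X" for A using that assms(3) by (intro image_cong) auto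
  have img2: "image f ` S = image g ` S" if "S \<subseteq> edges X" for S
  proof (rule image_cong)
    fix e assume "e \<in> S"
    then have "e \<subseteq> verts X" using that assms(2) by (auto simp: pre_wf_def)
    then show "f ` e = g ` e" by (rule img)
  qed simp
  have "bij_betw g (verts X) (verts Y)"
    using assms(1) bij_betw_cong[of "verts X" f g "verts Y", OF assms(3)] by (simp add: iso_via_def)
  moreover have "edges Y = image g ` edges X" using assms(1) img2 by (simp add: iso_via_def)
  moreover have "origin Y = g (origin X)" using assms by (auto simp: iso_via_def pre_wf_def)
  moreover have "vsets Y = map (image g) (vsets X)"
    using assms(1,2) img by (auto simp: iso_via_def pre_wf_def)
  moreover have "esets Y = map (image (image g)) (esets X)"
    using assms(1,2) img2 by (auto simp: iso_via_def pre_wf_def)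
  ultimately show ?thesis by (simp add: iso_via_def)
qed

lemma iso_rgraph_refl: "iso_rgraph X X"
  unfolding iso_rgraph_def iso_via_def by (rule exI[of _ id]) simp

lemma iso_rgraph_sym:
  assumes "iso_rgraph X Y" "pre_wf X"
  shows "iso_rgraph Y X"
proof -
  obtain f where f: "iso_via f X Y" using assms(1) by (auto simp: iso_rgraph_def)
  define g where "g = inv_into (verts X) f"
  have inj: "inj_on f (verts X)" using f by (auto simp: iso_via_def bij_betw_def)
  have gf: "g ` f ` A = A" if "A \<subseteq> verts X" for A
    unfolding g_def using inj that by (rule inv_into_image_cancel)
  have gf2: "image g ` image f ` S = S" if "S \<subseteq> edges X" for S
  proof -
    have "g ` f ` e = e" if "e \<in> S" for e using gf \<open>S \<subseteq> edges X\<close> that assms(2)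
      by (auto simp: pre_wf_def)
    then show ?thesis by (auto simp: image_image)
  qed
  have "bij_betw g (verts Y) (verts X)"
    using f by (auto simp: g_def iso_via_def bij_betw_inv_into)
  moreover have "origin X = g (origin Y)"
    using f assms(2) inj by (auto simp: g_def iso_via_def pre_wf_def)
  moreover have "edges X = image g ` edges Y" using f gf2 by (simp add: iso_via_def)
  moreover have "vsets X = map (image g) (vsets Y)"
    using f assms(2) gf by (simp add: iso_via_def pre_wf_def o_def map_idI)
  moreover have "esets X = map (image (image g)) (esets Y)"
    using f assms(2) gf2 by (simp add: iso_via_def pre_wf_def o_def map_idI)
  ultimately show ?thesis by (auto simp: iso_rgraph_def iso_via_def)
qed

lemma iso_rgraph_trans:
  assumes "iso_rgraph X Y" "iso_rgraph Y Z"
  shows "iso_rgraph X Z"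
proof -
  obtain f g where "iso_via f X Y" "iso_via g Y Z" using assms by (auto simp: iso_rgraph_def)
  then have "iso_via (g \<circ> f) X Z"
    by (auto simp: iso_via_def image_image o_def intro: bij_betw_trans[unfolded o_def])
  then show ?thesis by (auto simp: iso_rgraph_def)
qed

lemma finite_ball_verts:
  assumes "wf_rgraph X"
  shows "finite (ball_verts (edges X) (origin X) r)"
proof (induction r)
  case 0
  show ?case by (simp add: ball_verts_0)
next
  case (Suc r)
  let ?B = "ball_verts (edges X) (origin X) r"
  have BV: "?B \<subseteq> verts X" using assms by (intro ball_verts_subset) (auto simp: wf_rgraph_def)
  have "finite (\<Union>u\<in>?B. {e \<in> edges X. u \<in> e})"
    using Suc BV assms by (intro finite_UN_I) (auto simp: wf_rgraph_def)
  moreover have fe: "finite e" if "e \<in> edges X" for e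
    using assms that by (intro card_ge_0_finite) (auto simp: wf_rgraph_def)
  ultimately have "finite (\<Union>(\<Union>u\<in>?B. {e \<in> edges X. u \<in> e}))"
    by (rule finite_Union) (use fe in auto)
  moreover have "{v. \<exists>u\<in>?B. {u, v} \<in> edges X} \<subseteq> \<Union>(\<Union>u\<in>?B. {e \<in> edges X. u \<in> e})" by auto
  ultimately show ?case unfolding ball_verts_Suc using Suc finite_subset by blast
qed

lemma verts_in_ball:
  assumes "wf_rgraph X" "v \<in> verts X"
  shows "\<exists>r. v \<in> ball_verts (edges X) (origin X) r"
proof -
  have "(origin X, v) \<in> (adj (edges X))\<^sup>*" using assms by (auto simp: wf_rgraph_def)
  then obtain n where "(origin X, v) \<in> adj (edges X) ^^ n" using rtrancl_imp_relpow by blast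
  then show ?thesis by (auto simp: ball_verts_def)
qed

lemma finite_subset_ball:
  assumes "wf_rgraph X" "finite A" "A \<subseteq> verts X"
  shows "\<exists>r. A \<subseteq> ball_verts (edges X) (origin X) r"
  using assms(2,3)
proof (induction A)
  case (insert v A)
  obtain r where r: "A \<subseteq> ball_verts (edges X) (origin X) r" using insert by auto
  obtain s where s: "v \<in> ball_verts (edges X) (origin X) s"
    using verts_in_ball[OF assms(1), of v] insert.prems by blast
  have "insert v A \<subseteq> ball_verts (edges X) (origin X) (max r s)"
    using r s ball_verts_mono[of r "max r s"] ball_verts_mono[of s "max r s"] by force
  then show ?case by blast
qed simp

lemma iso_via_from_balls:
  assumes X: "wf_rgraph X" and Y: "wf_rgraph Y"
    and iso: "\<And>r. iso_via f (rball X r) (rball Y r)"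
  shows "iso_via f X Y"
proof -
  let ?B = "\<lambda>r. ball_verts (edges X) (origin X) r"
  let ?C = "\<lambda>r. ball_verts (edges Y) (origin Y) r"
  have bij: "bij_betw f (?B r) (?C r)" for r
    using iso[of r] unfolding iso_via_def rball_simps by (elim conjE)
  have edg: "{e \<in> edges Y. e \<subseteq> ?C r} = image f ` {e \<in> edges X. e \<subseteq> ?B r}" for r
    using iso[of r] unfolding iso_via_def rball_simps by (elim conjE)
  have BV: "?B r \<subseteq> verts X" for r using X by (intro ball_verts_subset) (auto simp: wf_rgraph_def)
  have CV: "?C r \<subseteq> verts Y" for r using Y by (intro ball_verts_subset) (auto simp: wf_rgraph_def)
  have VX: "verts X = (\<Union>r. ?B r)" using BV verts_in_ball[OF X] by blast
  have VY: "verts Y = (\<Union>r. ?C r)" using CV verts_in_ball[OF Y] by blast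
  have eBX: "\<exists>r. e \<subseteq> ?B r" if "e \<in> edges X" for e
    using X that by (intro finite_subset_ball) (auto simp: wf_rgraph_def intro: card_ge_0_finite)
  have eBY: "\<exists>r. e \<subseteq> ?C r" if "e \<in> edges Y" for e
    using Y that by (intro finite_subset_ball) (auto simp: wf_rgraph_def intro: card_ge_0_finite)
  have inj: "inj_on f (verts X)"
  proof (rule inj_onI)
    fix u v assume uv: "u \<in> verts X" "v \<in> verts X" "f u = f v"
    obtain r where "{u, v} \<subseteq> ?B r" using finite_subset_ball[OF X, of "{u, v}"] uv by auto
    then show "u = v" using bij[of r] uv(3) by (auto simp: bij_betw_def inj_on_def)
  qed
  have "f ` verts X = verts Y"
    unfolding VX VY image_UN using bij by (auto simp: bij_betw_def)
  moreover have "edges Y = image f ` edges X"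
  proof (intro equalityI subsetI)
    fix e assume "e \<in> edges Y"
    then obtain r where "e \<in> {e \<in> edges Y. e \<subseteq> ?C r}" using eBY by blast
    then show "e \<in> image f ` edges X" using edg by auto
  next
    fix e assume "e \<in> image f ` edges X"
    then obtain e' r where "e = f ` e'" "e' \<in> {e \<in> edges X. e \<subseteq> ?B r}" using eBX by blast
    then show "e \<in> edges Y" using edg[of r] by auto
  qed
  moreover have "origin Y = f (origin X)" using iso[of 0] by (simp add: iso_via_def rball_simps)
  moreover have "vsets Y = map (image f) (vsets X)"
  proof (rule nth_equalityI)
    have mp: "map (\<lambda>A. A \<inter> ?C r) (vsets Y) = map (\<lambda>A. f ` (A \<inter> ?B r)) (vsets X)" for r
      using iso[of r] unfolding iso_via_def rball_simps map_map o_def by (elim conjE)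
    show len: "length (vsets Y) = length (map (image f) (vsets X))"
      using arg_cong[OF mp[of 0], of length] by simp
    fix i assume i: "i < length (vsets Y)"
    then have i': "i < length (vsets X)" using len by simp
    have eq: "vsets Y ! i \<inter> ?C r = f ` (vsets X ! i \<inter> ?B r)" for r
      using arg_cong[OF mp[of r], of "\<lambda>xs. xs ! i"] i i' by simp
    have "vsets X ! i \<subseteq> verts X" using X i' by (auto simp: wf_rgraph_def)
    then have 1: "vsets X ! i = (\<Union>r. vsets X ! i \<inter> ?B r)" unfolding VX by auto
    have "vsets Y ! i \<subseteq> verts Y" using Y i by (auto simp: wf_rgraph_def)
    then have "vsets Y ! i = (\<Union>r. vsets Y ! i \<inter> ?C r)" unfolding VY by auto
    also have "\<dots> = f ` (\<Union>r. vsets X ! i \<inter> ?B r)" unfolding eq image_UN ..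
    finally show "vsets Y ! i = map (image f) (vsets X) ! i" using 1 i' by simp
  qed
  moreover have "esets Y = map (image (image f)) (esets X)"
  proof (rule nth_equalityI)
    have mp: "map (\<lambda>S. {e \<in> S. e \<subseteq> ?C r}) (esets Y) =
        map (\<lambda>S. image f ` {e \<in> S. e \<subseteq> ?B r}) (esets X)" for r
      using iso[of r] unfolding iso_via_def rball_simps map_map o_def by (elim conjE)
    show len: "length (esets Y) = length (map (image (image f)) (esets X))"
      using arg_cong[OF mp[of 0], of length] by simp
    fix i assume i: "i < length (esets Y)"
    then have i': "i < length (esets X)" using len by simp
    have eq: "{e \<in> esets Y ! i. e \<subseteq> ?C r} = image f ` {e \<in> esets X ! i. e \<subseteq> ?B r}" for r
      using arg_cong[OF mp[of r], of "\<lambda>xs. xs ! i"] i i' by simp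
    have "esets X ! i \<subseteq> edges X" using X i' by (auto simp: wf_rgraph_def)
    then have 1: "esets X ! i = (\<Union>r. {e \<in> esets X ! i. e \<subseteq> ?B r})" using eBX by auto
    have "esets Y ! i \<subseteq> edges Y" using Y i by (auto simp: wf_rgraph_def)
    then have "esets Y ! i = (\<Union>r. {e \<in> esets Y ! i. e \<subseteq> ?C r})" using eBY by auto
    also have "\<dots> = image f ` (\<Union>r. {e \<in> esets X ! i. e \<subseteq> ?B r})" unfolding eq image_UN ..
    finally show "esets Y ! i = map (image (image f)) (esets X) ! i" using 1 i' by simp
  qed
  ultimately show ?thesis using inj by (simp add: iso_via_def bij_betw_def)
qed

lemma iso_from_balls:
  assumes X: "wf_rgraph X" and Y: "wf_rgraph Y"
    and iso: "\<And>r. iso_rgraph (rball X r) (rball Y r)"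
  shows "iso_rgraph X Y"
proof -
  let ?B = "\<lambda>r. ball_verts (edges X) (origin X) r"
  let ?C = "\<lambda>r. ball_verts (edges Y) (origin Y) r"
  have "\<exists>F. \<forall>r. iso_via (F r) (rball X r) (rball Y r)"
    using iso unfolding iso_rgraph_def by (intro choice) blast
  then obtain F where F: "\<And>r. iso_via (F r) (rball X r) (rball Y r)" by blast
  have FC: "F r v \<in> ?C d" if "d \<le> r" "v \<in> ?B d" for r d v
    using iso_via_rball_mono[OF F wf_imp_pre_wf[OF X] that(1)] that(2)
    by (auto simp: iso_via_def rball_simps bij_betw_def)
  define P where "P = (\<lambda>v (s :: nat \<Rightarrow> nat). v \<in> verts X \<longrightarrow>
      (\<exists>c. \<forall>\<^sub>F k in sequentially. F (s k) v = c))"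
  interpret subseqs P
  proof
    fix v and s :: "nat \<Rightarrow> nat" assume s: "strict_mono s"
    show "\<exists>r'. strict_mono r' \<and> P v (s \<circ> r')"
    proof (cases "v \<in> verts X")
      case False
      then show ?thesis unfolding P_def by (intro exI[of _ id]) (simp add: strict_mono_id)
    next
      case True
      then obtain d where d: "v \<in> ?B d" using verts_in_ball[OF X] by blast
      have "(\<lambda>k. F (s (k + d)) v) ` UNIV \<subseteq> ?C d"
      proof (rule image_subsetI)
        fix k
        have "d \<le> s (k + d)" using seq_suble[OF s, of "k + d"] by linarith
        then show "F (s (k + d)) v \<in> ?C d" using d by (rule FC)
      qed
      then have "finite (range (\<lambda>k. F (s (k + d)) v))"
        using finite_ball_verts[OF Y] finite_subset by blast
      then obtain c where c: "infinite {k. F (s (k + d)) v = c}"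
        using inf_img_fin_domE[of "\<lambda>k. F (s (k + d)) v" UNIV] by (auto simp: vimage_def)
      define q where "q = (\<lambda>k. enumerate {k. F (s (k + d)) v = c} k + d)"
      have "strict_mono q" unfolding q_def using strict_mono_enumerate[OF c]
        by (auto simp: strict_mono_def)
      moreover have "F ((s \<circ> q) k) v = c" for k
        using enumerate_in_set[OF c, of k] by (simp add: q_def)
      ultimately show ?thesis unfolding P_def by (intro exI[of _ q]) auto
    qed
  qed
  have diag: "P v (diagseq \<circ> (+) (Suc v))" for v
  proof (rule diagseq_holds)
    fix r' s :: "nat \<Rightarrow> nat" and n assume r': "strict_mono r'" and "P n s"
    have "\<forall>\<^sub>F k in sequentially. F (s (r' k)) n = c"
      if "\<forall>\<^sub>F k in sequentially. F (s k) n = c" for c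
      using eventually_compose_filterlim[OF that filterlim_subseq[OF r']] .
    then show "P n (s \<circ> r')" using \<open>P n s\<close> unfolding P_def o_def by blast
  qed
  have "\<exists>c. \<forall>\<^sub>F k in sequentially. F (diagseq k) v = c" if v: "v \<in> verts X" for v
  proof -
    obtain c where "\<forall>\<^sub>F k in sequentially. F (diagseq (k + Suc v)) v = c"
      using diag[of v] v by (auto simp: P_def add.commute)
    then show ?thesis
      using eventually_sequentially_seg[of "\<lambda>k. F (diagseq k) v = c" "Suc v"] by blast
  qed
  then have "\<exists>f. \<forall>v\<in>verts X. \<forall>\<^sub>F k in sequentially. F (diagseq k) v = f v"
    by (intro bchoice) blast
  then obtain f where f: "\<And>v. v \<in> verts X \<Longrightarrow> \<forall>\<^sub>F k in sequentially. F (diagseq k) v = f v" by blast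
  have "iso_via f (rball X r) (rball Y r)" for r
  proof -
    have BV: "?B r \<subseteq> verts X" using X by (intro ball_verts_subset) (auto simp: wf_rgraph_def)
    have "\<forall>\<^sub>F k in sequentially. \<forall>v\<in>?B r. F (diagseq k) v = f v"
      using BV f finite_ball_verts[OF X] by (intro eventually_ball_finite) auto
    moreover have "\<forall>\<^sub>F k in sequentially. r \<le> k" by (rule eventually_ge_at_top)
    ultimately have "\<forall>\<^sub>F k in sequentially. r \<le> k \<and> (\<forall>v\<in>?B r. F (diagseq k) v = f v)"
      by (simp add: eventually_conj_iff)
    then obtain k where k: "r \<le> k" "\<And>v. v \<in> ?B r \<Longrightarrow> F (diagseq k) v = f v"
      using eventually_happens by fastforce
    have "r \<le> diagseq k" using k(1) seq_suble[OF subseq_diagseq, of k] by simp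
    from iso_via_rball_mono[OF F wf_imp_pre_wf[OF X] this] show ?thesis
    proof (rule iso_via_cong)
      show "pre_wf (rball X r)" by (intro pre_wf_rball wf_imp_pre_wf X)
    qed (simp add: rball_simps k(2))
  qed
  then show ?thesis using iso_via_from_balls[OF X Y] unfolding iso_rgraph_def by blast
qed


section \<open>The metric space of isomorphism classes\<close>

lemma wf_rgraph_ex: "wf_rgraph \<lparr>verts = {0}, edges = {}, origin = 0, vsets = [], esets = []\<rparr>"
  by (simp add: wf_rgraph_def)

quotient_type rgraph = pre_rgraph / partial: "\<lambda>X Y. wf_rgraph X \<and> wf_rgraph Y \<and> iso_rgraph X Y"
proof (rule part_equivpI)
  show "\<exists>X. wf_rgraph X \<and> wf_rgraph X \<and> iso_rgraph X X"
    using wf_rgraph_ex iso_rgraph_refl by blast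
  show "symp (\<lambda>X Y. wf_rgraph X \<and> wf_rgraph Y \<and> iso_rgraph X Y)"
    using iso_rgraph_sym wf_imp_pre_wf by (intro sympI) blast
  show "transp (\<lambda>X Y. wf_rgraph X \<and> wf_rgraph Y \<and> iso_rgraph X Y)"
    using iso_rgraph_trans by (intro transpI) blast
qed

lemma wf_rep_rgraph: "wf_rgraph (rep_rgraph c)"
  using Quotient3_rep_reflp[OF Quotient3_rgraph, of c] by simp

lemma abs_rep_rgraph: "abs_rgraph (rep_rgraph c) = c"
  using Quotient3_abs_rep[OF Quotient3_rgraph] .

lemma rgraph_eq_iff: "c = d \<longleftrightarrow> iso_rgraph (rep_rgraph c) (rep_rgraph d)"
  using Quotient3_rel_rep[OF Quotient3_rgraph, of c d] by (simp add: wf_rep_rgraph)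

lemma abs_rgraph_eq_iff:
  "wf_rgraph X \<Longrightarrow> wf_rgraph Y \<Longrightarrow> abs_rgraph X = abs_rgraph Y \<longleftrightarrow> iso_rgraph X Y"
  using Quotient3_rel[OF Quotient3_rgraph, of X Y] by (simp add: iso_rgraph_refl)

lemma rep_abs_rgraph: "wf_rgraph X \<Longrightarrow> iso_rgraph (rep_rgraph (abs_rgraph X)) X"
  using abs_rgraph_eq_iff[OF wf_rep_rgraph, of X "abs_rgraph X"] by (simp add: abs_rep_rgraph)

definition ball_iso :: "rgraph \<Rightarrow> rgraph \<Rightarrow> nat \<Rightarrow> bool" where
  "ball_iso c d r \<longleftrightarrow> iso_rgraph (rball (rep_rgraph c) r) (rball (rep_rgraph d) r)"

lemma ball_iso_mono: "ball_iso c d r \<Longrightarrow> s \<le> r \<Longrightarrow> ball_iso c d s"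
  unfolding ball_iso_def iso_rgraph_def
  using iso_via_rball_mono wf_imp_pre_wf wf_rep_rgraph by blast

lemma ball_iso_refl: "ball_iso c c r"
  by (simp add: ball_iso_def iso_rgraph_refl)

lemma ball_iso_sym: "ball_iso c d r \<Longrightarrow> ball_iso d c r"
  unfolding ball_iso_def
  by (rule iso_rgraph_sym) (assumption, intro pre_wf_rball wf_imp_pre_wf wf_rep_rgraph)

lemma ball_iso_trans: "ball_iso c d r \<Longrightarrow> ball_iso d e r \<Longrightarrow> ball_iso c e r"
  unfolding ball_iso_def by (rule iso_rgraph_trans)

lemma finite_ball_iso:
  assumes "c \<noteq> d"
  shows "finite {r. ball_iso c d r}"
proof -
  obtain r where r: "\<not> ball_iso c d r"
    using assms iso_from_balls[OF wf_rep_rgraph wf_rep_rgraph] rgraph_eq_iff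
    unfolding ball_iso_def by blast
  have "{r. ball_iso c d r} \<subseteq> {..<r}"
    using r ball_iso_mono[of c d _ r] by (auto simp: not_le[symmetric])
  then show ?thesis using finite_subset by blast
qed

text \<open>
  Two rooted graphs \<open>(G, o)\<close> have isomorphic balls of radius \<open>0\<close>. The value \<open>2\<close> is a convention
  for tuples for which not even these are isomorphic, for instance because they have different
  numbers of components, or because \<open>x = y\<close> in only one of \<open>(G, x, y)\<close> and \<open>(G', x', y')\<close>.
\<close>

instantiation rgraph :: metric_space
begin

definition dist_rgraph :: "rgraph \<Rightarrow> rgraph \<Rightarrow> real" where
  "dist c d =
     (if c = d then 0
      else if {r. ball_iso c d r} = {} then 2
      else 1 / (real (Max {r. ball_iso c d r}) + 1))"

definition uniformity_rgraph :: "(rgraph \<times> rgraph) filter" where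
  "uniformity_rgraph = (INF e\<in>{0 <..}. principal {(c, d). dist c d < e})"

definition open_rgraph :: "rgraph set \<Rightarrow> bool" where
  "open_rgraph U \<longleftrightarrow> (\<forall>c\<in>U. eventually (\<lambda>(c', d). c' = c \<longrightarrow> d \<in> U) uniformity)"

lemma dist_rgraph_ball_iso: "ball_iso c d r \<longleftrightarrow> dist c d < 1 / real r \<or> r = 0 \<and> dist c d \<le> 1"
proof (cases "c = d \<or> {r. ball_iso c d r} = {}")
  case True
  then show ?thesis
  proof
    assume "c = d"
    then show ?thesis by (auto simp: ball_iso_refl dist_rgraph_def)
  next
    assume e: "{r. ball_iso c d r} = {}"
    then have "c \<noteq> d" using ball_iso_refl by blast
    then have "dist c d = 2" using e by (simp add: dist_rgraph_def)
    moreover have "1 / real r \<le> 1" by (cases "r = 0") auto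
    ultimately show ?thesis using e by auto
  qed
next
  case False
  let ?m = "Max {r. ball_iso c d r}"
  have fin: "finite {r. ball_iso c d r}" using False finite_ball_iso by blast
  have m: "ball_iso c d ?m" using Max_in[OF fin] False by blast
  have "ball_iso c d r \<longleftrightarrow> r \<le> ?m"
    using ball_iso_mono[OF m] Max_ge[OF fin] by blast
  moreover have "dist c d = 1 / (real ?m + 1)" using False by (subst dist_rgraph_def) argo
  moreover have "r \<le> ?m \<longleftrightarrow> 1 / (real ?m + 1) < 1 / real r \<or> r = 0 \<and> 1 / (real ?m + 1) \<le> 1"
    by (cases "r = 0") (auto simp: field_simps)
  ultimately show ?thesis by simp
qed

instance
proof
  fix c d e :: rgraph and U :: "rgraph set"
  show "uniformity = (INF e\<in>{0 <..}. principal {(c, d :: rgraph). dist c d < e})"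
    by (rule uniformity_rgraph_def)
  show "open U \<longleftrightarrow> (\<forall>c\<in>U. \<forall>\<^sub>F (c', d) in uniformity. c' = c \<longrightarrow> d \<in> U)"
    by (rule open_rgraph_def)
  show "dist c d = 0 \<longleftrightarrow> c = d" by (auto simp: dist_rgraph_def add_pos_nonneg)
  have nonneg: "0 \<le> dist c d" for c d :: rgraph by (simp add: dist_rgraph_def)
  have le2: "dist c d \<le> 2" for c d :: rgraph
    by (simp add: dist_rgraph_def divide_le_eq)
  have sym_set: "{r. ball_iso c d r} = {r. ball_iso d c r}" for c d
    using ball_iso_sym by blast
  have dist_sym: "dist c d = dist d c" for c d :: rgraph
    using sym_set[of c d] by (simp only: dist_rgraph_def eq_commute[of c d])
  have dist_self: "dist c c = 0" for c :: rgraph by (simp add: dist_rgraph_def)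
  have dist_lt2: "dist c d < 2 \<Longrightarrow> dist c d \<le> 1" for c d :: rgraph
    unfolding dist_rgraph_def by (simp add: divide_le_eq split: if_splits)
  show "dist c d \<le> dist c e + dist d e"
  proof (cases "c = d \<or> c = e \<or> d = e")
    case True
    then consider "c = d" | "c = e" | "d = e" by blast
    then show ?thesis
    proof cases
      case 1
      then show ?thesis using nonneg[of c e] dist_self[of c] by simp
    next
      case 2
      then show ?thesis using dist_sym[of c d] dist_self[of c] by simp
    next
      case 3
      then show ?thesis using dist_self[of d] by simp
    qed
  next
    case False
    have "dist c d \<le> max (dist c e) (dist d e)"
    proof (rule ccontr)
      assume "\<not> ?thesis"
      then have lt: "dist c e < dist c d" "dist e d < dist c d" using dist_sym[of d e] by auto
      show False
      proof (cases "{r. ball_iso c d r} = {}")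
        case True
        have "dist c e \<le> 1" "dist e d \<le> 1"
          using lt le2[of c d] dist_lt2[of c e] dist_lt2[of e d] by linarith+
        then have "ball_iso c e 0" "ball_iso e d 0" by (simp_all add: dist_rgraph_ball_iso)
        then have "ball_iso c d 0" by (rule ball_iso_trans)
        then show False using True by blast
      next
        case ne: False
        let ?m = "Max {r. ball_iso c d r}"
        have d: "dist c d = 1 / real (Suc ?m)"
          using ne False by (auto simp: dist_rgraph_def add.commute)
        have "ball_iso c e (Suc ?m)" "ball_iso e d (Suc ?m)"
          by (rule dist_rgraph_ball_iso[THEN iffD2], rule disjI1, use lt d in metis)+
        then have "ball_iso c d (Suc ?m)" by (rule ball_iso_trans)
        then show False using Max_ge[OF finite_ball_iso[of c d], of "Suc ?m"] False by auto
      qed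
    qed
    then show ?thesis using nonneg[of c e] nonneg[of d e] by linarith
  qed
qed

end

definition rooted_graphs :: "rgraph set" where
  "rooted_graphs = {c. vsets (rep_rgraph c) = [] \<and> esets (rep_rgraph c) = []}"

definition rooted_graphs_deg :: "nat \<Rightarrow> rgraph set" where
  "rooted_graphs_deg M =
     {c \<in> rooted_graphs. \<forall>v\<in>verts (rep_rgraph c). card {e \<in> edges (rep_rgraph c). v \<in> e} \<le> M}"

definition edge_marked_graphs :: "rgraph set" where
  "edge_marked_graphs = {c. vsets (rep_rgraph c) = [] \<and> length (esets (rep_rgraph c)) = 1}"

definition marked_edges :: "rgraph \<Rightarrow> nat set set" where
  "marked_edges c = hd (esets (rep_rgraph c))"

definition forget_marks :: "rgraph \<Rightarrow> rgraph" where
  "forget_marks c = abs_rgraph (rep_rgraph c\<lparr>esets := []\<rparr>)"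


section \<open>Spaces of measures\<close>

definition prob_measures_on :: "rgraph set \<Rightarrow> rgraph measure set" where
  "prob_measures_on A = {\<mu>. prob_space \<mu> \<and> sets \<mu> = sets borel \<and> (AE c in \<mu>. c \<in> A)}"

text \<open>
  The coarsest topology on the Borel probability measures on \<open>A\<close> that makes \<open>\<mu> \<mapsto> \<integral> f d\<mu>\<close>
  continuous for each bounded continuous \<open>f : A \<rightarrow> \<real>\<close>.
\<close>

definition weak_topology :: "rgraph set \<Rightarrow> rgraph measure topology" where
  "weak_topology A = topology_generated_by
     {{\<mu> \<in> prob_measures_on A. (LINT c:A|\<mu>. f c) \<in> U} | (f :: rgraph \<Rightarrow> real) U.
        continuous_on A f \<and> bounded (f ` A) \<and> open U}"

text \<open>
  \<open>with_roots c x y\<close> is the class of \<open>(G, x, y)\<close> if \<open>c\<close> is the class of \<open>(G, o)\<close>, and that of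
  \<open>(G, S, x, y)\<close> if \<open>c\<close> is the class of \<open>(G, o, S)\<close>; so \<open>unimodular\<close> below is the Mass
  Transport Principle for measures on either kind of tuple.
\<close>

definition with_roots :: "rgraph \<Rightarrow> nat \<Rightarrow> nat \<Rightarrow> rgraph" where
  "with_roots c x y = abs_rgraph (rep_rgraph c\<lparr>origin := x, vsets := [{y}]\<rparr>)"

definition unimodular :: "rgraph measure \<Rightarrow> bool" where
  "unimodular \<mu> \<longleftrightarrow> (\<forall>f :: rgraph \<Rightarrow> ennreal. f \<in> borel_measurable borel \<longrightarrow>
     (\<integral>\<^sup>+c. (\<integral>\<^sup>+x. f (with_roots c x (origin (rep_rgraph c)))
        \<partial>count_space (verts (rep_rgraph c))) \<partial>\<mu>) =
     (\<integral>\<^sup>+c. (\<integral>\<^sup>+y. f (with_roots c (origin (rep_rgraph c)) y)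
        \<partial>count_space (verts (rep_rgraph c))) \<partial>\<mu>))"

definition unimodular_measures :: "rgraph measure set" where
  "unimodular_measures = {\<mu> \<in> prob_measures_on rooted_graphs. unimodular \<mu>}"

definition unimodular_measures_deg :: "nat \<Rightarrow> rgraph measure set" where
  "unimodular_measures_deg M = unimodular_measures \<inter> prob_measures_on (rooted_graphs_deg M)"


section \<open>Hyperfiniteness\<close>

definition components :: "nat set \<Rightarrow> nat set set \<Rightarrow> nat set set" where
  "components V E = {{w. (v, w) \<in> (adj E)\<^sup>*} | v. v \<in> V}"

definition hyperfinite :: "nat \<Rightarrow> real \<Rightarrow> rgraph measure \<Rightarrow> bool" where
  "hyperfinite k \<epsilon> \<mu> \<longleftrightarrow> \<mu> \<in> unimodular_measures \<and>
     (\<exists>\<nu> \<in> prob_measures_on edge_marked_graphs. unimodular \<nu> \<and>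
        distr \<nu> borel forget_marks = \<mu> \<and>
        (AE c in \<nu>. \<forall>C \<in> components (verts (rep_rgraph c)) (edges (rep_rgraph c) - marked_edges c).
           finite C \<and> card C \<le> k) \<and>
        (\<integral>\<^sup>+c. ennreal (real (card {e \<in> marked_edges c. origin (rep_rgraph c) \<in> e})) \<partial>\<nu>)
          \<le> ennreal (2 * \<epsilon>))"

end

theory Submission
  imports Defs
begin

text \<open>
  Let \<open>\<nu>\<close> witness that \<open>\<mu>\<close> is hyperfinite. Conditionally on \<open>(G, o)\<close>, let \<open>p(K)\<close> be the probability
  that \<open>K\<close> is the component of \<open>o\<close> after removing \<open>S\<close>. By mass transport \<open>p(K)\<close> does not depend on
  the choice of the root in \<open>K\<close>, so \<open>p\<close> is a fractional partition of \<open>G\<close> into small sets: the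
  weights of the sets containing a given vertex add up to \<open>1\<close>. It is rounded as in the greedy
  analysis of set cover. With \<open>t = ln (2 M / \<epsilon>)\<close>, let each small set \<open>K\<close> ring independently with
  probability \<open>1 - exp (- t p(K))\<close>, and cut the edges that leave a ringing set together with the
  edges at vertices covered by no ringing set. Each remaining component lies in a ringing set or
  is a single vertex. The ringing sets cost at most \<open>4 t \<epsilon>\<close> edges at the root in expectation, and the
  uncovered vertices at most \<open>2 M exp (- t) = \<epsilon>\<close>, which is less than \<open>2 t \<epsilon>\<close>.

  Replacing \<open>p\<close> by an \<open>L\<^sup>1\<close>-approximation that depends only on a ball of bounded radius changes these
  costs by an arbitrarily small amount. Then the cutting procedure is defined for every \<open>\<mu>'\<close>, its law
  is unimodular whenever \<open>\<mu>'\<close> is, and the expected number of cut edges at the root is the integral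
  of a bounded continuous function, so the bound persists in a neighbourhood of \<open>\<mu>\<close>.
\<close>

abbreviation rep :: "rgraph \<Rightarrow> pre_rgraph" where
  "rep \<equiv> rep_rgraph"

abbreviation vball :: "pre_rgraph \<Rightarrow> nat \<Rightarrow> nat set" where
  "vball X \<equiv> ball_verts (edges X) (origin X)"

abbreviation ball_via :: "(nat \<Rightarrow> nat) \<Rightarrow> pre_rgraph \<Rightarrow> pre_rgraph \<Rightarrow> nat \<Rightarrow> bool" where
  "ball_via f X Y R \<equiv> iso_via f (rball X R) (rball Y R)"

abbreviation nbrs :: "pre_rgraph \<Rightarrow> nat set" where
  "nbrs X \<equiv> {v. {origin X, v} \<in> edges X}"


section \<open>Cylinder sets and local functions\<close>

lemma iso_via_imp_iso_rball:
  "iso_via f X Y \<Longrightarrow> wf_rgraph X \<Longrightarrow> iso_rgraph (rball X R) (rball Y R)"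
  using iso_via_rball wf_imp_pre_wf unfolding iso_rgraph_def by blast

lemma ball_iso_abs:
  assumes X: "wf_rgraph X" and Y: "wf_rgraph Y"
  shows "ball_iso (abs_rgraph X) (abs_rgraph Y) R \<longleftrightarrow> iso_rgraph (rball X R) (rball Y R)"
proof -
  have *: "iso_rgraph (rball (rep (abs_rgraph Z)) R) (rball Z R)" if "wf_rgraph Z" for Z
    using rep_abs_rgraph[OF that] iso_via_imp_iso_rball wf_rep_rgraph
    unfolding iso_rgraph_def by blast
  have s: "iso_rgraph (rball Z R) (rball (rep (abs_rgraph Z)) R)" if "wf_rgraph Z" for Z
    by (intro iso_rgraph_sym[OF *[OF that]] pre_wf_rball wf_imp_pre_wf wf_rep_rgraph)
  show ?thesis unfolding ball_iso_def
    using *[OF X] *[OF Y] s[OF X] s[OF Y] iso_rgraph_trans by metis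
qed

text \<open>An event that can be read off the ball of radius R. Complements are of the same kind, so
  cylinders are clopen. Finite-range constructions handle them well, and identities of measures are
  checked on them.\<close>

definition cylinder :: "nat \<Rightarrow> rgraph set \<Rightarrow> bool" where
  "cylinder R C \<longleftrightarrow> (\<forall>c d. c \<in> C \<longrightarrow> ball_iso c d R \<longrightarrow> d \<in> C)"

lemma cylinderD: "cylinder R C \<Longrightarrow> ball_iso c d R \<Longrightarrow> c \<in> C \<longleftrightarrow> d \<in> C"
  unfolding cylinder_def using ball_iso_sym by blast

lemma cylinder_Compl: "cylinder R C \<Longrightarrow> cylinder R (- C)"
  unfolding cylinder_def using ball_iso_sym by blast

lemma cylinder_mono: "cylinder R C \<Longrightarrow> R \<le> S \<Longrightarrow> cylinder S C"
  unfolding cylinder_def using ball_iso_mono by blast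

lemma open_iff_ball_iso:
  "open U \<longleftrightarrow> (\<forall>c\<in>U. \<exists>R. \<forall>d. ball_iso c d R \<longrightarrow> d \<in> U)" for U :: "rgraph set"
proof
  assume U: "open U"
  show "\<forall>c\<in>U. \<exists>R. \<forall>d. ball_iso c d R \<longrightarrow> d \<in> U"
  proof
    fix c assume "c \<in> U"
    then obtain e where e: "e > 0" "\<And>d. dist d c < e \<Longrightarrow> d \<in> U"
      using U unfolding open_dist by blast
    obtain n where n: "n > 0" "1 / real n < e"
      using e(1) by (metis nat_approx_posE zero_less_Suc)
    have "d \<in> U" if "ball_iso c d n" for d
      using that n by (intro e(2)) (auto simp: dist_rgraph_ball_iso dist_commute)
    then show "\<exists>R. \<forall>d. ball_iso c d R \<longrightarrow> d \<in> U" by blast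
  qed
next
  assume *: "\<forall>c\<in>U. \<exists>R. \<forall>d. ball_iso c d R \<longrightarrow> d \<in> U"
  show "open U" unfolding open_dist
  proof
    fix c assume "c \<in> U"
    then obtain R where R: "\<And>d. ball_iso c d R \<Longrightarrow> d \<in> U" using * by blast
    \<comment> \<open>The radius is \<open>Suc R\<close> because the bound \<open>1 / real R\<close>
      degenerates to 0 at R = 0.\<close>
    have "d \<in> U" if "dist d c < 1 / real (Suc R)" for d
    proof -
      have "ball_iso c d (Suc R)"
        using that by (simp add: dist_rgraph_ball_iso dist_commute)
      then show ?thesis using R ball_iso_mono by (meson le_SucI order_refl)
    qed
    then show "\<exists>e>0. \<forall>d. dist d c < e \<longrightarrow> d \<in> U"
      by (intro exI[of _ "1 / real (Suc R)"]) auto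
  qed
qed

lemma open_cylinder: "cylinder R C \<Longrightarrow> open C"
  unfolding open_iff_ball_iso cylinder_def by blast

lemma sets_cylinder [intro]: "cylinder R C \<Longrightarrow> C \<in> sets borel"
  by (rule borel_open) (rule open_cylinder)

text \<open>The set at level R collects the points all of whose companions with the same R-ball lie
  in U. These inner approximations exhaust an open U, so monotone limits lead from cylinders to open
  sets.\<close>

lemma open_incseq_cylinders:
  fixes U :: "rgraph set" assumes "open U"
  obtains C where "incseq C" "\<And>R. cylinder R (C R)" "(\<Union>R. C R) = U"
proof
  let ?C = "\<lambda>R. {c. \<forall>d. ball_iso c d R \<longrightarrow> d \<in> U}"
  show "incseq ?C" unfolding incseq_def using ball_iso_mono by blast
  show "cylinder R (?C R)" for R unfolding cylinder_def using ball_iso_trans by blast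
  show "(\<Union>R. ?C R) = U"
    using assms ball_iso_refl unfolding open_iff_ball_iso by blast
qed

lemma continuous_on_local:
  fixes f :: "rgraph \<Rightarrow> 'a :: topological_space"
  assumes "\<And>c d. ball_iso c d R \<Longrightarrow> f c = f d"
  shows "continuous_on A f"
proof -
  have "open (f -` B)" for B
    by (rule open_cylinder[of R]) (use assms in \<open>auto simp: cylinder_def\<close>)
  then have "continuous_on UNIV f" by (simp add: continuous_on_open_vimage)
  then show ?thesis by (rule continuous_on_subset) simp
qed

lemma measurable_local:
  assumes "\<And>c d. ball_iso c d R \<Longrightarrow> f c = f d" "range f \<subseteq> space N"
  shows "f \<in> measurable borel N"
proof (rule measurableI)
  show "f c \<in> space N" for c using assms(2) by auto
  show "f -` B \<inter> space borel \<in> sets borel" for B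
  proof -
    have "cylinder R (f -` B)" using assms(1) by (auto simp: cylinder_def)
    then show ?thesis using sets_cylinder by simp
  qed
qed

lemma measurable_rgraphI:
  fixes g :: "'a \<Rightarrow> rgraph"
  assumes "\<And>R C. cylinder R C \<Longrightarrow> {x \<in> space M. g x \<in> C} \<in> sets M"
  shows "g \<in> borel_measurable M"
proof (rule borel_measurableI)
  fix U :: "rgraph set" assume "open U"
  then obtain C where C: "\<And>R. cylinder R (C R)" "(\<Union>R. C R) = U"
    using open_incseq_cylinders by metis
  have "g -` U \<inter> space M = (\<Union>R. {x \<in> space M. g x \<in> C R})" using C(2) by blast
  also have "\<dots> \<in> sets M" using assms C(1) by blast
  finally show "g -` U \<inter> space M \<in> sets M" .
qed

lemma sets_borel_sigma_open: "sets (borel :: rgraph measure) = sigma_sets UNIV {U. open U}"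
  unfolding borel_def by (simp add: sets_measure_of)

lemma Int_stable_open: "Int_stable {U :: rgraph set. open U}"
  unfolding Int_stable_def by auto

lemma open_subset_Pow: "{U :: rgraph set. open U} \<subseteq> Pow UNIV"
  by simp

text \<open>Open sets form an intersection-stable generator and are increasing unions of cylinders,
  so continuity from below suffices.\<close>

lemma measure_eqI_cylinder:
  fixes M N :: "rgraph measure"
  assumes "finite_measure M" and sM: "sets M = sets borel" and sN: "sets N = sets borel"
    and eq: "\<And>R C. cylinder R C \<Longrightarrow> emeasure M C = emeasure N C"
  shows "M = N"
proof (rule measure_eqI_generator_eq[OF Int_stable_open, where \<Omega>=UNIV and A="\<lambda>_. UNIV"])
  interpret finite_measure M by fact
  show "emeasure M UNIV \<noteq> \<infinity>" for i :: nat
    using emeasure_finite[of UNIV] by simp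
  fix U :: "rgraph set" assume "U \<in> {U. open U}"
  then obtain C where C: "incseq C" "\<And>R. cylinder R (C R)" "(\<Union>R. C R) = U"
    using open_incseq_cylinders[of U] by auto
  have rg: "range C \<subseteq> sets borel" using C(2) by blast
  have "emeasure M U = (SUP R. emeasure M (C R))"
    using SUP_emeasure_incseq[OF _ C(1), of M] rg C(3) sM by simp
  also have "\<dots> = (SUP R. emeasure N (C R))" using eq[OF C(2)] by simp
  also have "\<dots> = emeasure N U"
    using SUP_emeasure_incseq[OF _ C(1), of N] rg C(3) sN by simp
  finally show "emeasure M U = emeasure N U" .
qed (use sM sN sets_borel_sigma_open in auto)

text \<open>Stated for representatives rather than classes, so that it applies to graphs built
  explicitly. Dependence on one ball forces invariance under isomorphism, which allows
  \<open>rep (abs_rgraph X)\<close> to be replaced by \<open>X\<close>.\<close>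

definition local_fun :: "(pre_rgraph \<Rightarrow> 'a) \<Rightarrow> bool" where
  "local_fun F \<longleftrightarrow> (\<exists>R. \<forall>X Y f. wf_rgraph X \<longrightarrow> wf_rgraph Y \<longrightarrow>
     ball_via f X Y R \<longrightarrow> F X = F Y)"

lemma local_fun_iso: "local_fun F \<Longrightarrow> iso_via f X Y \<Longrightarrow> wf_rgraph X \<Longrightarrow> wf_rgraph Y \<Longrightarrow> F X = F Y"
  unfolding local_fun_def using iso_via_rball wf_imp_pre_wf by metis

lemma local_fun_rep_abs: "local_fun F \<Longrightarrow> wf_rgraph X \<Longrightarrow> F (rep (abs_rgraph X)) = F X"
  using local_fun_iso rep_abs_rgraph wf_rep_rgraph unfolding iso_rgraph_def by metis

lemma local_fun_ball_iso:
  assumes "local_fun F"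
  obtains R where "\<And>c d. ball_iso c d R \<Longrightarrow> F (rep c) = F (rep d)"
  using assms wf_rep_rgraph unfolding local_fun_def ball_iso_def iso_rgraph_def by metis

lemma measurable_local_fun:
  assumes "local_fun F" "\<And>X. wf_rgraph X \<Longrightarrow> F X \<in> space N"
  shows "(\<lambda>c. F (rep c)) \<in> measurable borel N"
proof -
  obtain R where "\<And>c d. ball_iso c d R \<Longrightarrow> F (rep c) = F (rep d)"
    using local_fun_ball_iso[OF assms(1)] by blast
  then show ?thesis by (rule measurable_local) (use assms(2) wf_rep_rgraph in auto)
qed

lemma local_fun_comp: "local_fun F \<Longrightarrow> local_fun (\<lambda>X. h (F X))"
  unfolding local_fun_def by metis

section \<open>Local kernels\<close>

definition local_kernel :: "(pre_rgraph \<Rightarrow> rgraph measure) \<Rightarrow> bool" where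
  "local_kernel \<kappa> \<longleftrightarrow> (\<forall>X. wf_rgraph X \<longrightarrow> finite_measure (\<kappa> X) \<and> sets (\<kappa> X) = sets borel) \<and>
     (\<forall>R. \<exists>R'. \<forall>X Y f. wf_rgraph X \<longrightarrow> wf_rgraph Y \<longrightarrow> iso_via f (rball X R') (rball Y R') \<longrightarrow>
        (\<forall>C. cylinder R C \<longrightarrow> emeasure (\<kappa> X) C = emeasure (\<kappa> Y) C))"

lemma local_kernel_iso:
  assumes "local_kernel \<kappa>" "iso_via f X Y" "wf_rgraph X" "wf_rgraph Y"
  shows "\<kappa> X = \<kappa> Y"
proof (rule measure_eqI_cylinder)
  show "emeasure (\<kappa> X) C = emeasure (\<kappa> Y) C" if "cylinder R C" for R C
    using assms(1) that assms(3,4) iso_via_rball[OF assms(2) wf_imp_pre_wf[OF assms(3)]]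
    unfolding local_kernel_def by metis
qed (use assms in \<open>auto simp: local_kernel_def\<close>)

lemma local_kernel_rep_abs:
  "local_kernel \<kappa> \<Longrightarrow> wf_rgraph X \<Longrightarrow> \<kappa> (rep (abs_rgraph X)) = \<kappa> X"
  using local_kernel_iso rep_abs_rgraph wf_rep_rgraph unfolding iso_rgraph_def by metis

lemma local_kernel_ball_iso:
  assumes "local_kernel \<kappa>"
  obtains R' where "\<And>c d C. ball_iso c d R' \<Longrightarrow> cylinder R C \<Longrightarrow>
    emeasure (\<kappa> (rep c)) C = emeasure (\<kappa> (rep d)) C"
proof -
  obtain R' where "\<forall>X Y f. wf_rgraph X \<longrightarrow> wf_rgraph Y \<longrightarrow> iso_via f (rball X R') (rball Y R') \<longrightarrow>
        (\<forall>C. cylinder R C \<longrightarrow> emeasure (\<kappa> X) C = emeasure (\<kappa> Y) C)"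
    using assms unfolding local_kernel_def by blast
  then show ?thesis using that wf_rep_rgraph unfolding ball_iso_def iso_rgraph_def by metis
qed

lemma sets_local_kernel: "local_kernel \<kappa> \<Longrightarrow> sets (\<kappa> (rep c)) = sets borel"
  unfolding local_kernel_def using wf_rep_rgraph by auto

text \<open>On cylinders the mass is a local function of the input. A Dynkin argument extends this
  to Borel sets; finiteness serves the complements.\<close>

lemma local_kernel_measurable_emeasure:
  assumes \<kappa>: "local_kernel \<kappa>" and "A \<in> sets borel"
  shows "(\<lambda>c. emeasure (\<kappa> (rep c)) A) \<in> borel_measurable borel"
proof -
  have sk [simp]: "sets (\<kappa> (rep c)) = sets borel" for c
    using sets_local_kernel[OF \<kappa>] .
  have spk [simp]: "space (\<kappa> (rep c)) = UNIV" for c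
    using sets_eq_imp_space_eq[OF sk] by simp
  have fk: "finite_measure (\<kappa> (rep c))" for c
    using \<kappa> wf_rep_rgraph unfolding local_kernel_def by blast
  have cyl: "(\<lambda>c. emeasure (\<kappa> (rep c)) C) \<in> borel_measurable borel" if "cylinder R C" for R C
  proof -
    obtain R' where "\<And>c d C. ball_iso c d R' \<Longrightarrow> cylinder R C \<Longrightarrow>
        emeasure (\<kappa> (rep c)) C = emeasure (\<kappa> (rep d)) C"
      using local_kernel_ball_iso[OF \<kappa>] by blast
    with that show ?thesis by (intro measurable_local[of R']) auto
  qed
  have A: "A \<in> sigma_sets UNIV {U. open U}" using assms(2) sets_borel_sigma_open by simp
  show ?thesis
    using Int_stable_open open_subset_Pow A
  proof (induction rule: sigma_sets_induct_disjoint)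
    case (basic U)
    then obtain C where C: "incseq C" "\<And>R. cylinder R (C R)" "(\<Union>R. C R) = U"
      using open_incseq_cylinders[of U] by auto
    have rg: "range C \<subseteq> sets borel" using C(2) by blast
    have "emeasure (\<kappa> (rep c)) U = (SUP R. emeasure (\<kappa> (rep c)) (C R))" for c
      using SUP_emeasure_incseq[OF _ C(1), of "\<kappa> (rep c)"] rg C(3) by simp
    then show ?case using cyl[OF C(2)] by simp
  next
    case empty
    then show ?case by simp
  next
    case (compl A)
    have "A \<in> sets borel" using compl(1) sets_borel_sigma_open by simp
    then have "emeasure (\<kappa> (rep c)) (UNIV - A) =
        emeasure (\<kappa> (rep c)) UNIV - emeasure (\<kappa> (rep c)) A" for c
      using emeasure_Diff[of "\<kappa> (rep c)" A UNIV] finite_measure.emeasure_finite[OF fk]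
      by simp
    moreover have "(\<lambda>c. emeasure (\<kappa> (rep c)) UNIV) \<in> borel_measurable borel"
      by (rule cyl[of 0]) (simp add: cylinder_def)
    ultimately show ?case using compl by simp
  next
    case (union A)
    have "range A \<subseteq> sets borel" using union(2) sets_borel_sigma_open by simp
    then have "emeasure (\<kappa> (rep c)) (\<Union>(range A)) = (\<Sum>i. emeasure (\<kappa> (rep c)) (A i))" for c
      using suminf_emeasure[of A "\<kappa> (rep c)"] union(1) by simp
    then show ?case using union by simp
  qed
qed

lemma local_kernel_measurable:
  assumes \<kappa>: "local_kernel \<kappa>" and "f \<in> borel_measurable borel"
  shows "(\<lambda>c. \<integral>\<^sup>+d. f d \<partial>\<kappa> (rep c)) \<in> borel_measurable borel"
  using assms(2)
proof (induction rule: borel_measurable_induct)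
  case (cong f g)
  then show ?case by simp
next
  case (set A)
  then show ?case using local_kernel_measurable_emeasure[OF \<kappa>] sets_local_kernel[OF \<kappa>] by simp
next
  case (mult u r)
  have "u \<in> borel_measurable (\<kappa> (rep c))" for c
    using mult measurable_cong_sets[OF sets_local_kernel[OF \<kappa>] refl] by blast
  then show ?case using mult by (simp add: nn_integral_cmult)
next
  case (add u v)
  have "u \<in> borel_measurable (\<kappa> (rep c))" "v \<in> borel_measurable (\<kappa> (rep c))" for c
    using add measurable_cong_sets[OF sets_local_kernel[OF \<kappa>] refl] by blast+
  then show ?case using add by (simp add: nn_integral_add)
next
  case (seq U)
  have m: "U i \<in> borel_measurable (\<kappa> (rep c))" for c i
    using seq measurable_cong_sets[OF sets_local_kernel[OF \<kappa>] refl] by blast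
  have "(\<integral>\<^sup>+d. (SUP i. U i) d \<partial>\<kappa> (rep c)) = (SUP i. \<integral>\<^sup>+d. U i d \<partial>\<kappa> (rep c))" for c
    using nn_integral_monotone_convergence_SUP[OF seq(3) m, of c] by (simp add: image_comp)
  then show ?case using seq by (simp add: image_comp)
qed

lemma local_kernel_measurable_subprob:
  assumes "local_kernel \<kappa>" "\<And>X. wf_rgraph X \<Longrightarrow> emeasure (\<kappa> X) UNIV \<le> 1" "sets \<mu> = sets borel"
  shows "(\<lambda>c. \<kappa> (rep c)) \<in> measurable \<mu> (subprob_algebra borel)"
proof (rule measurable_subprob_algebra)
  show "subprob_space (\<kappa> (rep c))" for c
  proof
    have "space (\<kappa> (rep c)) = UNIV"
      using sets_eq_imp_space_eq[OF sets_local_kernel[OF assms(1)]] by simp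
    then show "emeasure (\<kappa> (rep c)) (space (\<kappa> (rep c))) \<le> 1"
      "space (\<kappa> (rep c)) \<noteq> {}"
      using assms(2)[OF wf_rep_rgraph] by auto
  qed
  show "(\<lambda>c. emeasure (\<kappa> (rep c)) A) \<in> borel_measurable \<mu>" if "A \<in> sets borel" for A
    using local_kernel_measurable_emeasure[OF assms(1) that] measurable_cong_sets[OF assms(3) refl]
    by blast
qed (rule sets_local_kernel[OF assms(1)])

text \<open>The preimages under an integer-valued function of the R-ball are cylinders of radius R,
  so both measures give it the same law.\<close>

lemma nn_integral_local_kernel_cong:
  fixes g :: "rgraph \<Rightarrow> nat"
  assumes "finite_measure M" "finite_measure N" "sets M = sets borel" "sets N = sets borel"
    and eq: "\<And>C. cylinder R C \<Longrightarrow> emeasure M C = emeasure N C"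
    and g: "\<And>c d. ball_iso c d R \<Longrightarrow> g c = g d"
  shows "(\<integral>\<^sup>+c. of_nat (g c) \<partial>M) = (\<integral>\<^sup>+c. of_nat (g c) \<partial>N)"
proof -
  have gm: "g \<in> measurable borel (count_space UNIV)" by (rule measurable_local[OF g]) auto
  have mM: "g \<in> measurable M (count_space UNIV)" and mN: "g \<in> measurable N (count_space UNIV)"
    using gm measurable_cong_sets[OF assms(3) refl] measurable_cong_sets[OF assms(4) refl] by blast+
  have spM: "space M = UNIV" and spN: "space N = UNIV"
    using sets_eq_imp_space_eq[OF assms(3)] sets_eq_imp_space_eq[OF assms(4)] by auto
  have "distr M (count_space UNIV) g = distr N (count_space UNIV) g"
  proof (rule measure_eqI)
    fix A
    have "cylinder R (g -` A)" unfolding cylinder_def using g by auto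
    then show "emeasure (distr M (count_space UNIV) g) A = emeasure (distr N (count_space UNIV) g) A"
      using eq by (simp add: emeasure_distr[OF mM] emeasure_distr[OF mN] spM spN)
  qed simp
  then show ?thesis
    using nn_integral_distr[OF mM, of of_nat] nn_integral_distr[OF mN, of of_nat] by simp
qed


section \<open>Approximation by local functions\<close>

text \<open>Dynkin induction: open sets are limits of cylinders from inside, complements keep the
  symmetric difference, and a disjoint union is cut off after finitely many sets, whose
  approximations have a common radius.\<close>

lemma cylinder_approx:
  fixes M :: "rgraph measure"
  assumes M: "finite_measure M" "sets M = sets borel" and A: "A \<in> sets borel" and e: "(e :: real) > 0"
  shows "\<exists>R C. cylinder R C \<and> measure M (sym_diff A C) < e"
proof -
  interpret finite_measure M by fact
  note [simp] = M(2)
  have [simp]: "space M = UNIV" using sets_eq_imp_space_eq[OF M(2)] by simp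
  have A: "A \<in> sigma_sets UNIV {U. open U}" using A sets_borel_sigma_open by simp
  have "\<forall>e>0. \<exists>R C. cylinder R C \<and> measure M (sym_diff A C) < e"
    using Int_stable_open open_subset_Pow A
  proof (induction rule: sigma_sets_induct_disjoint)
    case (basic U)
    then obtain C where C: "incseq C" "\<And>R. cylinder R (C R)" "(\<Union>R. C R) = U"
      using open_incseq_cylinders[of U] by auto
    have lim: "(\<lambda>R. measure M (C R)) \<longlonglongrightarrow> measure M U"
      using finite_Lim_measure_incseq[OF _ C(1)] C(2,3) by auto
    have UC: "measure M (sym_diff U (C R)) = measure M U - measure M (C R)" for R
    proof -
      have "sym_diff U (C R) = U - C R" using C(3) by blast
      moreover have "C R \<in> sets borel" "C R \<subseteq> U" "U \<in> sets borel" using C(2,3) basic by auto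
      ultimately show ?thesis using finite_measure_Diff[of U "C R"] by simp
    qed
    show ?case
    proof (intro allI impI)
      fix e :: real assume "e > 0"
      then have "\<forall>\<^sub>F R in sequentially. dist (measure M (C R)) (measure M U) < e"
        using lim tendstoD by blast
      then obtain R where "dist (measure M (C R)) (measure M U) < e"
        using eventually_happens by fastforce
      then show "\<exists>R Ca. cylinder R Ca \<and> measure M (sym_diff U Ca) < e"
        using UC[of R] C(2)[of R] by (intro exI[of _ R] exI[of _ "C R"]) (auto simp: dist_real_def)
    qed
  next
    case empty
    have "cylinder 0 {}" by (simp add: cylinder_def)
    then show ?case by (intro allI impI exI[of _ 0] exI[of _ "{}"]) simp
  next
    case (compl A)
    show ?case
    proof (intro allI impI)
      fix e :: real assume "e > 0"
      then obtain R C where "cylinder R C" "measure M (sym_diff A C) < e" using compl by blast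
      moreover have "sym_diff (UNIV - A) (- C) = sym_diff A C" by blast
      ultimately show "\<exists>R C. cylinder R C \<and> measure M (sym_diff (UNIV - A) C) < e"
        using cylinder_Compl by metis
    qed
  next
    case (union A)
    have As: "A i \<in> sets borel" for i using union(2) sets_borel_sigma_open by auto
    show ?case
    proof (intro allI impI)
      fix e :: real assume e: "e > 0"
      have "(\<lambda>n. measure M (\<Union>i\<le>n. A i)) \<longlonglongrightarrow> measure M (\<Union>n. \<Union>i\<le>n. A i)"
        by (rule finite_Lim_measure_incseq) (use As in \<open>auto simp: incseq_def intro: order_trans\<close>)
      moreover have "(\<Union>n. \<Union>i\<le>n. A i) = (\<Union>i. A i)" by blast
      ultimately have "\<forall>\<^sub>F n in sequentially. dist (measure M (\<Union>i\<le>n. A i)) (measure M (\<Union>i. A i)) < e / 2"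
        using e tendstoD by (metis half_gt_zero)
      then obtain n where n: "dist (measure M (\<Union>i\<le>n. A i)) (measure M (\<Union>i. A i)) < e / 2"
        using eventually_happens by fastforce
      \<comment> \<open>Half of the error is spent on the tail; the other half is shared by the n +
        1 sets that are kept.\<close>
      have pos: "e / (2 * (real n + 1)) > 0" using e by (simp add: add_nonneg_pos)
      have "\<forall>i. \<exists>R C. cylinder R C \<and> measure M (sym_diff (A i) C) < e / (2 * (real n + 1))"
        using union(3) pos by blast
      then obtain R C where RC: "\<And>i. cylinder (R i) (C i)"
          "\<And>i. measure M (sym_diff (A i) (C i)) < e / (2 * (real n + 1))" by metis
      let ?R = "Max (R ` {..n})" and ?C = "\<Union>i\<le>n. C i"
      have "cylinder ?R (C i)" if "i \<le> n" for i
        using cylinder_mono[OF RC(1)] that by simp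
      then have cyl: "cylinder ?R ?C" unfolding cylinder_def by blast
      have Cs: "C i \<in> sets borel" for i using RC(1) by blast
      have "sym_diff (\<Union>i. A i) ?C \<subseteq> ((\<Union>i. A i) - (\<Union>i\<le>n. A i)) \<union> (\<Union>i\<le>n. sym_diff (A i) (C i))"
        by blast
      then have "measure M (sym_diff (\<Union>i. A i) ?C) \<le>
          measure M (((\<Union>i. A i) - (\<Union>i\<le>n. A i)) \<union> (\<Union>i\<le>n. sym_diff (A i) (C i)))"
        by (intro finite_measure_mono) (use As Cs in auto)
      also have "\<dots> \<le> measure M ((\<Union>i. A i) - (\<Union>i\<le>n. A i)) + measure M (\<Union>i\<le>n. sym_diff (A i) (C i))"
        by (intro measure_Un_le) (use As Cs in auto)
      also have "\<dots> < e / 2 + e / 2"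
      proof (rule add_less_le_mono)
        have "measure M ((\<Union>i. A i) - (\<Union>i\<le>n. A i)) = measure M (\<Union>i. A i) - measure M (\<Union>i\<le>n. A i)"
          by (rule finite_measure_Diff) (use As in auto)
        then show "measure M ((\<Union>i. A i) - (\<Union>i\<le>n. A i)) < e / 2"
          using n unfolding dist_real_def by linarith
        have "measure M (\<Union>i\<le>n. sym_diff (A i) (C i)) \<le> (\<Sum>i\<le>n. measure M (sym_diff (A i) (C i)))"
          by (intro finite_measure_subadditive_finite) (use As Cs in auto)
        also have "\<dots> \<le> (\<Sum>i\<le>n. e / (2 * (real n + 1)))"
          using RC(2) by (intro sum_mono less_imp_le) auto
        also have "\<dots> = e / 2" by (simp add: field_simps)
        finally show "measure M (\<Union>i\<le>n. sym_diff (A i) (C i)) \<le> e / 2" .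
      qed
      finally show "\<exists>R C. cylinder R C \<and> measure M (sym_diff (\<Union>(range A)) C) < e"
        using cyl by auto
    qed
  qed
  then show ?thesis using e by blast
qed

text \<open>Density of local functions in L1: indicators are handled by
  \<open>cylinder_approx\<close>, sums by passing to the larger radius, limits by dominated
  convergence.\<close>

lemma local_approx:
  fixes f :: "rgraph \<Rightarrow> real"
  assumes M: "finite_measure M" "sets M = sets borel" and f: "integrable M f" and e: "(e :: real) > 0"
  shows "\<exists>R q. (\<forall>c d. ball_iso c d R \<longrightarrow> q c = q d) \<and> integrable M q \<and> (LINT c|M. \<bar>f c - q c\<bar>) < e"
proof -
  interpret finite_measure M by fact
  note [simp] = M(2)
  have [simp]: "space M = UNIV" using sets_eq_imp_space_eq[OF M(2)] by simp
  let ?P = "\<lambda>f. \<forall>e>0. \<exists>R q. (\<forall>c d. ball_iso c d R \<longrightarrow> q c = q d) \<and> integrable M q \<and>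
      (LINT c|M. \<bar>f c - q c\<bar>) < (e :: real)"
  have "?P f" using f
  proof (induction rule: integrable_induct)
    case (base A r)
    show ?case
    proof (intro allI impI)
      fix e :: real assume e: "e > 0"
      \<comment> \<open>The summand 1 covers the case r = 0.\<close>
      have "e / (\<bar>r\<bar> + 1) > 0" using e by (simp add: add_nonneg_pos)
      moreover have "A \<in> sets borel" using base by simp
      ultimately obtain R C where C: "cylinder R C" "measure M (sym_diff A C) < e / (\<bar>r\<bar> + 1)"
        using cylinder_approx[OF M] by blast
      have Cs: "C \<in> sets borel" using C(1) by blast
      have "(LINT c|M. \<bar>indicat_real A c *\<^sub>R r - indicat_real C c *\<^sub>R r\<bar>) =
          (LINT c|M. indicator (sym_diff A C) c * \<bar>r\<bar>)"
        by (intro Bochner_Integration.integral_cong) (auto simp: indicator_def)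
      also have "\<dots> = measure M (sym_diff A C) * \<bar>r\<bar>" by simp
      also have "\<dots> \<le> measure M (sym_diff A C) * (\<bar>r\<bar> + 1)" by (intro mult_left_mono) auto
      also have "\<dots> < e" using C(2) by (simp add: pos_less_divide_eq)
      finally have "(LINT c|M. \<bar>indicat_real A c *\<^sub>R r - indicat_real C c *\<^sub>R r\<bar>) < e" .
      moreover have "integrable M (\<lambda>c. indicat_real C c *\<^sub>R r)"
        using Cs emeasure_finite[of C] by (simp add: less_top[symmetric])
      moreover have "\<forall>c d. ball_iso c d R \<longrightarrow> indicat_real C c *\<^sub>R r = indicat_real C d *\<^sub>R r"
        using cylinderD[OF C(1)] by (auto simp: indicator_def)
      ultimately show "\<exists>R q. (\<forall>c d. ball_iso c d R \<longrightarrow> q c = q d) \<and> integrable M q \<and>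
          (LINT c|M. \<bar>indicat_real A c *\<^sub>R r - q c\<bar>) < e"
        by (intro exI[of _ R] exI[of _ "\<lambda>c. indicat_real C c *\<^sub>R r"] conjI)
    qed
  next
    case (add f g)
    show ?case
    proof (intro allI impI)
      fix e :: real assume e: "e > 0"
      obtain R q where q: "\<forall>c d. ball_iso c d R \<longrightarrow> q c = q d" "integrable M q"
        "(LINT c|M. \<bar>f c - q c\<bar>) < e / 2" using add(3) half_gt_zero[OF e] by blast
      obtain S p where p: "\<forall>c d. ball_iso c d S \<longrightarrow> p c = p d" "integrable M p"
        "(LINT c|M. \<bar>g c - p c\<bar>) < e / 2" using add(4) half_gt_zero[OF e] by blast
      have "(LINT c|M. \<bar>f c + g c - (q c + p c)\<bar>) \<le> (LINT c|M. \<bar>f c - q c\<bar> + \<bar>g c - p c\<bar>)"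
        by (intro integral_mono) (use add(1,2) q(2) p(2) in auto)
      also have "\<dots> = (LINT c|M. \<bar>f c - q c\<bar>) + (LINT c|M. \<bar>g c - p c\<bar>)"
        by (intro Bochner_Integration.integral_add) (use add(1,2) q(2) p(2) in auto)
      also have "\<dots> < e" using q(3) p(3) by simp
      finally have "(LINT c|M. \<bar>f c + g c - (q c + p c)\<bar>) < e" .
      moreover have "\<forall>c d. ball_iso c d (max R S) \<longrightarrow> q c + p c = q d + p d"
        using q(1) p(1) ball_iso_mono by (metis max.cobounded1 max.cobounded2)
      moreover have "integrable M (\<lambda>c. q c + p c)" using q(2) p(2) by simp
      ultimately show "\<exists>R q. (\<forall>c d. ball_iso c d R \<longrightarrow> q c = q d) \<and> integrable M q \<and>
          (LINT c|M. \<bar>f c + g c - q c\<bar>) < e"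
        by (intro exI[of _ "max R S"] exI[of _ "\<lambda>c. q c + p c"]) simp
    qed
  next
    case (lim f s)
    have lim0: "(\<lambda>i. LINT c|M. \<bar>f c - s i c\<bar>) \<longlonglongrightarrow> (LINT c|M. 0)"
    \<comment> \<open>The induction rule supplies approximants bounded by twice the modulus of f,
      whence the factor 3.\<close>
    proof (rule integral_dominated_convergence[where w="\<lambda>c. 3 * \<bar>f c\<bar>"])
      show "AE c in M. (\<lambda>i. \<bar>f c - s i c\<bar>) \<longlonglongrightarrow> 0"
      proof (rule AE_I2)
        fix c assume "c \<in> space M"
        then have "(\<lambda>i. \<bar>f c - s i c\<bar>) \<longlonglongrightarrow> \<bar>f c - f c\<bar>" by (intro tendsto_intros lim(2))
        then show "(\<lambda>i. \<bar>f c - s i c\<bar>) \<longlonglongrightarrow> 0" by simp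
      qed
      show "AE c in M. norm \<bar>f c - s i c\<bar> \<le> 3 * \<bar>f c\<bar>" for i
      proof (rule AE_I2)
        fix c assume "c \<in> space M"
        then have "\<bar>s i c\<bar> \<le> 2 * \<bar>f c\<bar>" using lim(3)[of c i] by simp
        then show "norm \<bar>f c - s i c\<bar> \<le> 3 * \<bar>f c\<bar>" by auto
      qed
    qed (use lim in auto)
    show ?case
    proof (intro allI impI)
      fix e :: real assume e: "e > 0"
      have "\<forall>\<^sub>F i in sequentially. (LINT c|M. \<bar>f c - s i c\<bar>) < e / 2"
        using order_tendstoD(2)[OF lim0, of "e / 2"] e by simp
      then obtain i where i: "(LINT c|M. \<bar>f c - s i c\<bar>) < e / 2"
        using eventually_happens by fastforce
      obtain R q where q: "\<forall>c d. ball_iso c d R \<longrightarrow> q c = q d" "integrable M q"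
        "(LINT c|M. \<bar>s i c - q c\<bar>) < e / 2" using lim(5)[of i] half_gt_zero[OF e] by blast
      have "(LINT c|M. \<bar>f c - q c\<bar>) \<le> (LINT c|M. \<bar>f c - s i c\<bar> + \<bar>s i c - q c\<bar>)"
        by (intro integral_mono) (use lim(1,4) q(2) in auto)
      also have "\<dots> = (LINT c|M. \<bar>f c - s i c\<bar>) + (LINT c|M. \<bar>s i c - q c\<bar>)"
        by (intro Bochner_Integration.integral_add) (use lim(1,4) q(2) in auto)
      also have "\<dots> < e" using q(3) i by simp
      finally show "\<exists>R q. (\<forall>c d. ball_iso c d R \<longrightarrow> q c = q d) \<and> integrable M q \<and>
          (LINT c|M. \<bar>f c - q c\<bar>) < e" using q(1,2) by blast
    qed
  qed
  then show ?thesis using e by blast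
qed


section \<open>Transport along isomorphisms of balls\<close>

lemma ball_verts_wf: "wf_rgraph X \<Longrightarrow> vball X R \<subseteq> verts X"
  by (rule ball_verts_subset) (auto simp: wf_rgraph_def)

lemma ball_verts_trans:
  "x \<in> ball_verts E a r \<Longrightarrow> y \<in> ball_verts E x s \<Longrightarrow> y \<in> ball_verts E a (r + s)"
  unfolding ball_verts_def by (smt (verit) add_mono mem_Collect_eq relcompI relpow_add)

text \<open>A path of length at most s from x stays within distance r + s of a, so deleting
  everything beyond distance R leaves the s-ball around x unchanged.\<close>

lemma ball_verts_restrict_at:
  assumes "x \<in> ball_verts E a r" "r + s \<le> R"
  shows "ball_verts {e \<in> E. e \<subseteq> ball_verts E a R} x s = ball_verts E x s"
  using assms(2)
proof (induction s)
  case 0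
  show ?case by (simp add: ball_verts_0)
next
  case (Suc s)
  have IH: "ball_verts {e \<in> E. e \<subseteq> ball_verts E a R} x s = ball_verts E x s"
    using Suc by simp
  have sub: "ball_verts E x (Suc s) \<subseteq> ball_verts E a R"
    using ball_verts_trans[OF assms(1)] ball_verts_mono[OF Suc.prems] by blast
  show ?case
    unfolding ball_verts_Suc IH using sub unfolding ball_verts_Suc by blast
qed

context
  fixes X Y :: pre_rgraph and f :: "nat \<Rightarrow> nat" and R :: nat
  assumes X: "wf_rgraph X" and Y: "wf_rgraph Y" and iso: "ball_via f X Y R"
begin

lemma iso_le: "r \<le> R \<Longrightarrow> ball_via f X Y r"
  using iso_via_rball_mono[OF iso wf_imp_pre_wf[OF X]] .

lemma inj_on_ball: "inj_on f (vball X R)"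
  using iso by (auto simp: iso_via_def rball_simps bij_betw_def)

lemma image_ball: "r \<le> R \<Longrightarrow>
    f ` vball X r = vball Y r"
  using iso_le[of r] by (auto simp: iso_via_def rball_simps bij_betw_def)

lemma origin_transport: "origin Y = f (origin X)"
  using iso by (simp add: iso_via_def rball_simps)

lemma edges_transport:
  "{e \<in> edges Y. e \<subseteq> vball Y R} =
    image f ` {e \<in> edges X. e \<subseteq> vball X R}"
  using iso unfolding iso_via_def rball_simps by (elim conjE)

lemma in_edges_transport:
  assumes "e \<subseteq> vball X R"
  shows "f ` e \<in> edges Y \<longleftrightarrow> e \<in> edges X"
proof
  assume "e \<in> edges X"
  then have "f ` e \<in> image f ` {e \<in> edges X. e \<subseteq> vball X R}"
    using assms by (intro imageI) simp
  then show "f ` e \<in> edges Y" unfolding edges_transport[symmetric] by simp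
next
  assume "f ` e \<in> edges Y"
  moreover have "f ` e \<subseteq> vball Y R"
    using image_mono[OF assms, of f] image_ball[of R] by simp
  ultimately have "f ` e \<in> {e \<in> edges Y. e \<subseteq> vball Y R}" by simp
  then obtain e' where e': "f ` e = f ` e'" "e' \<in> edges X"
      "e' \<subseteq> vball X R"
    unfolding edges_transport by (elim imageE CollectE conjE)
  then show "e \<in> edges X" using inj_on_image_eq_iff[OF inj_on_ball assms e'(3)] by simp
qed

text \<open>An isomorphism of balls also serves vertices off the centre, at the price of their
  distance from it. This is what makes constructions at other vertices than the root local.\<close>

lemma rball_reroot:
  assumes "x \<in> vball X r" "r + s \<le> R"
  shows "ball_via f (X\<lparr>origin := x\<rparr>) (Y\<lparr>origin := f x\<rparr>) s"
proof -
  have fx: "f x \<in> vball Y r"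
    using assms image_ball[of r] by auto
  have xR: "x \<in> vball X R"
    using assms ball_verts_mono[of r R] by auto
  \<comment> \<open>Restricting to the R-ball first and re-rooting afterwards does not change the
    s-ball around the new root.\<close>
  have *: "rball ((rball Z R)\<lparr>origin := z\<rparr>) s = rball (Z\<lparr>origin := z\<rparr>) s"
    if z: "z \<in> vball Z r" for Z z
  proof -
    let ?B = "vball Z R"
    have eq: "ball_verts {e \<in> edges Z. e \<subseteq> ?B} z s = ball_verts (edges Z) z s"
      using ball_verts_restrict_at[OF z assms(2)] .
    have sub: "ball_verts (edges Z) z s \<subseteq> ?B"
      using ball_verts_trans[OF z] ball_verts_mono[OF assms(2)] by blast
    show ?thesis
      unfolding rball_def[of "(rball Z R)\<lparr>origin := z\<rparr>"] rball_def[of "Z\<lparr>origin := z\<rparr>"]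
      using sub by (auto simp: rball_simps Let_def eq o_def)
  qed
  have "pre_wf ((rball X R)\<lparr>origin := x\<rparr>)"
    using pre_wf_rball[OF wf_imp_pre_wf[OF X], of R] xR by (simp add: pre_wf_def rball_simps)
  moreover have "iso_via f ((rball X R)\<lparr>origin := x\<rparr>) ((rball Y R)\<lparr>origin := f x\<rparr>)"
    using iso by (simp add: iso_via_def)
  ultimately have "ball_via f ((rball X R)\<lparr>origin := x\<rparr>) ((rball Y R)\<lparr>origin := f x\<rparr>) s"
    by (intro iso_via_rball)
  then show ?thesis using *[OF assms(1)] *[OF fx] by simp
qed

lemma ball_transport:
  assumes "x \<in> vball X r" "r + s \<le> R"
  shows "ball_verts (edges Y) (f x) s = f ` ball_verts (edges X) x s"
  using rball_reroot[OF assms] by (auto simp: iso_via_def rball_simps bij_betw_def)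

lemma ball_sub:
  assumes "x \<in> vball X r" "r + s \<le> R"
  shows "ball_verts (edges X) x s \<subseteq> vball X R"
  using ball_verts_trans[OF assms(1)] ball_verts_mono[OF assms(2)] by blast

end

text \<open>Only the underlying graph isomorphism is kept; the old marks are discarded, and any
  marks that match inside the balls may take their place.\<close>

lemma iso_via_remark:
  assumes "ball_via f X Y R"
    and "map (\<lambda>A. A \<inter> vball Y R) Bs =
      map (\<lambda>A. f ` (A \<inter> vball X R)) As"
    and "map (\<lambda>S. {e \<in> S. e \<subseteq> vball Y R}) Ts =
      map (\<lambda>S. image f ` {e \<in> S. e \<subseteq> vball X R}) Ss"
  shows "ball_via f (X\<lparr>vsets := As, esets := Ss\<rparr>) (Y\<lparr>vsets := Bs, esets := Ts\<rparr>) R"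
  using assms unfolding iso_via_def rball_simps map_map o_def by (elim conjE) simp


section \<open>Small sets of vertices\<close>

text \<open>
  Every component with at most \<open>k\<close> vertices has diameter at most \<open>k * k\<close>, a bound for
  the number of its ordered pairs of adjacent vertices.
\<close>

definition small :: "nat \<Rightarrow> pre_rgraph \<Rightarrow> nat set set" where
  "small k X = {K. K \<subseteq> verts X \<and> finite K \<and> card K \<le> k \<and>
     (\<forall>x\<in>K. K \<subseteq> ball_verts (edges X) x (k * k))}"

text \<open>The small sets that can influence the ball of radius r; by \<open>finite_near\<close>
  there are finitely many.\<close>

definition near :: "nat \<Rightarrow> nat \<Rightarrow> pre_rgraph \<Rightarrow> nat set set" where
  "near k r X = {K \<in> small k X. K \<inter> vball X r \<noteq> {}}"

abbreviation at_root :: "nat \<Rightarrow> pre_rgraph \<Rightarrow> nat set set" where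
  "at_root k \<equiv> near k 0"

lemma small_update [simp]:
  "small k (X\<lparr>origin := x\<rparr>) = small k X" "small k (X\<lparr>vsets := As\<rparr>) = small k X"
  "small k (X\<lparr>esets := Ss\<rparr>) = small k X"
  by (simp_all add: small_def)

lemma near_update [simp]:
  "near k r (X\<lparr>vsets := As\<rparr>) = near k r X" "near k r (X\<lparr>esets := Ss\<rparr>) = near k r X"
  by (simp_all add: near_def)

lemma at_root_iff: "K \<in> at_root k X \<longleftrightarrow> K \<in> small k X \<and> origin X \<in> K"
  by (auto simp: near_def ball_verts_0)

lemma near_smallD: "K \<in> near k r X \<Longrightarrow> K \<in> small k X"
  by (simp add: near_def)

lemma small_finite: "K \<in> small k X \<Longrightarrow> finite K"
  by (simp add: small_def)

lemma small_verts: "K \<in> small k X \<Longrightarrow> K \<subseteq> verts X"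
  by (simp add: small_def)

lemma near_sub:
  assumes "K \<in> near k r X"
  shows "K \<subseteq> vball X (r + k * k)"
proof -
  obtain x where x: "x \<in> K" "x \<in> vball X r"
    using assms by (auto simp: near_def)
  then have "K \<subseteq> ball_verts (edges X) x (k * k)"
    using assms by (auto simp: near_def small_def)
  then show ?thesis using ball_verts_trans[OF x(2)] by blast
qed

lemma finite_near: "wf_rgraph X \<Longrightarrow> finite (near k r X)"
  by (rule finite_subset[of _ "Pow (vball X (r + k * k))"])
    (use near_sub finite_ball_verts in \<open>auto dest!: subsetD\<close>)

text \<open>A small set meeting the ball of radius r reaches out to r + k * k, and checking its
  smallness requires the balls of radius k * k around its own vertices; this accounts for the
  summand 2 * (k * k).\<close>

lemma near_transport:
  assumes X: "wf_rgraph X" and Y: "wf_rgraph Y" and iso: "ball_via f X Y R"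
    and R: "r + 2 * (k * k) \<le> R"
  shows "bij_betw (image f) (near k r X) (near k r Y)"
proof -
  let ?B = "\<lambda>r. vball X r"
  let ?C = "\<lambda>r. vball Y r"
  have BR: "?B (r + k * k) \<subseteq> ?B R" "?B r \<subseteq> ?B R" using R by (auto intro!: ball_verts_mono)
  have inj: "inj_on f (?B R)" using inj_on_ball[OF X Y iso] .
  have *: "f ` K \<in> near k r Y \<longleftrightarrow> K \<in> near k r X" if K: "K \<subseteq> ?B (r + k * k)" for K
  proof -
    have KR: "K \<subseteq> ?B R" using K BR by blast
    have sub: "?B R \<subseteq> verts X" "?C R \<subseteq> verts Y"
      using X Y by (auto dest: ball_verts_wf)
    have fin: "finite K" using KR finite_ball_verts[OF X] finite_subset by blast
    have "card (f ` K) = card K" using inj KR by (intro card_image) (rule inj_on_subset)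
    moreover have "f ` K \<inter> ?C r \<noteq> {} \<longleftrightarrow> K \<inter> ?B r \<noteq> {}"
    proof -
      have "f ` K \<inter> ?C r = f ` (K \<inter> ?B r)"
        using image_ball[OF X Y iso, of r] inj_on_image_Int[OF inj KR BR(2)] R by simp
      then show ?thesis by simp
    qed
    moreover have "f ` K \<subseteq> ball_verts (edges Y) (f x) (k * k) \<longleftrightarrow> K \<subseteq> ball_verts (edges X) x (k * k)"
      if "x \<in> K" for x
    proof -
      have x: "x \<in> ?B (r + k * k)" using that K by blast
      have "ball_verts (edges Y) (f x) (k * k) = f ` ball_verts (edges X) x (k * k)"
        using ball_transport[OF X Y iso x] R by simp
      moreover have "ball_verts (edges X) x (k * k) \<subseteq> ?B R" using ball_sub[OF X Y iso x] R by simp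
      ultimately show ?thesis using inj_on_image_subset_iff[OF inj KR] by simp
    qed
    moreover have "K \<subseteq> verts X" "f ` K \<subseteq> verts Y"
      using KR sub image_mono[OF KR, of f] image_ball[OF X Y iso, of R] by auto
    ultimately show ?thesis using fin by (simp add: near_def small_def)
  qed
  show ?thesis
    unfolding bij_betw_def
  proof
    show "inj_on ((`) f) (near k r X)"
    proof (rule inj_onI)
      fix K L assume KL: "K \<in> near k r X" "L \<in> near k r X" "f ` K = f ` L"
      have "K \<subseteq> ?B R" using near_sub[OF KL(1)] BR(1) by (rule subset_trans)
      moreover have "L \<subseteq> ?B R" using near_sub[OF KL(2)] BR(1) by (rule subset_trans)
      ultimately show "K = L" using inj_on_image_eq_iff[OF inj] KL(3) by simp
    qed
    show "(`) f ` near k r X = near k r Y"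
    proof (intro equalityI subsetI)
      fix L assume "L \<in> (`) f ` near k r X"
      then obtain K where "L = f ` K" "K \<in> near k r X" by blast
      then show "L \<in> near k r Y" using *[OF near_sub] by blast
    next
      fix L assume L: "L \<in> near k r Y"
      then have "L \<subseteq> ?C (r + k * k)" by (rule near_sub)
      also have "\<dots> = f ` ?B (r + k * k)" using image_ball[OF X Y iso, of "r + k * k"] R by simp
      finally obtain K where "K \<subseteq> ?B (r + k * k)" "L = f ` K" by (meson subset_imageE)
      then show "L \<in> (`) f ` near k r X" using * L by blast
    qed
  qed
qed


section \<open>Marking a small set and moving the root inside it\<close>

text \<open>The marked edges are dropped on purpose: (G, z, K) must not remember S, so that laws
  obtained from \<nu> can be compared with laws obtained from \<mu>.\<close>

definition mark :: "pre_rgraph \<Rightarrow> nat \<Rightarrow> nat set \<Rightarrow> rgraph" where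
  "mark X z K = abs_rgraph (X\<lparr>origin := z, vsets := [K], esets := []\<rparr>)"

abbreviation rmark :: "pre_rgraph \<Rightarrow> nat set \<Rightarrow> rgraph" where
  "rmark X \<equiv> mark X (origin X)"

lemma wf_mark: "wf_rgraph X \<Longrightarrow> z \<in> verts X \<Longrightarrow> K \<subseteq> verts X \<Longrightarrow>
    wf_rgraph (X\<lparr>origin := z, vsets := [K], esets := []\<rparr>)"
  by (simp add: wf_rgraph_def)

lemma ball_iso_mark:
  assumes X: "wf_rgraph X" and Y: "wf_rgraph Y" and iso: "ball_via f X Y R"
    and z: "z \<in> vball X r" "r + s \<le> R"
    and K: "K \<subseteq> vball X R"
  shows "ball_iso (mark X z K) (mark Y (f z) (f ` K)) s"
proof -
  let ?B = "vball X R" and ?C = "vball Y R"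
  have sub: "?B \<subseteq> verts X" "?C \<subseteq> verts Y"
    using X Y by (auto dest: ball_verts_wf)
  have zB: "z \<in> ?B" using z ball_verts_mono[of r R] by auto
  have im: "f ` ?B = ?C" using image_ball[OF X Y iso] by simp
  have "iso_via f (rball (X\<lparr>origin := z, vsets := [K], esets := []\<rparr>) s)
      (rball (Y\<lparr>origin := f z, vsets := [f ` K], esets := []\<rparr>) s)"
    using iso_via_remark[OF rball_reroot[OF X Y iso z], of "[f ` K]" "[K]" "[]" "[]"]
      inj_on_image_Int[OF inj_on_ball[OF X Y iso] K ball_sub[OF X Y iso z]]
    by (simp add: ball_transport[OF X Y iso z])
  moreover have "wf_rgraph (X\<lparr>origin := z, vsets := [K], esets := []\<rparr>)"
    using X zB K sub by (intro wf_mark) auto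
  moreover have "f ` K \<subseteq> verts Y" "f z \<in> verts Y"
    using image_mono[OF K, of f] imageI[OF zB, of f] sub(2) unfolding im by blast+
  moreover have "wf_rgraph (Y\<lparr>origin := f z, vsets := [f ` K], esets := []\<rparr>)"
    using Y calculation by (intro wf_mark) auto
  ultimately show ?thesis
    unfolding mark_def using ball_iso_abs iso_rgraph_def by blast
qed

text \<open>Weights of pairs (K, z), where K is a small set at the root and z is the vertex of K
  that becomes the new root.\<close>

definition local_weight :: "nat \<Rightarrow> (pre_rgraph \<Rightarrow> nat set \<Rightarrow> nat \<Rightarrow> real) \<Rightarrow> bool" where
  "local_weight k w \<longleftrightarrow> (\<exists>R. \<forall>X Y f K z. wf_rgraph X \<longrightarrow> wf_rgraph Y \<longrightarrow>
     ball_via f X Y R \<longrightarrow> K \<in> at_root k X \<longrightarrow> z \<in> K \<longrightarrow>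
     w Y (f ` K) (f z) = w X K z)"

text \<open>A weighted sum of point masses at (G, z, K). Sums over small sets become integrals
  against this kernel, so their measurability and independence of the representative follow
  uniformly from \<open>measurable_kern\<close> and \<open>kern_rep_abs\<close>.\<close>

definition kern :: "nat \<Rightarrow> (pre_rgraph \<Rightarrow> nat set \<Rightarrow> nat \<Rightarrow> real) \<Rightarrow> pre_rgraph \<Rightarrow> rgraph measure" where
  "kern k w X = distr (density (count_space (SIGMA K:at_root k X. K)) (\<lambda>(K, z). ennreal (w X K z)))
     borel (\<lambda>(K, z). mark X z K)"

lemma sets_kern [simp]: "sets (kern k w X) = sets borel"
  by (simp add: kern_def)

lemma space_kern [simp]: "space (kern k w X) = UNIV"
  by (simp add: kern_def)

lemma nn_integral_kern:
  assumes "wf_rgraph X" "g \<in> borel_measurable borel"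
  shows "(\<integral>\<^sup>+d. g d \<partial>kern k w X) =
    (\<Sum>K\<in>at_root k X. \<Sum>z\<in>K. ennreal (w X K z) * g (mark X z K))"
proof -
  have fin: "finite (at_root k X)" "\<And>K. K \<in> at_root k X \<Longrightarrow> finite K"
    using finite_near[OF assms(1)] near_smallD small_finite by blast+
  show ?thesis
    unfolding kern_def
    using assms(2) fin
    by (subst nn_integral_distr) (auto simp: nn_integral_density nn_integral_count_space_finite
        sum.Sigma case_prod_beta')
qed

text \<open>The radius pays for evaluating the weight, for recognising the small sets at the root,
  and for looking R far from the new root z, which is at distance at most k * k.\<close>

lemma kern_cong_cylinder:
  assumes w: "\<forall>X Y f K z. wf_rgraph X \<longrightarrow> wf_rgraph Y \<longrightarrow>
     ball_via f X Y Rw \<longrightarrow> K \<in> at_root k X \<longrightarrow> z \<in> K \<longrightarrow>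
     w Y (f ` K) (f z) = w X K z"
    and X: "wf_rgraph X" and Y: "wf_rgraph Y"
    and R: "Rw + 2 * (k * k) + R \<le> R'"
    and iso: "iso_via f (rball X R') (rball Y R')"
    and C: "cylinder R C"
  shows "emeasure (kern k w X) C = emeasure (kern k w Y) C"
proof -
  have Cs: "C \<in> sets borel" using C by blast
  have em: "emeasure (kern k w Z) C =
      (\<Sum>K\<in>at_root k Z. \<Sum>z\<in>K. ennreal (w Z K z) * indicator C (mark Z z K))" if "wf_rgraph Z" for Z
    using nn_integral_kern[OF that, of "indicator C" k w] Cs by simp
  have iso_w: "ball_via f X Y Rw" using iso_le[OF X Y iso, of Rw] R by simp
  have bij: "bij_betw (image f) (at_root k X) (at_root k Y)"
    using near_transport[OF X Y iso, of 0 k] R by simp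
  have inj: "inj_on f (vball X R')" using inj_on_ball[OF X Y iso] .
  have "(\<Sum>z\<in>f ` K. ennreal (w Y (f ` K) z) * indicator C (mark Y z (f ` K))) =
      (\<Sum>z\<in>K. ennreal (w X K z) * indicator C (mark X z K))" if K: "K \<in> at_root k X" for K
  proof -
    have Ks: "K \<subseteq> vball X (k * k)" using near_sub[OF K] by simp
    then have KR: "K \<subseteq> vball X R'"
      using ball_verts_mono[of "k * k" R'] R by fastforce
    have "mark X z K \<in> C \<longleftrightarrow> mark Y (f z) (f ` K) \<in> C" if "z \<in> K" for z
      using ball_iso_mark[OF X Y iso, of z "k * k" R K] Ks KR that R cylinderD[OF C] by auto
    then have "ennreal (w Y (f ` K) (f z)) * indicator C (mark Y (f z) (f ` K)) =
        ennreal (w X K z) * indicator C (mark X z K)" if "z \<in> K" for z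
      using w[rule_format, OF X Y iso_w K that] that by (simp add: indicator_def)
    then show ?thesis using inj_on_subset[OF inj KR] by (simp add: sum.reindex)
  qed
  then show ?thesis
    unfolding em[OF X] em[OF Y] sum.reindex_bij_betw[OF bij, symmetric] by simp
qed

lemma finite_measure_kern: "wf_rgraph X \<Longrightarrow> finite_measure (kern k w X)"
proof
  assume X: "wf_rgraph X"
  have "emeasure (kern k w X) UNIV = (\<Sum>K\<in>at_root k X. \<Sum>z\<in>K. ennreal (w X K z))"
    using nn_integral_kern[OF X, of "\<lambda>_. 1" k w] by simp
  also have "\<dots> < \<infinity>"
    using finite_near[OF X] near_smallD[THEN small_finite] by (simp add: ennreal_sum_less_top)
  finally show "emeasure (kern k w X) (space (kern k w X)) \<noteq> \<infinity>" by simp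
qed

lemma local_kernel_kern:
  assumes "local_weight k w"
  shows "local_kernel (kern k w)"
proof -
  obtain Rw where "\<forall>X Y f K z. wf_rgraph X \<longrightarrow> wf_rgraph Y \<longrightarrow>
     ball_via f X Y Rw \<longrightarrow> K \<in> at_root k X \<longrightarrow> z \<in> K \<longrightarrow>
     w Y (f ` K) (f z) = w X K z"
    using assms unfolding local_weight_def by blast
  note * = kern_cong_cylinder[OF this]
  show ?thesis
    unfolding local_kernel_def
  proof (intro conjI allI impI)
    fix R
    show "\<exists>R'. \<forall>X Y f. wf_rgraph X \<longrightarrow> wf_rgraph Y \<longrightarrow> iso_via f (rball X R') (rball Y R') \<longrightarrow>
        (\<forall>C. cylinder R C \<longrightarrow> emeasure (kern k w X) C = emeasure (kern k w Y) C)"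
      by (intro exI[of _ "Rw + 2 * (k * k) + R"] allI impI) (rule *[OF _ _ order_refl]; assumption)
  qed (simp_all add: finite_measure_kern)
qed

lemma measurable_kern:
  assumes "local_weight k w" "g \<in> borel_measurable borel"
  shows "(\<lambda>c. \<Sum>K\<in>at_root k (rep c). \<Sum>z\<in>K.
    ennreal (w (rep c) K z) * g (mark (rep c) z K)) \<in> borel_measurable borel"
  using local_kernel_measurable[OF local_kernel_kern[OF assms(1)] assms(2)]
    nn_integral_kern[OF wf_rep_rgraph assms(2)] by simp

lemma kern_rep_abs:
  assumes "local_weight k w" "g \<in> borel_measurable borel" and X: "wf_rgraph X"
  shows "(\<Sum>K\<in>at_root k (rep (abs_rgraph X)). \<Sum>z\<in>K. ennreal (w (rep (abs_rgraph X)) K z) *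
      g (mark (rep (abs_rgraph X)) z K)) =
    (\<Sum>K\<in>at_root k X. \<Sum>z\<in>K. ennreal (w X K z) * g (mark X z K))"
  using local_kernel_rep_abs[OF local_kernel_kern[OF assms(1)] X]
    nn_integral_kern[OF wf_rep_rgraph assms(2), of k w "abs_rgraph X"]
    nn_integral_kern[OF X assms(2), of k w] by simp


section \<open>Cutting along random small sets\<close>

text \<open>The rate depends on the vertex set, the edge set and K, and cannot see the root.
  Different roots of one graph therefore have literally the same clocks, which is the source of
  unimodularity of the cut graph.\<close>

definition local_rate :: "nat \<Rightarrow> (nat set \<Rightarrow> nat set set \<Rightarrow> nat set \<Rightarrow> real) \<Rightarrow> bool" where
  "local_rate k q \<longleftrightarrow> (\<forall>V E K. 0 \<le> q V E K) \<and>
     (\<exists>R. \<forall>X Y f K. wf_rgraph X \<longrightarrow> wf_rgraph Y \<longrightarrow> ball_via f X Y R \<longrightarrow>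
        K \<in> at_root k X \<longrightarrow> q (verts Y) (edges Y) (f ` K) = q (verts X) (edges X) K)"

lemma wf_reroot: "wf_rgraph X \<Longrightarrow> z \<in> verts X \<Longrightarrow> wf_rgraph (X\<lparr>origin := z\<rparr>)"
  by (simp add: wf_rgraph_def)

text \<open>K contains some x in the ball of radius r. With x as the root K belongs to
  \<open>at_root\<close>, and the move costs r in the radius.\<close>

lemma local_rate_near:
  assumes "local_rate k q"
  obtains Rq where "\<And>X Y f R r K. wf_rgraph X \<Longrightarrow> wf_rgraph Y \<Longrightarrow> ball_via f X Y R \<Longrightarrow>
    r + Rq \<le> R \<Longrightarrow> K \<in> near k r X \<Longrightarrow> q (verts Y) (edges Y) (f ` K) = q (verts X) (edges X) K"
proof -
  obtain Rq where Rq: "\<forall>X Y f K. wf_rgraph X \<longrightarrow> wf_rgraph Y \<longrightarrow> ball_via f X Y Rq \<longrightarrow>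
        K \<in> at_root k X \<longrightarrow> q (verts Y) (edges Y) (f ` K) = q (verts X) (edges X) K"
    using assms unfolding local_rate_def by blast
  show ?thesis
  proof (rule that)
    fix X Y f R r K
    assume X: "wf_rgraph X" and Y: "wf_rgraph Y" and iso: "ball_via f X Y R"
      and R: "r + Rq \<le> R" and K: "K \<in> near k r X"
    obtain x where x: "x \<in> K" "x \<in> vball X r"
      using K by (auto simp: near_def)
    have "x \<in> verts X" using x(2) ball_verts_wf[OF X] by blast
    then have X': "wf_rgraph (X\<lparr>origin := x\<rparr>)" by (rule wf_reroot[OF X])
    have "f x \<in> verts Y"
      using x(2) image_ball[OF X Y iso, of r] R ball_verts_wf[OF Y, of r] by auto
    then have Y': "wf_rgraph (Y\<lparr>origin := f x\<rparr>)" by (rule wf_reroot[OF Y])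
    have "K \<in> at_root k (X\<lparr>origin := x\<rparr>)"
      using x(1) near_smallD[OF K] by (simp add: at_root_iff)
    with Rq[rule_format, OF X' Y' rball_reroot[OF X Y iso x(2) R]]
    show "q (verts Y) (edges Y) (f ` K) = q (verts X) (edges X) K" by simp
  qed
qed

text \<open>K rings if a Poisson clock of rate q has gone off by time 1. In this parametrisation the
  probability of silence of a finite family is the exponential of minus its total rate.\<close>

definition ring_law :: "nat \<Rightarrow> (nat set \<Rightarrow> nat set set \<Rightarrow> nat set \<Rightarrow> real) \<Rightarrow> pre_rgraph \<Rightarrow>
    (nat set \<Rightarrow> bool) measure" where
  "ring_law k q X = PiM (small k X) (\<lambda>K. measure_pmf (bernoulli_pmf (1 - exp (- q (verts X) (edges X) K))))"

text \<open>The family of sets is a parameter because inside a ball the cut edges can also be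
  computed from the finite family of small sets near the root.\<close>

definition cut_edges :: "nat set set \<Rightarrow> pre_rgraph \<Rightarrow> (nat set \<Rightarrow> bool) \<Rightarrow> nat set set" where
  "cut_edges \<K> X \<omega> = {e \<in> edges X. (\<exists>K\<in>\<K>. \<omega> K \<and> e \<inter> K \<noteq> {} \<and> \<not> e \<subseteq> K) \<or>
     (\<exists>v\<in>e. \<forall>K\<in>\<K>. v \<in> K \<longrightarrow> \<not> \<omega> K)}"

definition cut_graph :: "nat set set \<Rightarrow> pre_rgraph \<Rightarrow> (nat set \<Rightarrow> bool) \<Rightarrow> pre_rgraph" where
  "cut_graph \<K> X \<omega> = X\<lparr>esets := [cut_edges \<K> X \<omega>]\<rparr>"

definition cut_law :: "nat \<Rightarrow> (nat set \<Rightarrow> nat set set \<Rightarrow> nat set \<Rightarrow> real) \<Rightarrow> pre_rgraph \<Rightarrow> rgraph measure" where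
  "cut_law k q X = distr (ring_law k q X) borel (\<lambda>\<omega>. abs_rgraph (cut_graph (small k X) X \<omega>))"

section \<open>Locality and measurability of the cut graph\<close>

lemma prob_space_ring: "prob_space (ring_law k q X)"
  unfolding ring_law_def by (intro prob_space_PiM) (rule prob_space_measure_pmf)

lemma cut_edges_cong: "(\<And>K. K \<in> \<K> \<Longrightarrow> \<omega> K = \<omega>' K) \<Longrightarrow> cut_edges \<K> X \<omega> = cut_edges \<K> X \<omega>'"
  unfolding cut_edges_def by auto

lemma wf_cut_graph: "wf_rgraph X \<Longrightarrow> wf_rgraph (cut_graph \<K> X \<omega>)"
  by (simp add: wf_rgraph_def cut_graph_def cut_edges_def)

text \<open>Whether an edge inside the R-ball is cut depends only on small sets containing one of
  its endpoints, and these meet the ball. So X may use the finite family near the root while Y uses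
  all small sets; for X = Y and the identity this is a truncation to finitely many clocks.\<close>

lemma cut_transport:
  assumes X: "wf_rgraph X" and Y: "wf_rgraph Y" and iso: "iso_via f (rball X R') (rball Y R')"
    and R: "R + 2 * (k * k) \<le> R'"
  shows "iso_via f (rball (cut_graph (near k R X) X (\<lambda>K. \<omega> (f ` K))) R)
    (rball (cut_graph (small k Y) Y \<omega>) R)"
proof -
  let ?B = "vball X R" and ?C = "vball Y R"
  let ?B' = "vball X R'"
  let ?J = "near k R X"
  have inj: "inj_on f ?B'" using inj_on_ball[OF X Y iso] .
  have BB: "?B \<subseteq> ?B'" using R by (intro ball_verts_mono) simp
  have fB: "f ` ?B = ?C" using image_ball[OF X Y iso, of R] R by simp
  have bij: "bij_betw (image f) ?J (near k R Y)" using near_transport[OF X Y iso R] .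
  have JB: "K \<subseteq> ?B'" if "K \<in> ?J" for K
    using near_sub[OF that] by (rule order_trans) (rule ball_verts_mono, use R in simp)
  have near_iff: "L \<in> near k R Y" if "L \<in> small k Y" "v \<in> L" "v \<in> ?C" for L v
    using that by (auto simp: near_def)
  have key: "f ` e \<in> cut_edges (small k Y) Y \<omega> \<longleftrightarrow> e \<in> cut_edges ?J X (\<lambda>K. \<omega> (f ` K))" if e: "e \<subseteq> ?B" for e
  proof -
    have eB': "e \<subseteq> ?B'" using e BB by blast
    have feC: "f ` e \<subseteq> ?C" using e fB by blast
    have "(\<exists>L\<in>small k Y. \<omega> L \<and> f ` e \<inter> L \<noteq> {} \<and> \<not> f ` e \<subseteq> L) \<longleftrightarrow>
        (\<exists>L\<in>near k R Y. \<omega> L \<and> f ` e \<inter> L \<noteq> {} \<and> \<not> f ` e \<subseteq> L)"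
      using near_iff near_smallD feC by fastforce
    also have "\<dots> \<longleftrightarrow> (\<exists>K\<in>?J. \<omega> (f ` K) \<and> f ` e \<inter> f ` K \<noteq> {} \<and> \<not> f ` e \<subseteq> f ` K)"
      unfolding bij_betw_imp_surj_on[OF bij, symmetric] by simp
    also have "\<dots> \<longleftrightarrow> (\<exists>K\<in>?J. \<omega> (f ` K) \<and> e \<inter> K \<noteq> {} \<and> \<not> e \<subseteq> K)"
    proof (rule bex_cong[OF refl])
      fix K assume "K \<in> ?J"
      then have "K \<subseteq> ?B'" by (rule JB)
      then show "(\<omega> (f ` K) \<and> f ` e \<inter> f ` K \<noteq> {} \<and> \<not> f ` e \<subseteq> f ` K) =
          (\<omega> (f ` K) \<and> e \<inter> K \<noteq> {} \<and> \<not> e \<subseteq> K)"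
        using inj_on_image_Int[OF inj eB'] inj_on_image_subset_iff[OF inj eB'] by (metis image_is_empty)
    qed
    finally have 1: "(\<exists>L\<in>small k Y. \<omega> L \<and> f ` e \<inter> L \<noteq> {} \<and> \<not> f ` e \<subseteq> L) \<longleftrightarrow>
        (\<exists>K\<in>?J. \<omega> (f ` K) \<and> e \<inter> K \<noteq> {} \<and> \<not> e \<subseteq> K)" .
    have "(\<forall>L\<in>small k Y. f v \<in> L \<longrightarrow> \<not> \<omega> L) \<longleftrightarrow> (\<forall>K\<in>?J. v \<in> K \<longrightarrow> \<not> \<omega> (f ` K))" if v: "v \<in> e" for v
    proof -
      have "f v \<in> ?C" using v feC by blast
      then have "(\<forall>L\<in>small k Y. f v \<in> L \<longrightarrow> \<not> \<omega> L) \<longleftrightarrow> (\<forall>L\<in>near k R Y. f v \<in> L \<longrightarrow> \<not> \<omega> L)"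
        using near_iff near_smallD by blast
      also have "\<dots> \<longleftrightarrow> (\<forall>K\<in>?J. f v \<in> f ` K \<longrightarrow> \<not> \<omega> (f ` K))"
        unfolding bij_betw_imp_surj_on[OF bij, symmetric] by simp
      also have "\<dots> \<longleftrightarrow> (\<forall>K\<in>?J. v \<in> K \<longrightarrow> \<not> \<omega> (f ` K))"
        using inj_on_image_mem_iff[OF inj] v eB' JB by (metis subsetD)
      finally show ?thesis .
    qed
    then have 2: "(\<exists>v\<in>f ` e. \<forall>L\<in>small k Y. v \<in> L \<longrightarrow> \<not> \<omega> L) \<longleftrightarrow>
        (\<exists>v\<in>e. \<forall>K\<in>?J. v \<in> K \<longrightarrow> \<not> \<omega> (f ` K))" by simp
    show ?thesis
      unfolding cut_edges_def mem_Collect_eq 1 2 in_edges_transport[OF X Y iso eB'] ..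
  qed
  have "{e \<in> cut_edges (small k Y) Y \<omega>. e \<subseteq> ?C} = image f ` {e \<in> cut_edges ?J X (\<lambda>K. \<omega> (f ` K)). e \<subseteq> ?B}"
  proof (intro equalityI subsetI)
    fix e' assume e': "e' \<in> {e \<in> cut_edges (small k Y) Y \<omega>. e \<subseteq> ?C}"
    then have "e' \<subseteq> f ` ?B" unfolding fB by simp
    then obtain e where "e \<subseteq> ?B" "e' = f ` e" by (meson subset_imageE)
    then show "e' \<in> image f ` {e \<in> cut_edges ?J X (\<lambda>K. \<omega> (f ` K)). e \<subseteq> ?B}" using key e' by simp
  next
    fix e' assume "e' \<in> image f ` {e \<in> cut_edges ?J X (\<lambda>K. \<omega> (f ` K)). e \<subseteq> ?B}"
    then obtain e where e: "e \<subseteq> ?B" "e' = f ` e" "e \<in> cut_edges ?J X (\<lambda>K. \<omega> (f ` K))" by blast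
    then have "f ` e \<subseteq> ?C" unfolding fB[symmetric] by (intro image_mono)
    then show "e' \<in> {e \<in> cut_edges (small k Y) Y \<omega>. e \<subseteq> ?C}" using e key by simp
  qed
  moreover have isoR: "ball_via f X Y R" using iso_le[OF X Y iso] R by simp
  ultimately have "iso_via f (rball (X\<lparr>vsets := vsets X, esets := [cut_edges ?J X (\<lambda>K. \<omega> (f ` K))]\<rparr>) R)
      (rball (Y\<lparr>vsets := vsets Y, esets := [cut_edges (small k Y) Y \<omega>]\<rparr>) R)"
    using isoR by (intro iso_via_remark) (simp_all add: iso_via_def rball_simps o_def)
  then show ?thesis by (simp add: cut_graph_def)
qed

lemma finite_PiM_sets:
  assumes "finite J" "A \<subseteq> space (PiM J (\<lambda>K. measure_pmf (p K)))"
  shows "A \<in> sets (PiM J (\<lambda>K. measure_pmf (p K :: 'b :: countable pmf)))"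
proof -
  have "sets (PiM J (\<lambda>K. measure_pmf (p K))) = sets (PiM J (\<lambda>_. count_space (UNIV :: 'b set)))"
    by (rule sets_PiM_cong) auto
  also have "\<dots> = Pow (PiE J (\<lambda>_. UNIV))"
    using count_space_PiM_finite[OF assms(1), of "\<lambda>_. UNIV :: 'b set"] by simp
  finally show ?thesis using assms(2) by (simp add: space_PiM)
qed

text \<open>The event factors through the clocks of the images of the small sets near the root of X,
  and these clocks have the finite product law M because the rates agree. The identity on one graph
  yields measurability; comparing the identity on X with f from X to Y yields locality of the cut
  law.\<close>

lemma ring_cylinder:
  assumes X: "wf_rgraph X" and Y: "wf_rgraph Y" and iso: "iso_via f (rball X R') (rball Y R')"
    and R: "R + 2 * (k * k) \<le> R'" and C: "cylinder R C"
    and q: "\<And>K. K \<in> near k R X \<Longrightarrow> q (verts Y) (edges Y) (f ` K) = q (verts X) (edges X) K"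
  defines "J \<equiv> near k R X"
  defines "M \<equiv> PiM J (\<lambda>K. measure_pmf (bernoulli_pmf (1 - exp (- q (verts X) (edges X) K))))"
  shows "{\<omega> \<in> space (ring_law k q Y). abs_rgraph (cut_graph (small k Y) Y \<omega>) \<in> C} \<in> sets (ring_law k q Y) \<and>
    emeasure (ring_law k q Y) {\<omega> \<in> space (ring_law k q Y). abs_rgraph (cut_graph (small k Y) Y \<omega>) \<in> C} =
    emeasure M {\<omega> \<in> space M. abs_rgraph (cut_graph J X \<omega>) \<in> C}"
proof -
  let ?MY = "\<lambda>K. measure_pmf (bernoulli_pmf (1 - exp (- q (verts Y) (edges Y) K)))"
  let ?g = "\<lambda>\<omega>. \<lambda>K\<in>J. \<omega> (f ` K) :: bool"
  let ?\<Phi> = "{\<omega> \<in> space M. abs_rgraph (cut_graph J X \<omega>) \<in> C}"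
  have bij: "bij_betw (image f) J (near k R Y)" unfolding J_def using near_transport[OF X Y iso R] .
  have M_eq: "M = PiM J (\<lambda>K. ?MY (f ` K))"
    unfolding M_def J_def by (rule PiM_cong) (auto simp: q)
  have Jf: "image f \<in> J \<rightarrow> small k Y"
  proof (rule funcsetI)
    fix K assume "K \<in> J"
    then have "f ` K \<in> image f ` J" by (rule imageI)
    then show "f ` K \<in> small k Y" unfolding bij_betw_imp_surj_on[OF bij] by (rule near_smallD)
  qed
  have g: "?g \<in> measurable (ring_law k q Y) M"
    unfolding M_eq ring_law_def
  proof (rule measurable_restrict)
    fix K assume "K \<in> J"
    then have "f ` K \<in> small k Y" using Jf by blast
    then show "(\<lambda>\<omega>. \<omega> (f ` K)) \<in> measurable (PiM (small k Y) ?MY) (?MY (f ` K))"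
      by (rule measurable_component_singleton)
  qed
  have distr: "distr (ring_law k q Y) M ?g = M"
    unfolding M_eq ring_law_def
    by (rule distr_PiM_reindex) (use bij Jf in \<open>auto simp: bij_betw_def prob_space_measure_pmf\<close>)
  have fin: "finite J" unfolding J_def using finite_near[OF X] .
  have \<Phi>: "?\<Phi> \<in> sets M" unfolding M_def by (rule finite_PiM_sets[OF fin]) auto
  have iff: "abs_rgraph (cut_graph (small k Y) Y \<omega>) \<in> C \<longleftrightarrow> abs_rgraph (cut_graph J X (?g \<omega>)) \<in> C" for \<omega>
  proof -
    have "cut_graph J X (?g \<omega>) = cut_graph J X (\<lambda>K. \<omega> (f ` K))"
      unfolding cut_graph_def by (subst cut_edges_cong[of J "?g \<omega>" "\<lambda>K. \<omega> (f ` K)"]) auto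
    then have "ball_iso (abs_rgraph (cut_graph J X (?g \<omega>))) (abs_rgraph (cut_graph (small k Y) Y \<omega>)) R"
      using cut_transport[OF X Y iso R, of \<omega>] ball_iso_abs[OF wf_cut_graph[OF X] wf_cut_graph[OF Y]]
      unfolding J_def iso_rgraph_def by metis
    then show ?thesis using cylinderD[OF C] by blast
  qed
  have eq: "{\<omega> \<in> space (ring_law k q Y). abs_rgraph (cut_graph (small k Y) Y \<omega>) \<in> C} =
      ?g -` ?\<Phi> \<inter> space (ring_law k q Y)"
    using measurable_space[OF g] unfolding iff by auto
  show ?thesis
  proof
    show "{\<omega> \<in> space (ring_law k q Y). abs_rgraph (cut_graph (small k Y) Y \<omega>) \<in> C} \<in> sets (ring_law k q Y)"
      unfolding eq using measurable_sets[OF g \<Phi>] .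
    show "emeasure (ring_law k q Y) {\<omega> \<in> space (ring_law k q Y). abs_rgraph (cut_graph (small k Y) Y \<omega>) \<in> C} =
        emeasure M ?\<Phi>"
      unfolding eq emeasure_distr[OF g \<Phi>, symmetric] distr ..
  qed
qed

lemma iso_via_id: "iso_via id X X"
  by (simp add: iso_via_def)

lemma measurable_cut_graph:
  assumes Y: "wf_rgraph Y"
  shows "(\<lambda>\<omega>. abs_rgraph (cut_graph (small k Y) Y \<omega>)) \<in> borel_measurable (ring_law k q Y)"
  by (rule measurable_rgraphI)
    (rule ring_cylinder[OF Y Y iso_via_id order_refl, THEN conjunct1], auto)

lemma prob_space_cut_law: "wf_rgraph X \<Longrightarrow> prob_space (cut_law k q X)"
  unfolding cut_law_def
  by (intro prob_space.prob_space_distr prob_space_ring measurable_cut_graph)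

lemma sets_cut_law [simp]: "sets (cut_law k q X) = sets borel"
  by (simp add: cut_law_def)

lemma space_cut_law [simp]: "space (cut_law k q X) = UNIV"
  by (simp add: cut_law_def)

lemma nn_integral_cut_law:
  assumes "wf_rgraph X" "g \<in> borel_measurable borel"
  shows "(\<integral>\<^sup>+d. g d \<partial>cut_law k q X) =
    (\<integral>\<^sup>+\<omega>. g (abs_rgraph (cut_graph (small k X) X \<omega>)) \<partial>ring_law k q X)"
  unfolding cut_law_def by (rule nn_integral_distr[OF measurable_cut_graph[OF assms(1)]]) (use assms(2) in simp)

lemma local_kernel_cut_law:
  assumes "local_rate k q"
  shows "local_kernel (cut_law k q)"
  unfolding local_kernel_def
proof (intro conjI allI impI)
  fix R
  obtain Rq where Rq: "\<And>X Y f R r K. wf_rgraph X \<Longrightarrow> wf_rgraph Y \<Longrightarrow> ball_via f X Y R \<Longrightarrow>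
      r + Rq \<le> R \<Longrightarrow> K \<in> near k r X \<Longrightarrow> q (verts Y) (edges Y) (f ` K) = q (verts X) (edges X) K"
    using local_rate_near[OF assms] by blast
  let ?R' = "R + 2 * (k * k) + Rq"
  have "emeasure (cut_law k q X) C = emeasure (cut_law k q Y) C"
    if X: "wf_rgraph X" and Y: "wf_rgraph Y" and iso: "iso_via f (rball X ?R') (rball Y ?R')"
      and C: "cylinder R C" for X Y f C
  proof -
    have em: "emeasure (cut_law k q Z) C =
        emeasure (ring_law k q Z) {\<omega> \<in> space (ring_law k q Z). abs_rgraph (cut_graph (small k Z) Z \<omega>) \<in> C}"
      if "wf_rgraph Z" for Z
      unfolding cut_law_def using C measurable_cut_graph[OF that]
      by (subst emeasure_distr) (auto simp: vimage_def Int_def conj_commute)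
    have "q (verts Y) (edges Y) (f ` K) = q (verts X) (edges X) K" if "K \<in> near k R X" for K
      using Rq[OF X Y iso _ that] by simp
    then show ?thesis
      unfolding em[OF X] em[OF Y]
      using ring_cylinder[OF X Y iso _ C, where q=q and k=k, THEN conjunct2]
        ring_cylinder[OF X X iso_via_id order_refl C, where q=q and k=k, THEN conjunct2]
      by simp
  qed
  then show "\<exists>R'. \<forall>X Y f. wf_rgraph X \<longrightarrow> wf_rgraph Y \<longrightarrow> iso_via f (rball X R') (rball Y R') \<longrightarrow>
      (\<forall>C. cylinder R C \<longrightarrow> emeasure (cut_law k q X) C = emeasure (cut_law k q Y) C)"
    by blast
qed (auto dest: prob_space_cut_law intro: prob_space.finite_measure)

lemma cut_graph_components:
  assumes "0 < k" "v \<in> verts X"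
  shows "finite {w. (v, w) \<in> (adj (edges X - cut_edges (small k X) X \<omega>))\<^sup>*} \<and>
    card {w. (v, w) \<in> (adj (edges X - cut_edges (small k X) X \<omega>))\<^sup>*} \<le> k"
proof (cases "\<exists>K\<in>small k X. \<omega> K \<and> v \<in> K")
  case True
  then obtain K where K: "K \<in> small k X" "\<omega> K" "v \<in> K" by blast
  have "w \<in> K" if "(v, w) \<in> (adj (edges X - cut_edges (small k X) X \<omega>))\<^sup>*" for w
    using that
  proof (induction rule: rtrancl_induct)
    case (step u w)
    then have e: "{u, w} \<in> edges X" "{u, w} \<notin> cut_edges (small k X) X \<omega>" by (auto simp: adj_def)
    then have "\<not> ({u, w} \<inter> K \<noteq> {} \<and> \<not> {u, w} \<subseteq> K)" using K unfolding cut_edges_def by blast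
    then show ?case using step.IH by blast
  qed (use K in simp)
  then have "{w. (v, w) \<in> (adj (edges X - cut_edges (small k X) X \<omega>))\<^sup>*} \<subseteq> K" by blast
  moreover have "finite K" "card K \<le> k" using K by (auto simp: small_def)
  ultimately show ?thesis by (meson card_mono finite_subset le_trans)
next
  case False
  have "w = v" if "(v, w) \<in> (adj (edges X - cut_edges (small k X) X \<omega>))\<^sup>*" for w
    using that
  proof (induction rule: rtrancl_induct)
    case (step u w)
    then have "{v, w} \<in> edges X" "{v, w} \<notin> cut_edges (small k X) X \<omega>" by (auto simp: adj_def)
    then show ?case using False unfolding cut_edges_def by blast
  qed simp
  then have "{w. (v, w) \<in> (adj (edges X - cut_edges (small k X) X \<omega>))\<^sup>*} = {v}" by blast
  then show ?thesis using assms(1) by simp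
qed

lemma finite_small_at: "wf_rgraph X \<Longrightarrow> v \<in> verts X \<Longrightarrow> finite {K \<in> small k X. v \<in> K}"
  using finite_near[OF wf_reroot, of X v k 0] by (simp add: at_root_iff Collect_conj_eq[symmetric] near_def ball_verts_0)

section \<open>Probabilities of ringing and of silence\<close>

lemma emeasure_ring_single:
  assumes "K \<in> small k X" "0 \<le> q (verts X) (edges X) K"
  shows "{\<omega> \<in> space (ring_law k q X). \<omega> K} \<in> sets (ring_law k q X)"
    "emeasure (ring_law k q X) {\<omega> \<in> space (ring_law k q X). \<omega> K} \<le> ennreal (q (verts X) (edges X) K)"
proof -
  let ?p = "\<lambda>K. bernoulli_pmf (1 - exp (- q (verts X) (edges X) K))"
  interpret product_prob_space "\<lambda>K. measure_pmf (?p K)" "small k X"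
    by standard
  have "emeasure (ring_law k q X) {\<omega> \<in> space (ring_law k q X). \<omega> K \<in> {True}} = emeasure (measure_pmf (?p K)) {True}"
    unfolding ring_law_def by (rule emeasure_PiM_Collect_single) (use assms in auto)
  also have "\<dots> = ennreal (1 - exp (- q (verts X) (edges X) K))"
    using assms(2) by (simp add: emeasure_pmf_single)
  also have "\<dots> \<le> ennreal (q (verts X) (edges X) K)"
    using exp_ge_add_one_self[of "- q (verts X) (edges X) K"] by (intro ennreal_leI) linarith
  finally show "emeasure (ring_law k q X) {\<omega> \<in> space (ring_law k q X). \<omega> K} \<le> ennreal (q (verts X) (edges X) K)"
    by simp
  have "(\<lambda>\<omega>. \<omega> K) \<in> measurable (ring_law k q X) (measure_pmf (?p K))"
    unfolding ring_law_def using assms(1) by (rule measurable_component_singleton)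
  from measurable_sets[OF this, of "{True}"]
  show "{\<omega> \<in> space (ring_law k q X). \<omega> K} \<in> sets (ring_law k q X)"
    by (simp add: vimage_def Int_def conj_commute)
qed

lemma emeasure_ring_none:
  assumes "J \<subseteq> small k X" "finite J" "\<And>K. K \<in> J \<Longrightarrow> 0 \<le> q (verts X) (edges X) K"
  shows "{\<omega> \<in> space (ring_law k q X). \<forall>K\<in>J. \<not> \<omega> K} \<in> sets (ring_law k q X)"
    "emeasure (ring_law k q X) {\<omega> \<in> space (ring_law k q X). \<forall>K\<in>J. \<not> \<omega> K} =
      ennreal (exp (- (\<Sum>K\<in>J. q (verts X) (edges X) K)))"
proof -
  let ?p = "\<lambda>K. bernoulli_pmf (1 - exp (- q (verts X) (edges X) K))"
  interpret product_prob_space "\<lambda>K. measure_pmf (?p K)" "small k X"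
    by standard
  have "emeasure (ring_law k q X) {\<omega> \<in> space (ring_law k q X). \<forall>K\<in>J. \<omega> K \<in> {False}} =
      (\<Prod>K\<in>J. emeasure (measure_pmf (?p K)) {False})"
    unfolding ring_law_def by (rule emeasure_PiM_Collect) (use assms in auto)
  also have "\<dots> = (\<Prod>K\<in>J. ennreal (exp (- q (verts X) (edges X) K)))"
    using assms(3) by (intro prod.cong refl) (simp add: emeasure_pmf_single)
  also have "\<dots> = ennreal (exp (- (\<Sum>K\<in>J. q (verts X) (edges X) K)))"
    using assms(2) by (simp add: prod_ennreal exp_sum sum_negf[symmetric])
  finally show "emeasure (ring_law k q X) {\<omega> \<in> space (ring_law k q X). \<forall>K\<in>J. \<not> \<omega> K} =
      ennreal (exp (- (\<Sum>K\<in>J. q (verts X) (edges X) K)))" by simp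
  have "{\<omega> \<in> space (ring_law k q X). \<not> \<omega> K} \<in> sets (ring_law k q X)" if "K \<in> J" for K
  proof -
    have "{\<omega> \<in> space (ring_law k q X). \<not> \<omega> K} = space (ring_law k q X) - {\<omega> \<in> space (ring_law k q X). \<omega> K}" by blast
    then show ?thesis using emeasure_ring_single(1)[of K k X q] assms that by auto
  qed
  then show "{\<omega> \<in> space (ring_law k q X). \<forall>K\<in>J. \<not> \<omega> K} \<in> sets (ring_law k q X)"
    using assms(2) by (intro sets.sets_Collect_finite_All) auto
qed


section \<open>Components\<close>

text \<open>The junk value \<open>{}\<close> for a graph without marked edges keeps all notions below local.\<close>

definition cutset :: "pre_rgraph \<Rightarrow> nat set set" where
  "cutset X = (if esets X = [] then {} else hd (esets X))"

definition root_comp :: "pre_rgraph \<Rightarrow> nat set" where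
  "root_comp X = {w. (origin X, w) \<in> (adj (edges X - cutset X))\<^sup>*}"

lemma reach_eq_balls: "{w. (a, w) \<in> (adj E)\<^sup>*} = (\<Union>r. ball_verts E a r)"
  unfolding ball_verts_def by (auto simp: rtrancl_power)

lemma adj_sym: "(u, v) \<in> adj E \<longleftrightarrow> (v, u) \<in> adj E"
  by (simp add: adj_def insert_commute)

lemma sym_reach: "(u, v) \<in> (adj E)\<^sup>* \<Longrightarrow> (v, u) \<in> (adj E)\<^sup>*"
  by (rule symD[OF sym_rtrancl]) (auto intro!: symI simp: adj_sym)

lemma comp_refl: "origin X \<in> root_comp X"
  by (simp add: root_comp_def)

text \<open>If the component computed inside the R-ball is K, no surviving edge leaves K, since it
  would end within distance r + 1 and so lie in the ball. Conversely, if the true component is K,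
  its paths lie in the ball.\<close>

lemma comp_local:
  assumes "K \<subseteq> vball X r" "Suc r \<le> R"
  shows "root_comp X = K \<longleftrightarrow>
    (\<Union>s. ball_verts {e \<in> edges X - cutset X. e \<subseteq> vball X R} (origin X) s) = K"
proof -
  let ?B = "vball X R"
  let ?E = "edges X - cutset X" and ?F = "{e \<in> edges X - cutset X. e \<subseteq> ?B}"
  let ?C = "{w. (origin X, w) \<in> (adj ?F)\<^sup>*}"
  have KB: "K \<subseteq> ?B" using assms ball_verts_mono[of r R] by (meson Suc_leD subset_trans)
  have CF: "?C \<subseteq> root_comp X"
    unfolding root_comp_def using rtrancl_mono[of "adj ?F" "adj ?E"] by (auto simp: adj_def)
  have 1: "root_comp X \<subseteq> K" if C: "?C = K"
  proof
    fix w assume "w \<in> root_comp X"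
    then have "(origin X, w) \<in> (adj ?E)\<^sup>*" by (simp add: root_comp_def)
    then have "w \<in> ?C"
    proof (induction rule: rtrancl_induct)
      case (step u w)
      have u: "u \<in> vball X r" using step.IH C assms(1) by blast
      have e: "{u, w} \<in> ?E" using step.hyps(2) by (simp add: adj_def)
      then have "w \<in> vball X (Suc r)" using u unfolding ball_verts_Suc by blast
      then have "{u, w} \<subseteq> ?B"
        using u ball_verts_mono[OF assms(2), of "edges X" "origin X"] ball_verts_mono[of r R "edges X" "origin X"] assms(2)
        by auto
      then have "(u, w) \<in> adj ?F" using e by (simp add: adj_def)
      then show ?case using step.IH by (simp add: rtrancl.rtrancl_into_rtrancl)
    qed simp
    then show "w \<in> K" using C by blast
  qed
  have 2: "root_comp X \<subseteq> ?C" if C: "root_comp X = K"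
  proof
    fix w assume "w \<in> root_comp X"
    then have "(origin X, w) \<in> (adj ?E)\<^sup>*" by (simp add: root_comp_def)
    then show "w \<in> ?C"
    proof (induction rule: rtrancl_induct)
      case (step u w)
      have "u \<in> root_comp X" "w \<in> root_comp X"
        using step.hyps by (auto simp: root_comp_def intro: rtrancl.rtrancl_into_rtrancl)
      then have "{u, w} \<subseteq> ?B" using C KB by blast
      then have "(u, w) \<in> adj ?F" using step.hyps(2) by (simp add: adj_def)
      then show ?case using step.IH by (simp add: rtrancl.rtrancl_into_rtrancl)
    qed simp
  qed
  show ?thesis unfolding reach_eq_balls[symmetric] using 1 2 CF by blast
qed

lemma cutset_transport:
  assumes "ball_via f X Y R"
  shows "{e \<in> cutset Y. e \<subseteq> vball Y R} =
    image f ` {e \<in> cutset X. e \<subseteq> vball X R}"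
proof -
  have m: "map (\<lambda>S. {e \<in> S. e \<subseteq> vball Y R}) (esets Y) =
      map (\<lambda>S. image f ` {e \<in> S. e \<subseteq> vball X R}) (esets X)"
    using assms unfolding iso_via_def rball_simps map_map o_def by (elim conjE)
  show ?thesis
    using m by (cases "esets X"; cases "esets Y") (auto simp: cutset_def)
qed

lemma comp_transport:
  assumes X: "wf_rgraph X" and Y: "wf_rgraph Y" and iso: "ball_via f X Y R"
    and K: "K \<subseteq> vball X r" "Suc r \<le> R"
  shows "root_comp Y = f ` K \<longleftrightarrow> root_comp X = K"
proof -
  let ?B = "vball X R" and ?C = "vball Y R"
  let ?E = "{e \<in> edges X - cutset X. e \<subseteq> ?B}" and ?F = "{e \<in> edges Y - cutset Y. e \<subseteq> ?C}"
  have inj: "inj_on f ?B" using inj_on_ball[OF X Y iso] .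
  have injP: "inj_on (image f) (Pow ?B)" using inj by (rule inj_on_image_Pow)
  have "?F = {e \<in> edges Y. e \<subseteq> ?C} - {e \<in> cutset Y. e \<subseteq> ?C}" by blast
  also have "\<dots> = image f ` {e \<in> edges X. e \<subseteq> ?B} - image f ` {e \<in> cutset X. e \<subseteq> ?B}"
    unfolding edges_transport[OF X Y iso] cutset_transport[OF iso] ..
  also have "\<dots> = image f ` ({e \<in> edges X. e \<subseteq> ?B} - {e \<in> cutset X. e \<subseteq> ?B})"
    by (rule inj_on_image_set_diff[OF injP, symmetric]) auto
  also have "{e \<in> edges X. e \<subseteq> ?B} - {e \<in> cutset X. e \<subseteq> ?B} = ?E" by blast
  finally have FE: "?F = image f ` ?E" .
  have oB: "origin X \<in> ?B" by (rule ball_verts_center)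
  have "(\<Union>s. ball_verts ?F (origin Y) s) = f ` (\<Union>s. ball_verts ?E (origin X) s)"
    unfolding FE unfolding origin_transport[OF X Y iso] image_UN
    using ball_verts_image[OF inj oB, of ?E] by simp
  moreover have "(\<Union>s. ball_verts ?E (origin X) s) \<subseteq> ?B"
    using ball_verts_subset[OF oB, of ?E] by blast
  moreover have KB: "K \<subseteq> ?B" using K ball_verts_mono[of r R] by (meson Suc_leD subset_trans)
  ultimately have "(\<Union>s. ball_verts ?F (origin Y) s) = f ` K \<longleftrightarrow> (\<Union>s. ball_verts ?E (origin X) s) = K"
    using inj_on_image_eq_iff[OF inj] by simp
  moreover have "f ` K \<subseteq> vball Y r"
    using image_mono[OF K(1), of f] image_ball[OF X Y iso, of r] K(2) by simp
  ultimately show ?thesis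
    using comp_local[OF K] comp_local[of "f ` K" Y r R] K(2) by simp
qed

text \<open>The component is closed under surviving edges, so paths between its vertices stay inside
  it, and a path can be shortened to at most as many steps as there are ordered adjacent
  pairs.\<close>

lemma comp_small:
  assumes X: "wf_rgraph X" and fin: "finite (root_comp X)" "card (root_comp X) \<le> k"
  shows "root_comp X \<in> at_root k X"
proof -
  let ?C = "root_comp X" and ?E = "edges X - cutset X"
  have CV: "?C \<subseteq> verts X"
  proof
    fix w assume "w \<in> ?C"
    then have "(origin X, w) \<in> (adj ?E)\<^sup>*" by (simp add: root_comp_def)
    then show "w \<in> verts X"
      by (induction rule: rtrancl_induct) (use X in \<open>auto simp: adj_def wf_rgraph_def\<close>)
  qed
  have closed: "w \<in> ?C" if "u \<in> ?C" "(u, w) \<in> adj ?E" for u w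
    using that by (auto simp: root_comp_def intro: rtrancl.rtrancl_into_rtrancl)
  have "?C \<subseteq> ball_verts (edges X) x (k * k)" if x: "x \<in> ?C" for x
  proof
    fix y assume "y \<in> ?C"
    let ?r = "adj ?E \<inter> ?C \<times> ?C"
    have "(x, y) \<in> (adj ?E)\<^sup>*"
      using x \<open>y \<in> ?C\<close> sym_reach unfolding root_comp_def by (metis mem_Collect_eq rtrancl_trans)
    then have "y \<in> ?C \<and> (x, y) \<in> ?r\<^sup>*"
    proof (induction rule: rtrancl_induct)
      case (step u w)
      then have "w \<in> ?C" "(u, w) \<in> ?r" using closed by auto
      then show ?case using step.IH by (meson rtrancl.rtrancl_into_rtrancl)
    qed (use x in simp)
    moreover have fr: "finite ?r" using fin(1) by simp
    ultimately obtain n where n: "n \<le> card ?r" "(x, y) \<in> ?r ^^ n"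
      using rtrancl_finite_eq_relpow[OF fr] by auto
    have "card ?r \<le> card (?C \<times> ?C)" using fin(1) by (intro card_mono) auto
    also have "\<dots> \<le> k * k" using fin(2) by (simp add: card_cartesian_product mult_le_mono)
    finally have "n \<le> k * k" using n(1) by simp
    moreover have "(x, y) \<in> adj (edges X) ^^ n"
      using n(2) relpowp_mono[to_set, of ?r "adj (edges X)"] by (auto simp: adj_def)
    ultimately show "y \<in> ball_verts (edges X) x (k * k)" by (auto simp: ball_verts_def)
  qed
  then show ?thesis using fin CV comp_refl by (simp add: at_root_iff small_def)
qed

definition comps_le :: "nat \<Rightarrow> pre_rgraph \<Rightarrow> bool" where
  "comps_le k X \<longleftrightarrow> (\<forall>v\<in>verts X. finite (root_comp (X\<lparr>origin := v\<rparr>)) \<and> card (root_comp (X\<lparr>origin := v\<rparr>)) \<le> k)"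

text \<open>Membership in \<open>at_root\<close> is recognised in a ball of bounded radius, so the
  bound on all components becomes a countable intersection of local conditions. This gives
  measurability and independence of the representative.\<close>

lemma comps_le_iff_local:
  assumes "wf_rgraph X"
  shows "comps_le k X \<longleftrightarrow>
    (\<forall>r. \<forall>v\<in>vball X r. root_comp (X\<lparr>origin := v\<rparr>) \<in> at_root k (X\<lparr>origin := v\<rparr>))"
proof -
  have "finite (root_comp (X\<lparr>origin := v\<rparr>)) \<and> card (root_comp (X\<lparr>origin := v\<rparr>)) \<le> k \<longleftrightarrow>
      root_comp (X\<lparr>origin := v\<rparr>) \<in> at_root k (X\<lparr>origin := v\<rparr>)" if "v \<in> verts X" for v
    using comp_small[OF wf_reroot[OF assms that]] by (auto simp: near_def small_def)
  then show ?thesis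
    unfolding comps_le_def using verts_in_ball[OF assms] ball_verts_wf[OF assms] by blast
qed

lemma local_fun_comps:
  "local_fun (\<lambda>X. \<forall>v\<in>vball X r.
    root_comp (X\<lparr>origin := v\<rparr>) \<in> at_root k (X\<lparr>origin := v\<rparr>))"
  unfolding local_fun_def
proof (intro exI[of _ "r + (2 * (k * k) + 1)"] allI impI)
  fix X Y f
  let ?R = "r + (2 * (k * k) + 1)"
  assume X: "wf_rgraph X" and Y: "wf_rgraph Y" and iso: "ball_via f X Y ?R"
  have "root_comp (X\<lparr>origin := v\<rparr>) \<in> at_root k (X\<lparr>origin := v\<rparr>) \<longleftrightarrow>
      root_comp (Y\<lparr>origin := f v\<rparr>) \<in> at_root k (Y\<lparr>origin := f v\<rparr>)"
    if v: "v \<in> vball X r" for v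
  proof -
    let ?X = "X\<lparr>origin := v\<rparr>" and ?Y = "Y\<lparr>origin := f v\<rparr>"
    have "v \<in> verts X" using v ball_verts_wf[OF X] by blast
    then have X': "wf_rgraph ?X" by (rule wf_reroot[OF X])
    have "f v \<in> verts Y" using v image_ball[OF X Y iso, of r] ball_verts_wf[OF Y, of r] by auto
    then have Y': "wf_rgraph ?Y" by (rule wf_reroot[OF Y])
    have iso': "ball_via f ?X ?Y (2 * (k * k) + 1)"
      by (rule rball_reroot[OF X Y iso v]) simp
    have bij: "image f ` at_root k ?X = at_root k ?Y"
      using near_transport[OF X' Y' iso', of 0 k] by (simp add: bij_betw_def)
    have "root_comp ?Y = f ` K \<longleftrightarrow> root_comp ?X = K" if "K \<in> at_root k ?X" for K
      by (rule comp_transport[OF X' Y' iso' near_sub[OF that]]) simp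
    then show ?thesis unfolding bij[symmetric] by blast
  qed
  moreover have "vball Y r = f ` vball X r"
    using image_ball[OF X Y iso, of r] by simp
  ultimately show "(\<forall>v\<in>vball X r. root_comp (X\<lparr>origin := v\<rparr>) \<in> at_root k (X\<lparr>origin := v\<rparr>)) =
      (\<forall>v\<in>vball Y r. root_comp (Y\<lparr>origin := v\<rparr>) \<in> at_root k (Y\<lparr>origin := v\<rparr>))"
    by simp
qed

lemma comps_le_rep_abs: "wf_rgraph X \<Longrightarrow> comps_le k (rep (abs_rgraph X)) = comps_le k X"
  using local_fun_rep_abs[OF local_fun_comps] by (simp add: comps_le_iff_local wf_rep_rgraph)

lemma sets_comps_le: "{c. comps_le k (rep c)} \<in> sets borel"
proof -
  have "(\<lambda>c. \<forall>v\<in>vball (rep c) r.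
      root_comp (rep c\<lparr>origin := v\<rparr>) \<in> at_root k (rep c\<lparr>origin := v\<rparr>))
      \<in> measurable borel (count_space UNIV)" for r
    using measurable_local_fun[OF local_fun_comps, where N="count_space UNIV"] by simp
  then have "(\<lambda>c. \<forall>r. \<forall>v\<in>vball (rep c) r.
      root_comp (rep c\<lparr>origin := v\<rparr>) \<in> at_root k (rep c\<lparr>origin := v\<rparr>))
      \<in> measurable borel (count_space UNIV)"
    by (rule pred_intros_countable(1))
  then show ?thesis
    using comps_le_iff_local[OF wf_rep_rgraph] by (simp add: pred_def)
qed

lemma comps_le_components:
  assumes "esets X \<noteq> []"
  shows "comps_le k X \<longleftrightarrow>
    (\<forall>C\<in>components (verts X) (edges X - hd (esets X)). finite C \<and> card C \<le> k)"
  using assms by (auto simp: comps_le_def components_def root_comp_def cutset_def)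

lemma comp_eq_of_mem: "x \<in> root_comp X \<Longrightarrow> root_comp (X\<lparr>origin := x\<rparr>) = root_comp X"
  unfolding root_comp_def cutset_def by (auto intro: rtrancl_trans dest: sym_reach)


section \<open>Mass transport between the vertices of a small set\<close>

lemma hd_vsets_transport:
  assumes "ball_via f X Y R"
  shows "length (vsets Y) = length (vsets X)"
    "vsets X \<noteq> [] \<Longrightarrow> hd (vsets Y) \<inter> vball Y R =
      f ` (hd (vsets X) \<inter> vball X R)"
proof -
  have m: "map (\<lambda>A. A \<inter> vball Y R) (vsets Y) =
      map (\<lambda>A. f ` (A \<inter> vball X R)) (vsets X)"
    using assms unfolding iso_via_def rball_simps map_map o_def by (elim conjE)
  show "length (vsets Y) = length (vsets X)" using arg_cong[OF m, of length] by simp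
  show "hd (vsets Y) \<inter> vball Y R =
      f ` (hd (vsets X) \<inter> vball X R)" if "vsets X \<noteq> []"
    using m that by (cases "vsets X"; cases "vsets Y") auto
qed

text \<open>Recovers K from a graph in which it is marked. The mark is intersected with a ball so
  that the test is local for arbitrary marks; a small K containing the root lies within distance k *
  k, so nothing of it is lost.\<close>

definition avg_weight :: "nat \<Rightarrow> pre_rgraph \<Rightarrow> nat set \<Rightarrow> nat \<Rightarrow> real" where
  "avg_weight k X K z = (if length (vsets X) = 1 \<and>
     hd (vsets X) \<inter> vball X (k * k) = K then 1 / real (card K) else 0)"

text \<open>Used on (G, x, y), where the marked vertex set is {y}; the condition on z then says z =
  y.\<close>

definition pair_weight :: "(rgraph \<Rightarrow> real) \<Rightarrow> pre_rgraph \<Rightarrow> nat set \<Rightarrow> nat \<Rightarrow> real" where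
  "pair_weight h X K z = (if length (vsets X) = 1 \<and> z \<in> hd (vsets X)
     then h (rmark X K) / real (card K) else 0)"

definition comp_weight :: "pre_rgraph \<Rightarrow> nat set \<Rightarrow> nat \<Rightarrow> real" where
  "comp_weight X K z = (if z = origin X \<and> root_comp X = K then 1 else 0)"

text \<open>Used on (G, S, x, y): the component K of x has to contain the second root y.\<close>

definition comp_pair_weight :: "pre_rgraph \<Rightarrow> nat set \<Rightarrow> nat \<Rightarrow> real" where
  "comp_pair_weight X K z = (if z = origin X \<and> root_comp X = K \<and> length (vsets X) = 1 \<and>
     hd (vsets X) \<inter> K \<noteq> {} then 1 / real (card K) else 0)"

definition root_weight :: "nat \<Rightarrow> pre_rgraph \<Rightarrow> nat set \<Rightarrow> nat \<Rightarrow> real" where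
  "root_weight k X K z = (if z = origin X then 1 / real (card (at_root k X)) else 0)"

context
  fixes X Y :: pre_rgraph and f :: "nat \<Rightarrow> nat" and R k :: nat and K :: "nat set"
  assumes X: "wf_rgraph X" and Y: "wf_rgraph Y" and iso: "ball_via f X Y R"
    and R: "2 * (k * k) + 1 \<le> R" and K: "K \<in> at_root k X"
begin

lemma K_sub: "K \<subseteq> vball X R"
  using near_sub[OF K] ball_verts_mono[of "0 + k * k" R] R by fastforce

lemma K_inj: "inj_on f K"
  using inj_on_subset[OF inj_on_ball[OF X Y iso] K_sub] .

lemma K_card: "card (f ` K) = card K"
  using card_image[OF K_inj] .

lemma K_origin: "z \<in> K \<Longrightarrow> f z = origin Y \<longleftrightarrow> z = origin X"
  using K_inj K unfolding origin_transport[OF X Y iso] by (auto simp: at_root_iff inj_on_def)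

lemma K_comp: "root_comp Y = f ` K \<longleftrightarrow> root_comp X = K"
  using comp_transport[OF X Y iso near_sub[OF K]] R by simp

lemma K_hd: "z \<in> K \<Longrightarrow> vsets X \<noteq> [] \<Longrightarrow> f z \<in> hd (vsets Y) \<longleftrightarrow> z \<in> hd (vsets X)"
proof -
  assume z: "z \<in> K" and ne: "vsets X \<noteq> []"
  let ?B = "vball X R" and ?C = "vball Y R"
  have zB: "z \<in> ?B" using z K_sub by blast
  have "f z \<in> ?C" using imageI[OF zB, of f] image_ball[OF X Y iso, of R] by simp
  then have "f z \<in> hd (vsets Y) \<longleftrightarrow> f z \<in> f ` (hd (vsets X) \<inter> ?B)"
    using hd_vsets_transport(2)[OF iso ne] by blast
  also have "\<dots> \<longleftrightarrow> z \<in> hd (vsets X) \<inter> ?B"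
    by (rule inj_on_image_mem_iff[OF inj_on_ball[OF X Y iso] zB]) simp
  finally show ?thesis using zB by simp
qed

lemma K_hd_int: "vsets X \<noteq> [] \<Longrightarrow> hd (vsets Y) \<inter> f ` K \<noteq> {} \<longleftrightarrow> hd (vsets X) \<inter> K \<noteq> {}"
  using K_hd by blast

lemma K_hd_ball: "vsets X \<noteq> [] \<Longrightarrow> hd (vsets Y) \<inter> vball Y (k * k) = f ` K \<longleftrightarrow>
    hd (vsets X) \<inter> vball X (k * k) = K"
proof -
  assume ne: "vsets X \<noteq> []"
  have kR: "k * k \<le> R" using R by simp
  have "hd (vsets Y) \<inter> vball Y (k * k) =
      f ` (hd (vsets X) \<inter> vball X (k * k))"
    using hd_vsets_transport(2)[OF iso_le[OF X Y iso kR] ne] .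
  moreover have "hd (vsets X) \<inter> vball X (k * k) \<subseteq> vball X R"
    using ball_verts_mono[OF kR] by blast
  ultimately show ?thesis using inj_on_image_eq_iff[OF inj_on_ball[OF X Y iso] _ K_sub] by simp
qed

lemma K_at_root_card: "card (at_root k Y) = card (at_root k X)"
  using bij_betw_same_card[OF near_transport[OF X Y iso, of 0 k]] R by simp

lemma K_mark:
  assumes "2 * (k * k) + 1 + s \<le> R" "z \<in> K"
  shows "ball_iso (mark X z K) (mark Y (f z) (f ` K)) s"
  by (rule ball_iso_mark[OF X Y iso _ _ K_sub, of z "k * k"]) (use near_sub[OF K] assms in auto)

end

lemma local_weight_avg: "local_weight k (avg_weight k)"
  unfolding local_weight_def
proof (intro exI[of _ "2 * (k * k) + 1"] allI impI)
  fix X Y f K z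
  assume *: "wf_rgraph X" "wf_rgraph Y"
    "ball_via f X Y (2 * (k * k) + 1)" "K \<in> at_root k X" "z \<in> K"
  show "avg_weight k Y (f ` K) (f z) = avg_weight k X K z"
  proof (cases "length (vsets X) = 1")
    case True
    then have "vsets X \<noteq> []" by auto
    then show ?thesis
      using hd_vsets_transport(1)[OF *(3)] K_hd_ball[OF *(1-3) order_refl *(4)]
      K_card[OF *(1-3) order_refl *(4)]
      by (simp add: avg_weight_def)
  next
    case False
    then show ?thesis using hd_vsets_transport(1)[OF *(3)] by (simp add: avg_weight_def)
  qed
qed

lemma local_weight_comp: "local_weight k comp_weight"
  unfolding local_weight_def
proof (intro exI[of _ "2 * (k * k) + 1"] allI impI)
  fix X Y f K z
  assume *: "wf_rgraph X" "wf_rgraph Y"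
    "ball_via f X Y (2 * (k * k) + 1)" "K \<in> at_root k X" "z \<in> K"
  show "comp_weight Y (f ` K) (f z) = comp_weight X K z"
    using K_comp[OF *(1-3) order_refl *(4)] K_origin[OF *(1-3) order_refl *(4,5)]
    unfolding comp_weight_def by simp
qed

lemma local_weight_comp_pair: "local_weight k comp_pair_weight"
  unfolding local_weight_def
proof (intro exI[of _ "2 * (k * k) + 1"] allI impI)
  fix X Y f K z
  assume *: "wf_rgraph X" "wf_rgraph Y"
    "ball_via f X Y (2 * (k * k) + 1)" "K \<in> at_root k X" "z \<in> K"
  show "comp_pair_weight Y (f ` K) (f z) = comp_pair_weight X K z"
  proof (cases "length (vsets X) = 1")
    case True
    then have "vsets X \<noteq> []" by auto
    then show ?thesis
      using K_comp[OF *(1-3) order_refl *(4)] K_origin[OF *(1-3) order_refl *(4,5)]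
      hd_vsets_transport(1)[OF *(3)] K_hd_int[OF *(1-3) order_refl *(4)] K_card[OF *(1-3) order_refl *(4)]
      by (simp add: comp_pair_weight_def)
  next
    case False
    then show ?thesis using hd_vsets_transport(1)[OF *(3)] by (simp add: comp_pair_weight_def)
  qed
qed

lemma local_weight_root: "local_weight k (root_weight k)"
  unfolding local_weight_def
proof (intro exI[of _ "2 * (k * k) + 1"] allI impI)
  fix X Y f K z
  assume *: "wf_rgraph X" "wf_rgraph Y"
    "ball_via f X Y (2 * (k * k) + 1)" "K \<in> at_root k X" "z \<in> K"
  show "root_weight k Y (f ` K) (f z) = root_weight k X K z"
    using K_at_root_card[OF *(1-3) order_refl *(4)] K_origin[OF *(1-3) order_refl *(4,5)]
    unfolding root_weight_def by simp
qed

lemma local_weight_pair: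
  assumes h: "\<And>c d. ball_iso c d R \<Longrightarrow> h c = h d"
  shows "local_weight k (pair_weight h)"
  unfolding local_weight_def
proof (intro exI[of _ "2 * (k * k) + 1 + R"] allI impI)
  fix X Y f K z
  let ?R = "2 * (k * k) + 1 + R"
  assume *: "wf_rgraph X" "wf_rgraph Y"
    "ball_via f X Y ?R" "K \<in> at_root k X" "z \<in> K"
  have R: "2 * (k * k) + 1 \<le> ?R" by simp
  have "origin X \<in> K" using *(4) by (simp add: at_root_iff)
  then have prem: "h (rmark X K) = h (rmark Y (f ` K))"
    using h[OF K_mark[OF *(1-3) R *(4) order_refl]] origin_transport[OF *(1-3)] by simp
  show "pair_weight h Y (f ` K) (f z) = pair_weight h X K z"
  proof (cases "length (vsets X) = 1")
    case True
    then have "vsets X \<noteq> []" by auto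
    then show ?thesis
      using prem hd_vsets_transport(1)[OF *(3)] K_hd[OF *(1-3) R *(4,5)] K_card[OF *(1-3) R *(4)]
      by (simp add: pair_weight_def)
  next
    case False
    then show ?thesis using hd_vsets_transport(1)[OF *(3)] by (simp add: pair_weight_def)
  qed
qed

text \<open>On a graph marked with a small set K at the root this is the mean of g over all choices
  of the root in K, see \<open>avg_mark\<close>. The detour through \<open>avg_weight\<close> makes
  it a Borel function on classes.\<close>

definition avg :: "nat \<Rightarrow> (rgraph \<Rightarrow> ennreal) \<Rightarrow> rgraph \<Rightarrow> ennreal" where
  "avg k g c = (\<Sum>K\<in>at_root k (rep c). \<Sum>z\<in>K.
     ennreal (avg_weight k (rep c) K z) * g (mark (rep c) z K))"

lemma measurable_avg: "g \<in> borel_measurable borel \<Longrightarrow> avg k g \<in> borel_measurable borel"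
  unfolding avg_def using measurable_kern[OF local_weight_avg] .

text \<open>Among the small sets at the root only the marked one passes the test in
  \<open>avg_weight\<close>, so the double sum collapses.\<close>

lemma avg_mark:
  assumes X: "wf_rgraph X" and K: "K \<in> small k X" "x \<in> K" and g: "g \<in> borel_measurable borel"
  shows "avg k g (mark X x K) = ennreal (1 / real (card K)) * (\<Sum>z\<in>K. g (mark X z K))"
proof -
  let ?X = "X\<lparr>origin := x, vsets := [K], esets := []\<rparr>"
  have wf: "wf_rgraph ?X" using X K small_verts by (intro wf_mark) auto
  have KX: "K \<in> at_root k ?X" using K by (simp add: at_root_iff small_def)
  have "K \<subseteq> ball_verts (edges X) x (k * k)" using K by (simp add: small_def)
  then have w: "avg_weight k ?X L z = (if L = K then 1 / real (card K) else 0)" for L z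
    by (auto simp: avg_weight_def Int_absorb2)
  have "avg k g (mark X x K) = (\<Sum>L\<in>at_root k ?X. \<Sum>z\<in>L. ennreal (avg_weight k ?X L z) * g (mark ?X z L))"
    unfolding avg_def mark_def[of X x K] by (rule kern_rep_abs[OF local_weight_avg g wf])
  also have "\<dots> = (\<Sum>L\<in>at_root k ?X. if L = K then \<Sum>z\<in>K. ennreal (1 / real (card K)) * g (mark ?X z K) else 0)"
    by (rule sum.cong) (auto simp: w)
  also have "\<dots> = (\<Sum>z\<in>K. ennreal (1 / real (card K)) * g (mark ?X z K))"
    using KX finite_near[OF wf] by (simp add: sum.delta')
  also have "\<dots> = ennreal (1 / real (card K)) * (\<Sum>z\<in>K. g (mark X z K))"
    by (simp add: mark_def sum_distrib_left)
  finally show ?thesis .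
qed

lemma nn_integral_count_space_small:
  assumes "finite T" "\<And>K. K \<in> T \<Longrightarrow> finite K \<and> K \<subseteq> V"
  shows "(\<integral>\<^sup>+y. (\<Sum>K\<in>T. indicator K y * \<phi> K y) \<partial>count_space V) = (\<Sum>K\<in>T. \<Sum>y\<in>K. \<phi> K y :: ennreal)"
proof -
  have "(\<integral>\<^sup>+y. (\<Sum>K\<in>T. indicator K y * \<phi> K y) \<partial>count_space V) =
      (\<Sum>K\<in>T. \<integral>\<^sup>+y. indicator K y * \<phi> K y \<partial>count_space V)"
    by (rule nn_integral_sum) simp
  also have "(\<integral>\<^sup>+y. indicator K y * \<phi> K y \<partial>count_space V) = (\<Sum>y\<in>K. \<phi> K y)" if "K \<in> T" for K
  proof -
    have "(\<integral>\<^sup>+y. indicator K y * \<phi> K y \<partial>count_space V) = (\<Sum>y\<in>K. indicator K y * \<phi> K y)"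
      by (rule nn_integral_count_space') (use assms(2)[OF that] in auto)
    then show ?thesis by (simp cong: sum.cong)
  qed
  then have "(\<Sum>K\<in>T. \<integral>\<^sup>+y. indicator K y * \<phi> K y \<partial>count_space V) = (\<Sum>K\<in>T. \<Sum>y\<in>K. \<phi> K y)"
    by (rule sum.cong[OF refl])
  finally show ?thesis .
qed

text \<open>
  Here \<open>\<Psi> X K x y\<close> is the mass that \<open>x\<close> sends to \<open>y\<close> on behalf of the small set \<open>K\<close>.
\<close>

lemma mass_transport_small:
  fixes \<Psi> :: "pre_rgraph \<Rightarrow> nat set \<Rightarrow> nat \<Rightarrow> nat \<Rightarrow> ennreal"
  assumes \<mu>: "unimodular \<mu>" and f: "f \<in> borel_measurable borel"
    and f_eq: "\<And>X x y. wf_rgraph X \<Longrightarrow> x \<in> verts X \<Longrightarrow> y \<in> verts X \<Longrightarrow>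
      f (abs_rgraph (X\<lparr>origin := x, vsets := [{y}]\<rparr>)) =
      (\<Sum>K\<in>{K \<in> small k X. x \<in> K}. indicator K y * \<Psi> X K x y)"
  shows "(\<integral>\<^sup>+c. (\<Sum>K\<in>at_root k (rep c). \<Sum>y\<in>K.
      \<Psi> (rep c) K (origin (rep c)) y) \<partial>\<mu>) =
    (\<integral>\<^sup>+c. (\<Sum>K\<in>at_root k (rep c). \<Sum>x\<in>K.
      \<Psi> (rep c) K x (origin (rep c))) \<partial>\<mu>)"
proof -
  have T: "finite (at_root k (rep c))"
    "\<And>K. K \<in> at_root k (rep c) \<Longrightarrow> finite K \<and> K \<subseteq> verts (rep c)" for c
    using finite_near[OF wf_rep_rgraph] near_smallD small_finite small_verts by blast+
  have o: "origin (rep c) \<in> verts (rep c)" for c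
    using wf_rep_rgraph[of c] by (simp add: wf_rgraph_def)
  have out: "(\<integral>\<^sup>+y. f (with_roots c (origin (rep c)) y) \<partial>count_space (verts (rep c))) =
      (\<Sum>K\<in>at_root k (rep c). \<Sum>y\<in>K. \<Psi> (rep c) K (origin (rep c)) y)" for c
  proof -
    have "f (with_roots c (origin (rep c)) y) =
        (\<Sum>K\<in>at_root k (rep c). indicator K y * \<Psi> (rep c) K (origin (rep c)) y)"
      if "y \<in> verts (rep c)" for y
      unfolding with_roots_def f_eq[OF wf_rep_rgraph o that] by (rule sum.cong) (auto simp: at_root_iff)
    then have "(\<integral>\<^sup>+y. f (with_roots c (origin (rep c)) y) \<partial>count_space (verts (rep c))) =
        (\<integral>\<^sup>+y. (\<Sum>K\<in>at_root k (rep c). indicator K y * \<Psi> (rep c) K (origin (rep c)) y)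
          \<partial>count_space (verts (rep c)))"
      by (intro nn_integral_cong) simp
    then show ?thesis using nn_integral_count_space_small[OF T] by simp
  qed
  have "(\<integral>\<^sup>+x. f (with_roots c x (origin (rep c))) \<partial>count_space (verts (rep c))) =
      (\<Sum>K\<in>at_root k (rep c). \<Sum>x\<in>K. \<Psi> (rep c) K x (origin (rep c)))" for c
  proof -
    let ?X = "rep c"
    have "f (with_roots c x (origin ?X)) =
        (\<Sum>K\<in>at_root k ?X. indicator K x * \<Psi> ?X K x (origin ?X))"
      if x: "x \<in> verts ?X" for x
    proof -
      have "f (with_roots c x (origin ?X)) =
          (\<Sum>K\<in>{K \<in> small k ?X. x \<in> K}. indicator K (origin ?X) * \<Psi> ?X K x (origin ?X))"
        unfolding with_roots_def using f_eq[OF wf_rep_rgraph x o] .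
      \<comment> \<open>That K contains both vertices is symmetric in sender and receiver, so a sum
        over the sets at x turns into one over the sets at the root.\<close>
      also have "\<dots> = (\<Sum>K\<in>{K \<in> small k ?X. x \<in> K \<and> origin ?X \<in> K}. \<Psi> ?X K x (origin ?X))"
        using finite_small_at[OF wf_rep_rgraph x]
        by (intro sum.mono_neutral_cong_right) (auto simp: indicator_def)
      also have "\<dots> = (\<Sum>K\<in>at_root k ?X. indicator K x * \<Psi> ?X K x (origin ?X))"
        using T(1) by (intro sum.mono_neutral_cong_left) (auto simp: indicator_def at_root_iff)
      finally show ?thesis .
    qed
    then have "(\<integral>\<^sup>+x. f (with_roots c x (origin ?X)) \<partial>count_space (verts ?X)) =
        (\<integral>\<^sup>+x. (\<Sum>K\<in>at_root k ?X. indicator K x * \<Psi> ?X K x (origin ?X)) \<partial>count_space (verts ?X))"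
      by (intro nn_integral_cong) simp
    then show ?thesis using nn_integral_count_space_small[OF T] by simp
  qed
  then show ?thesis using \<mu>[unfolded unimodular_def, rule_format, OF f] out by simp
qed

lemma wf_two_roots: "wf_rgraph X \<Longrightarrow> x \<in> verts X \<Longrightarrow> y \<in> verts X \<Longrightarrow>
    wf_rgraph (X\<lparr>origin := x, vsets := [{y}]\<rparr>)"
  by (simp add: wf_rgraph_def)

text \<open>For every small K containing both, x sends to y the mass h(G, x, K) g(G, y, K) / card K.
  The mass sent is h times the average of g, the mass received the average of h times g. The factor
  h is local because it becomes the weight of a kernel, while g is the integrand and may be any
  Borel function.\<close>

lemma avg_selfadjoint:
  assumes \<mu>: "unimodular \<mu>" and h: "\<And>c d. ball_iso c d R \<Longrightarrow> h c = h d" "\<And>c. 0 \<le> h c"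
    and g: "g \<in> borel_measurable borel"
  shows "(\<integral>\<^sup>+c. (\<Sum>K\<in>at_root k (rep c). ennreal (h (rmark (rep c) K)) *
      avg k g (rmark (rep c) K)) \<partial>\<mu>) =
    (\<integral>\<^sup>+c. (\<Sum>K\<in>at_root k (rep c). avg k (\<lambda>d. ennreal (h d)) (rmark (rep c) K) *
      g (rmark (rep c) K)) \<partial>\<mu>)"
proof -
  define \<Psi> where "\<Psi> X K x y = ennreal (1 / real (card K)) * ennreal (h (mark X x K)) * g (mark X y K)"
    for X K x y
  define f where "f c = (\<Sum>K\<in>at_root k (rep c). \<Sum>z\<in>K.
    ennreal (pair_weight h (rep c) K z) * g (mark (rep c) z K))" for c
  have lw: "local_weight k (pair_weight h)" using h(1) by (rule local_weight_pair)
  have hm: "(\<lambda>d. ennreal (h d)) \<in> borel_measurable borel"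
    by (rule measurable_local[of R]) (use h(1) in auto)
  have f: "f \<in> borel_measurable borel" unfolding f_def using measurable_kern[OF lw g] .
  have f_eq: "f (abs_rgraph (X\<lparr>origin := x, vsets := [{y}]\<rparr>)) =
      (\<Sum>K\<in>{K \<in> small k X. x \<in> K}. indicator K y * \<Psi> X K x y)"
    if "wf_rgraph X" "x \<in> verts X" "y \<in> verts X" for X x y
  proof -
    let ?X = "X\<lparr>origin := x, vsets := [{y}]\<rparr>"
    have "f (abs_rgraph ?X) = (\<Sum>K\<in>at_root k ?X. \<Sum>z\<in>K. ennreal (pair_weight h ?X K z) * g (mark ?X z K))"
      unfolding f_def by (rule kern_rep_abs[OF lw g wf_two_roots[OF that]])
    also have "\<dots> = (\<Sum>K\<in>{K \<in> small k X. x \<in> K}. indicator K y * \<Psi> X K x y)"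
    proof (rule sum.cong)
      show "at_root k ?X = {K \<in> small k X. x \<in> K}" by (auto simp: at_root_iff)
      fix K assume "K \<in> {K \<in> small k X. x \<in> K}"
      then have fin: "finite K" using small_finite by blast
      have m: "mark ?X z K = mark X z K" for z by (simp add: mark_def)
      have "(\<Sum>z\<in>K. ennreal (pair_weight h ?X K z) * g (mark ?X z K)) =
          (\<Sum>z\<in>K. if z = y then ennreal (h (mark X x K) / real (card K)) * g (mark X y K) else 0)"
        by (rule sum.cong) (auto simp: pair_weight_def m)
      also have "\<dots> = indicator K y * (ennreal (h (mark X x K) / real (card K)) * g (mark X y K))"
        using fin by (simp add: indicator_def)
      also have "ennreal (h (mark X x K) / real (card K)) = ennreal (1 / real (card K)) * ennreal (h (mark X x K))"
        using h(2) by (simp add: ennreal_mult[symmetric])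
      finally show "(\<Sum>z\<in>K. ennreal (pair_weight h ?X K z) * g (mark ?X z K)) = indicator K y * \<Psi> X K x y"
        by (simp add: \<Psi>_def mult.assoc)
    qed
    finally show ?thesis .
  qed
  have "(\<Sum>K\<in>at_root k X. ennreal (h (rmark X K)) * avg k g (rmark X K)) =
      (\<Sum>K\<in>at_root k X. \<Sum>y\<in>K. \<Psi> X K (origin X) y)"
    "(\<Sum>K\<in>at_root k X. avg k (\<lambda>d. ennreal (h d)) (rmark X K) * g (rmark X K)) =
      (\<Sum>K\<in>at_root k X. \<Sum>x\<in>K. \<Psi> X K x (origin X))" if X: "wf_rgraph X" for X
    using avg_mark[OF X _ _ g] avg_mark[OF X _ _ hm]
    by (auto intro!: sum.cong simp: \<Psi>_def at_root_iff sum_distrib_left sum_distrib_right mult_ac)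
  then show ?thesis using mass_transport_small[OF \<mu> f f_eq] wf_rep_rgraph by simp
qed

text \<open>Each vertex x whose component K is small spreads h(G, x, K) evenly over K. It sends h in
  total and receives the average of h, because all vertices of K have the same component. So the law
  of (G, o, K) is invariant under resampling the root within K.\<close>

lemma avg_comp:
  assumes \<nu>: "unimodular \<nu>" and h: "h \<in> borel_measurable borel"
  shows "(\<integral>\<^sup>+c. (\<Sum>K\<in>at_root k (rep c). of_bool (root_comp (rep c) = K) *
      h (rmark (rep c) K)) \<partial>\<nu>) =
    (\<integral>\<^sup>+c. (\<Sum>K\<in>at_root k (rep c). of_bool (root_comp (rep c) = K) *
      avg k h (rmark (rep c) K)) \<partial>\<nu>)"
proof -
  define \<Psi> where "\<Psi> X K x (y :: nat) = ennreal (1 / real (card K)) *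
      (of_bool (root_comp (X\<lparr>origin := x\<rparr>) = K) * h (mark X x K))" for X K x y
  define f where "f c = (\<Sum>K\<in>at_root k (rep c). \<Sum>z\<in>K.
    ennreal (comp_pair_weight (rep c) K z) * h (mark (rep c) z K))" for c
  have f: "f \<in> borel_measurable borel"
    unfolding f_def using measurable_kern[OF local_weight_comp_pair h] .
  have f_eq: "f (abs_rgraph (X\<lparr>origin := x, vsets := [{y}]\<rparr>)) =
      (\<Sum>K\<in>{K \<in> small k X. x \<in> K}. indicator K y * \<Psi> X K x y)"
    if "wf_rgraph X" "x \<in> verts X" "y \<in> verts X" for X x y
  proof -
    let ?X = "X\<lparr>origin := x, vsets := [{y}]\<rparr>"
    have "f (abs_rgraph ?X) = (\<Sum>K\<in>at_root k ?X. \<Sum>z\<in>K. ennreal (comp_pair_weight ?X K z) * h (mark ?X z K))"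
      unfolding f_def by (rule kern_rep_abs[OF local_weight_comp_pair h wf_two_roots[OF that]])
    also have "\<dots> = (\<Sum>K\<in>{K \<in> small k X. x \<in> K}. indicator K y * \<Psi> X K x y)"
    proof (rule sum.cong)
      show "at_root k ?X = {K \<in> small k X. x \<in> K}" by (auto simp: at_root_iff)
      fix K assume K: "K \<in> {K \<in> small k X. x \<in> K}"
      then have fin: "finite K" using small_finite by blast
      have m: "mark ?X z K = mark X z K" "root_comp ?X = root_comp (X\<lparr>origin := x\<rparr>)" for z
        by (simp_all add: mark_def root_comp_def cutset_def)
      have "(\<Sum>z\<in>K. ennreal (comp_pair_weight ?X K z) * h (mark ?X z K)) =
          (\<Sum>z\<in>K. if z = x then indicator K y * \<Psi> X K x y else 0)"
        by (rule sum.cong) (auto simp: comp_pair_weight_def m \<Psi>_def indicator_def)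
      also have "\<dots> = indicator K y * \<Psi> X K x y" using fin K by simp
      finally show "(\<Sum>z\<in>K. ennreal (comp_pair_weight ?X K z) * h (mark ?X z K)) = indicator K y * \<Psi> X K x y" .
    qed
    finally show ?thesis .
  qed
  have o: "X\<lparr>origin := origin X\<rparr> = X" for X :: pre_rgraph by simp
  have "(\<Sum>K\<in>at_root k X. of_bool (root_comp X = K) * h (rmark X K)) =
      (\<Sum>K\<in>at_root k X. \<Sum>y\<in>K. \<Psi> X K (origin X) y)" for X
  proof (rule sum.cong[OF refl])
    fix K assume "K \<in> at_root k X"
    then have "card K > 0" using near_smallD small_finite by (auto simp: card_gt_0_iff at_root_iff)
    then have "of_nat (card K) * ennreal (1 / real (card K)) = 1"
      by (simp add: ennreal_of_nat_eq_real_of_nat ennreal_mult[symmetric])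
    then show "of_bool (root_comp X = K) * h (rmark X K) = (\<Sum>y\<in>K. \<Psi> X K (origin X) y)"
      unfolding \<Psi>_def o by (simp add: mult.assoc[symmetric])
  qed
  moreover have "(\<Sum>K\<in>at_root k X. of_bool (root_comp X = K) * avg k h (rmark X K)) =
      (\<Sum>K\<in>at_root k X. \<Sum>x\<in>K. \<Psi> X K x (origin X))" if X: "wf_rgraph X" for X
  proof (rule sum.cong[OF refl])
    fix K assume K: "K \<in> at_root k X"
    have "root_comp (X\<lparr>origin := x\<rparr>) = K \<longleftrightarrow> root_comp X = K" if x: "x \<in> K" for x
    proof
      assume c: "root_comp (X\<lparr>origin := x\<rparr>) = K"
      have "origin X \<in> root_comp (X\<lparr>origin := x\<rparr>)" using K c by (simp add: at_root_iff)
      from comp_eq_of_mem[OF this] show "root_comp X = K" using c by simp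
    next
      assume c: "root_comp X = K"
      then have "x \<in> root_comp X" using x by simp
      from comp_eq_of_mem[OF this] show "root_comp (X\<lparr>origin := x\<rparr>) = K" using c by simp
    qed
    then show "of_bool (root_comp X = K) * avg k h (rmark X K) = (\<Sum>x\<in>K. \<Psi> X K x (origin X))"
      using avg_mark[OF X _ _ h] K
      by (simp add: \<Psi>_def at_root_iff sum_distrib_left mult_ac)
  qed
  ultimately show ?thesis using mass_transport_small[OF \<nu> f f_eq] wf_rep_rgraph by simp
qed


section \<open>The fractional partition of a hyperfinite measure\<close>

lemma measurable_ball_iso_map:
  assumes "\<And>R c d. ball_iso c d R \<Longrightarrow> ball_iso (g c) (g d) R"
  shows "g \<in> borel_measurable borel"
proof (rule measurable_rgraphI)
  fix R and C :: "rgraph set" assume "cylinder R C"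
  then have "cylinder R {x. g x \<in> C}" using assms unfolding cylinder_def by blast
  then show "{x \<in> space borel. g x \<in> C} \<in> sets borel" using sets_cylinder by simp
qed

definition unmark :: "rgraph \<Rightarrow> rgraph" where
  "unmark c = abs_rgraph (rep c\<lparr>vsets := [], esets := []\<rparr>)"

lemma wf_unmark: "wf_rgraph X \<Longrightarrow> wf_rgraph (X\<lparr>vsets := [], esets := []\<rparr>)"
  by (simp add: wf_rgraph_def)

lemma wf_forget: "wf_rgraph X \<Longrightarrow> wf_rgraph (X\<lparr>esets := []\<rparr>)"
  by (simp add: wf_rgraph_def)

lemma ball_iso_rep:
  "ball_iso c d R \<longleftrightarrow> (\<exists>f. ball_via f (rep c) (rep d) R)"
  by (simp add: ball_iso_def iso_rgraph_def)

lemma unmark_abs: "wf_rgraph X \<Longrightarrow> unmark (abs_rgraph X) = abs_rgraph (X\<lparr>vsets := [], esets := []\<rparr>)"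
proof -
  assume X: "wf_rgraph X"
  obtain f where "iso_via f (rep (abs_rgraph X)) X"
    using rep_abs_rgraph[OF X] by (auto simp: iso_rgraph_def)
  then have "iso_via f (rep (abs_rgraph X)\<lparr>vsets := [], esets := []\<rparr>) (X\<lparr>vsets := [], esets := []\<rparr>)"
    by (simp add: iso_via_def)
  then show ?thesis
    unfolding unmark_def abs_rgraph_eq_iff[OF wf_unmark[OF wf_rep_rgraph] wf_unmark[OF X]]
    by (auto simp: iso_rgraph_def)
qed

lemma forget_marks_abs: "wf_rgraph X \<Longrightarrow> forget_marks (abs_rgraph X) = abs_rgraph (X\<lparr>esets := []\<rparr>)"
proof -
  assume X: "wf_rgraph X"
  obtain f where "iso_via f (rep (abs_rgraph X)) X"
    using rep_abs_rgraph[OF X] by (auto simp: iso_rgraph_def)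
  then have "iso_via f (rep (abs_rgraph X)\<lparr>esets := []\<rparr>) (X\<lparr>esets := []\<rparr>)"
    by (simp add: iso_via_def)
  then show ?thesis
    unfolding forget_marks_def abs_rgraph_eq_iff[OF wf_forget[OF wf_rep_rgraph] wf_forget[OF X]]
    by (auto simp: iso_rgraph_def)
qed

lemma measurable_unmark [measurable]: "unmark \<in> borel_measurable borel"
proof (rule measurable_ball_iso_map)
  fix R c d assume "ball_iso c d R"
  then obtain f where f: "ball_via f (rep c) (rep d) R"
    by (auto simp: ball_iso_rep)
  show "ball_iso (unmark c) (unmark d) R"
    unfolding unmark_def ball_iso_abs[OF wf_unmark[OF wf_rep_rgraph] wf_unmark[OF wf_rep_rgraph]]
    using iso_via_remark[OF f, of "[]" "[]" "[]" "[]"] by (auto simp: iso_rgraph_def)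
qed

lemma measurable_forget_marks [measurable]: "forget_marks \<in> borel_measurable borel"
proof (rule measurable_ball_iso_map)
  fix R c d assume "ball_iso c d R"
  then obtain f where f: "ball_via f (rep c) (rep d) R"
    by (auto simp: ball_iso_rep)
  let ?X = "rep c" and ?Y = "rep d"
  have "map (\<lambda>A. A \<inter> vball ?Y R) (vsets ?Y) =
      map (\<lambda>A. f ` (A \<inter> vball ?X R)) (vsets ?X)"
    using f unfolding iso_via_def rball_simps map_map o_def by (elim conjE)
  from iso_via_remark[OF f this, of "[]" "[]"]
  have "ball_via f (?X\<lparr>esets := []\<rparr>) (?Y\<lparr>esets := []\<rparr>) R" by simp
  then show "ball_iso (forget_marks c) (forget_marks d) R"
    unfolding forget_marks_def ball_iso_abs[OF wf_forget[OF wf_rep_rgraph] wf_forget[OF wf_rep_rgraph]]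
    by (auto simp: iso_rgraph_def)
qed

section \<open>Sums over the small sets at the root\<close>

definition rsum :: "nat \<Rightarrow> (rgraph \<Rightarrow> 'a) \<Rightarrow> pre_rgraph \<Rightarrow> 'a :: comm_monoid_add" where
  "rsum k F X = (\<Sum>K\<in>at_root k X. F (rmark X K))"

text \<open>At most one term is nonzero; the form of a sum makes it an integral against
  \<open>kern\<close> and hence measurable.\<close>

definition csum :: "nat \<Rightarrow> (rgraph \<Rightarrow> ennreal) \<Rightarrow> pre_rgraph \<Rightarrow> ennreal" where
  "csum k F X = (\<Sum>K\<in>at_root k X. of_bool (root_comp X = K) * F (rmark X K))"

definition unit_weight :: "pre_rgraph \<Rightarrow> nat set \<Rightarrow> nat \<Rightarrow> real" where
  "unit_weight X K z = (if z = origin X then 1 else 0)"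

lemma local_weight_unit: "local_weight k unit_weight"
  unfolding local_weight_def
proof (intro exI[of _ "2 * (k * k) + 1"] allI impI)
  fix X Y f K z
  assume *: "wf_rgraph X" "wf_rgraph Y"
    "ball_via f X Y (2 * (k * k) + 1)" "K \<in> at_root k X" "z \<in> K"
  show "unit_weight Y (f ` K) (f z) = unit_weight X K z"
    using K_origin[OF *(1-3) order_refl *(4,5)] unfolding unit_weight_def by simp
qed

lemma sum_at_origin:
  assumes "K \<in> at_root k X"
  shows "(\<Sum>z\<in>K. ennreal (if z = origin X then a else 0) * g z) = ennreal a * g (origin X)"
proof -
  have "(\<Sum>z\<in>K. ennreal (if z = origin X then a else 0) * g z) =
      (\<Sum>z\<in>K. if z = origin X then ennreal a * g (origin X) else 0)"
    by (rule sum.cong) auto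
  then show ?thesis using assms small_finite by (auto simp: at_root_iff)
qed

lemma rsum_kern: "rsum k F X = (\<Sum>K\<in>at_root k X. \<Sum>z\<in>K. ennreal (unit_weight X K z) * F (mark X z K))"
  unfolding rsum_def unit_weight_def by (rule sum.cong[OF refl]) (simp add: sum_at_origin)

lemma csum_kern: "csum k F X = (\<Sum>K\<in>at_root k X. \<Sum>z\<in>K. ennreal (comp_weight X K z) * F (mark X z K))"
  unfolding csum_def comp_weight_def
proof (rule sum.cong[OF refl])
  fix K assume "K \<in> at_root k X"
  from sum_at_origin[OF this, of 1 "\<lambda>z. F (mark X z K)"]
  show "of_bool (root_comp X = K) * F (rmark X K) =
      (\<Sum>z\<in>K. ennreal (if z = origin X \<and> root_comp X = K then 1 else 0) * F (mark X z K))"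
    by (cases "root_comp X = K") auto
qed

lemma root_weight_kern: "(\<Sum>K\<in>at_root k X. \<Sum>z\<in>K. ennreal (root_weight k X K z) * F (mark X z K)) =
    ennreal (1 / real (card (at_root k X))) * rsum k F X"
  unfolding rsum_def root_weight_def sum_distrib_left
  by (rule sum.cong[OF refl]) (simp add: sum_at_origin)

lemma measurable_rsum:
  fixes F :: "rgraph \<Rightarrow> ennreal"
  shows "F \<in> borel_measurable borel \<Longrightarrow> (\<lambda>c. rsum k F (rep c)) \<in> borel_measurable borel"
  unfolding rsum_kern using measurable_kern[OF local_weight_unit] .

lemma card_at_root:
  assumes "0 < k" "wf_rgraph X"
  shows "0 < card (at_root k X)"
proof -
  have "{origin X} \<in> at_root k X"
    using assms by (auto simp: at_root_iff small_def wf_rgraph_def ball_verts_center)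
  then show ?thesis using finite_near[OF assms(2)] by (auto simp: card_gt_0_iff)
qed

lemma local_fun_card_at_root: "local_fun (\<lambda>X. card (at_root k X))"
  unfolding local_fun_def
proof (intro exI[of _ "2 * (k * k)"] allI impI)
  fix X Y f
  assume *: "wf_rgraph X" "wf_rgraph Y" "ball_via f X Y (2 * (k * k))"
  show "card (at_root k X) = card (at_root k Y)"
    by (rule bij_betw_same_card[OF near_transport[OF *]]) simp
qed

text \<open>Since a mark does not affect this number, it moves as a factor between functions of (G,
  o) and functions of (G, o, K).\<close>

lemma card_at_root_mark:
  assumes "wf_rgraph X" "K \<in> at_root k X"
  shows "card (at_root k (rep (rmark X K))) = card (at_root k X)"
proof -
  have "wf_rgraph (X\<lparr>origin := origin X, vsets := [K], esets := []\<rparr>)"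
    using assms near_smallD[THEN small_verts] by (intro wf_mark) (auto simp: wf_rgraph_def)
  from local_fun_rep_abs[OF local_fun_card_at_root this, of k]
  show ?thesis unfolding mark_def by simp
qed

lemma csum_comp:
  assumes "root_comp X \<in> at_root k X" "wf_rgraph X"
  shows "csum k F X = F (rmark X (root_comp X))"
proof -
  have "csum k F X = (\<Sum>K\<in>at_root k X. if K = root_comp X then F (rmark X (root_comp X)) else 0)"
    unfolding csum_def by (rule sum.cong) auto
  then show ?thesis using assms finite_near by simp
qed

section \<open>Edges leaving the marked set\<close>

definition bdeg :: "pre_rgraph \<Rightarrow> nat" where
  "bdeg X = card {v. {origin X, v} \<in> edges X \<and> v \<notin> \<Union>(set (vsets X))}"

lemma nbr_in_ball: "{origin X, v} \<in> edges X \<Longrightarrow> v \<in> vball X 1"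
  using ball_verts_Suc[of "edges X" "origin X" 0] by (auto simp: ball_verts_0)

lemma nbr_transport:
  assumes X: "wf_rgraph X" and Y: "wf_rgraph Y" and iso: "ball_via f X Y R" and R: "1 \<le> R"
  shows "bij_betw f (nbrs X) (nbrs Y)"
proof -
  let ?B = "vball X 1" and ?B' = "vball X R"
  have BB: "?B \<subseteq> ?B'" by (rule ball_verts_mono[OF R])
  have e: "{origin Y, f v} \<in> edges Y \<longleftrightarrow> {origin X, v} \<in> edges X" if "v \<in> ?B" for v
  proof -
    have "{origin X, v} \<subseteq> ?B'" using that BB ball_verts_center by auto
    from in_edges_transport[OF X Y iso this] show ?thesis
      by (simp add: origin_transport[OF X Y iso])
  qed
  have fB: "f ` ?B = vball Y 1" using image_ball[OF X Y iso R] .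
  show ?thesis unfolding bij_betw_def
  proof
    show "inj_on f (nbrs X)"
    proof (rule inj_on_subset[OF inj_on_ball[OF X Y iso]])
      show "nbrs X \<subseteq> ?B'" using BB by (auto dest!: nbr_in_ball)
    qed
    show "f ` nbrs X = nbrs Y"
    proof (intro equalityI subsetI)
      fix w assume "w \<in> f ` nbrs X"
      then show "w \<in> nbrs Y" using e nbr_in_ball by auto
    next
      fix w assume w: "w \<in> nbrs Y"
      then have "w \<in> f ` ?B" unfolding fB using nbr_in_ball by simp
      then show "w \<in> f ` nbrs X" using e w by auto
    qed
  qed
qed

lemma vsets_mem_transport:
  assumes X: "wf_rgraph X" and Y: "wf_rgraph Y" and iso: "ball_via f X Y R"
    and v: "v \<in> vball X R"
  shows "f v \<in> \<Union>(set (vsets Y)) \<longleftrightarrow> v \<in> \<Union>(set (vsets X))"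
proof -
  let ?B = "vball X R" and ?C = "vball Y R"
  have m: "map (\<lambda>A. A \<inter> ?C) (vsets Y) = map (\<lambda>A. f ` (A \<inter> ?B)) (vsets X)"
    using iso unfolding iso_via_def rball_simps map_map o_def by (elim conjE)
  have s: "(\<lambda>A. A \<inter> ?C) ` set (vsets Y) = (\<lambda>A. f ` (A \<inter> ?B)) ` set (vsets X)"
    using arg_cong[OF m, of set] by simp
  have fv: "f v \<in> ?C" using imageI[OF v, of f] image_ball[OF X Y iso, of R] by simp
  have "f v \<in> \<Union>(set (vsets Y)) \<longleftrightarrow> f v \<in> \<Union>((\<lambda>A. A \<inter> ?C) ` set (vsets Y))" using fv by blast
  also have "\<dots> \<longleftrightarrow> (\<exists>A\<in>set (vsets X). f v \<in> f ` (A \<inter> ?B))" unfolding s by blast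
  also have "\<dots> \<longleftrightarrow> (\<exists>A\<in>set (vsets X). v \<in> A \<inter> ?B)"
    using inj_on_image_mem_iff[OF inj_on_ball[OF X Y iso] v] by simp
  finally show ?thesis using v by blast
qed

lemma local_fun_bdeg: "local_fun bdeg"
  unfolding local_fun_def
proof (intro exI[of _ 1] allI impI)
  fix X Y f
  assume X: "wf_rgraph X" and Y: "wf_rgraph Y" and iso: "ball_via f X Y 1"
  have bij: "bij_betw f (nbrs X) (nbrs Y)"
    using nbr_transport[OF X Y iso] by simp
  have "bij_betw f {v \<in> nbrs X. v \<notin> \<Union>(set (vsets X))}
      {v \<in> nbrs Y. v \<notin> \<Union>(set (vsets Y))}"
  proof (rule bij_betw_Collect[OF bij])
    fix v assume "v \<in> nbrs X"
    then have "v \<in> vball X 1" using nbr_in_ball by simp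
    from vsets_mem_transport[OF X Y iso this]
    show "f v \<notin> \<Union>(set (vsets Y)) \<longleftrightarrow> v \<notin> \<Union>(set (vsets X))" by simp
  qed
  then show "bdeg X = bdeg Y" unfolding bdeg_def mem_Collect_eq by (rule bij_betw_same_card)
qed

lemma bdeg_mark:
  assumes "wf_rgraph X" "K \<in> at_root k X"
  shows "bdeg (rep (rmark X K)) = card {v. {origin X, v} \<in> edges X \<and> v \<notin> K}"
proof -
  have "wf_rgraph (X\<lparr>origin := origin X, vsets := [K], esets := []\<rparr>)"
    using assms near_smallD[THEN small_verts] by (intro wf_mark) (auto simp: wf_rgraph_def)
  from local_fun_rep_abs[OF local_fun_bdeg this]
  show ?thesis unfolding mark_def by (simp add: bdeg_def)
qed

lemma finite_nbrs: "wf_rgraph X \<Longrightarrow> finite (nbrs X)"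
  by (rule finite_subset[OF _ finite_ball_verts[of X 1]]) (auto dest: nbr_in_ball)

lemma incident_nbrs:
  assumes X: "wf_rgraph X" and S: "S \<subseteq> edges X"
  shows "card {e \<in> S. origin X \<in> e} = card {v. {origin X, v} \<in> S}"
proof (rule bij_betw_same_card[symmetric])
  have "e \<in> (\<lambda>v. {origin X, v}) ` {v. {origin X, v} \<in> S}" if "e \<in> S" "origin X \<in> e" for e
  proof -
    have "card e = 2" using X S that(1) by (auto simp: wf_rgraph_def)
    then obtain a b where "e = {a, b}" by (auto simp: card_2_iff)
    then have "e = {origin X, a} \<or> e = {origin X, b}" using that(2) by auto
    then show ?thesis using that(1) by auto
  qed
  then show "bij_betw (\<lambda>v. {origin X, v}) {v. {origin X, v} \<in> S} {e \<in> S. origin X \<in> e}"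
    by (auto simp: bij_betw_def inj_on_def doubleton_eq_iff)
qed

text \<open>The mixture first draws (G, o) and then (K, z) with the given weights; the mass bound
  makes the kernel one of subprobability measures, as the mixture requires.\<close>

lemma bind_kern:
  assumes "local_weight k w" and mass: "\<forall>X. wf_rgraph X \<longrightarrow> emeasure (kern k w X) UNIV \<le> 1"
    and \<mu>: "prob_space \<mu>" "sets \<mu> = sets borel"
  defines "m \<equiv> \<mu> \<bind> (\<lambda>c. kern k w (rep c))"
  shows "subprob_space m" "sets m = sets borel"
    "\<And>F. F \<in> borel_measurable borel \<Longrightarrow> (\<integral>\<^sup>+d. F d \<partial>m) =
      (\<integral>\<^sup>+c. (\<Sum>K\<in>at_root k (rep c). \<Sum>z\<in>K. ennreal (w (rep c) K z) * F (mark (rep c) z K)) \<partial>\<mu>)"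
proof -
  have meas: "(\<lambda>c. kern k w (rep c)) \<in> measurable \<mu> (subprob_algebra borel)"
    by (rule local_kernel_measurable_subprob[OF local_kernel_kern[OF assms(1)] mass[rule_format] \<mu>(2)])
  have ne: "space \<mu> \<noteq> {}" using \<mu>(1) by (rule prob_space.not_empty)
  show "sets m = sets borel" unfolding m_def by (rule sets_bind[OF _ ne]) simp
  have sp: "subprob_space \<mu>" using \<mu>(1) by (rule prob_space_imp_subprob_space)
  show "subprob_space m" unfolding m_def by (rule subprob_space_bind[OF sp meas])
  show "(\<integral>\<^sup>+d. F d \<partial>m) =
      (\<integral>\<^sup>+c. (\<Sum>K\<in>at_root k (rep c). \<Sum>z\<in>K. ennreal (w (rep c) K z) * F (mark (rep c) z K)) \<partial>\<mu>)"
    if F: "F \<in> borel_measurable borel" for F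
    unfolding m_def nn_integral_bind[OF F meas] using nn_integral_kern[OF wf_rep_rgraph F] by simp
qed

text \<open>Here s is the fractional partition: the last clause says that K is the component of o
  under \<nu> with weight s(G, o, K). The local q approximates it. As the later rates use averages
  of q over the root, it is such an average that is compared with s; the error e holds pointwise and
  has small total mass.\<close>

lemma fractional_partition:
  fixes k :: nat and \<mu> \<nu> :: "rgraph measure" and \<delta> :: real
  assumes k: "0 < k" and \<mu>: "prob_space \<mu>" "sets \<mu> = sets borel" "unimodular \<mu>"
    and \<nu>: "prob_space \<nu>" "sets \<nu> = sets borel" "unimodular \<nu>" "distr \<nu> borel forget_marks = \<mu>"
    and \<delta>: "0 < \<delta>"
  obtains q R s e where "\<And>c d. ball_iso c d R \<Longrightarrow> q c = q d" "\<And>d. (0 :: real) \<le> q d"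
    "s \<in> borel_measurable borel" "e \<in> borel_measurable borel"
    "\<And>X K. wf_rgraph X \<Longrightarrow> K \<in> at_root k X \<Longrightarrow>
      avg k (\<lambda>d. ennreal (q d)) (rmark X K) \<le> s (rmark X K) + e (rmark X K)"
    "\<And>X K. wf_rgraph X \<Longrightarrow> K \<in> at_root k X \<Longrightarrow>
      s (rmark X K) \<le> avg k (\<lambda>d. ennreal (q d)) (rmark X K) + e (rmark X K)"
    "(\<integral>\<^sup>+c. rsum k e (rep c) \<partial>\<mu>) \<le> ennreal \<delta>"
    "\<And>h. h \<in> borel_measurable borel \<Longrightarrow>
      (\<integral>\<^sup>+c. csum k h (rep c) \<partial>\<nu>) = (\<integral>\<^sup>+c. rsum k (\<lambda>d. h d * s d) (rep c) \<partial>\<mu>)"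
proof -
  have inv: "ennreal (1 / real (card (at_root k X))) * of_nat (card (at_root k X)) = 1"
    if "wf_rgraph X" for X
    using card_at_root[OF k that] by (simp add: ennreal_of_nat_eq_real_of_nat ennreal_mult[symmetric])
  define nn where "nn d = card (at_root k (rep d))" for d
  have nn_pos: "0 < nn d" for d unfolding nn_def by (rule card_at_root[OF k wf_rep_rgraph])
  have nn_mark: "nn (rmark X K) = card (at_root k X)" if "wf_rgraph X" "K \<in> at_root k X" for X K
    unfolding nn_def by (rule card_at_root_mark[OF that])
  obtain Rn where Rn: "\<And>c d. ball_iso c d Rn \<Longrightarrow> nn c = nn d"
    using local_fun_ball_iso[OF local_fun_card_at_root, of k] unfolding nn_def by metis
  have nn_meas: "(\<lambda>d. h (nn d)) \<in> borel_measurable borel" for h :: "nat \<Rightarrow> 'b :: topological_space"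
    by (rule measurable_local[of Rn]) (auto dest: Rn)

  have root_mass: "\<forall>X. wf_rgraph X \<longrightarrow> emeasure (kern k (root_weight k) X) UNIV \<le> 1"
  proof (intro allI impI)
    fix X assume that: "wf_rgraph X"
    have "emeasure (kern k (root_weight k) X) UNIV = (\<integral>\<^sup>+d. 1 \<partial>kern k (root_weight k) X)" by simp
    also have "\<dots> = ennreal (1 / real (card (at_root k X))) * rsum k (\<lambda>_. 1) X"
      unfolding nn_integral_kern[OF that borel_measurable_const] by (rule root_weight_kern)
    also have "\<dots> = 1" using inv[OF that] by (simp add: rsum_def)
    finally show "emeasure (kern k (root_weight k) X) UNIV \<le> 1" by simp
  qed
  have comp_mass: "\<forall>X. wf_rgraph X \<longrightarrow> emeasure (kern k comp_weight X) UNIV \<le> 1"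
  proof (intro allI impI)
    fix X assume that: "wf_rgraph X"
    have "emeasure (kern k comp_weight X) UNIV = (\<integral>\<^sup>+d. 1 \<partial>kern k comp_weight X)" by simp
    also have "\<dots> = csum k (\<lambda>_. 1) X"
      unfolding nn_integral_kern[OF that borel_measurable_const] csum_kern ..
    also have "\<dots> = (\<Sum>K\<in>at_root k X. if K = root_comp X then 1 else 0)"
      unfolding csum_def by (rule sum.cong) auto
    also have "\<dots> \<le> 1" using finite_near[OF that] by simp
    finally show "emeasure (kern k comp_weight X) UNIV \<le> 1" .
  qed
  \<comment> \<open>\<open>m\<close> is the law of \<open>(G, o, K)\<close> with \<open>K\<close> uniform among the small sets at \<open>o\<close>, which is finite
    without a degree bound; \<open>n\<close> is the law of \<open>(G, o, K)\<close> with \<open>K\<close> the component of \<open>o\<close> under \<open>\<nu>\<close>.\<close>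
  define m where "m = \<mu> \<bind> (\<lambda>c. kern k (root_weight k) (rep c))"
  define n where "n = \<nu> \<bind> (\<lambda>c. kern k comp_weight (rep c))"
  note bm = bind_kern[OF local_weight_root root_mass \<mu>(1,2), folded m_def]
  note bn = bind_kern[OF local_weight_comp comp_mass \<nu>(1,2), folded n_def]
  have im: "(\<integral>\<^sup>+d. F d \<partial>m) =
      (\<integral>\<^sup>+c. ennreal (1 / real (card (at_root k (rep c)))) * rsum k F (rep c) \<partial>\<mu>)"
    if "F \<in> borel_measurable borel" for F
    using bm(3)[OF that] by (simp add: root_weight_kern)
  \<comment> \<open>Multiplication by the number of small sets undoes the normalisation of m, so
    that sums over the small sets at the root become integrals against m.\<close>
  have im_nn: "(\<integral>\<^sup>+d. of_nat (nn d) * F d \<partial>m) = (\<integral>\<^sup>+c. rsum k F (rep c) \<partial>\<mu>)"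
    if F: "F \<in> borel_measurable borel" for F
  proof -
    have nF: "(\<lambda>d. of_nat (nn d) * F d) \<in> borel_measurable borel"
      using F nn_meas[of of_nat] by measurable
    have "ennreal (1 / real (card (at_root k X))) * rsum k (\<lambda>d. of_nat (nn d) * F d) X = rsum k F X"
      if X: "wf_rgraph X" for X
    proof -
      have "rsum k (\<lambda>d. of_nat (nn d) * F d) X = of_nat (card (at_root k X)) * rsum k F X"
        unfolding rsum_def sum_distrib_left by (rule sum.cong) (simp_all add: nn_mark[OF X])
      then show ?thesis using inv[OF X] by (simp add: mult.assoc[symmetric])
    qed
    then show ?thesis unfolding im[OF nF] by (simp add: wf_rep_rgraph)
  qed
  have int_n: "(\<integral>\<^sup>+d. F d \<partial>n) = (\<integral>\<^sup>+c. csum k F (rep c) \<partial>\<nu>)" if "F \<in> borel_measurable borel" for F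
    using bn(3)[OF that] by (simp add: csum_kern)

  interpret m: subprob_space m by (rule bm(1))
  interpret n: subprob_space n by (rule bn(1))
  \<comment> \<open>If N is null for m, then almost surely no small set at the root gives a mark in
    N, because each of them has positive weight; in particular the component does not. The statement
    passes from \<mu> to \<nu> because forgetting the marks projects \<nu> to \<mu>.\<close>
  have ac: "absolutely_continuous m n"
    unfolding absolutely_continuous_def
  proof
    fix N assume N: "N \<in> null_sets m"
    then have Ns: "N \<in> sets borel" using bm(2) by auto
    then have iN: "indicator N \<in> borel_measurable borel" by simp
    define r :: "rgraph \<Rightarrow> ennreal" where "r c = (\<Sum>K\<in>at_root k (rep c). \<Sum>z\<in>K.
      ennreal (root_weight k (rep c) K z) * indicator N (mark (rep c) z K))" for c
    have rb: "r \<in> borel_measurable borel" unfolding r_def by (rule measurable_kern[OF local_weight_root iN])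
    then have rm: "r \<in> borel_measurable \<mu>" using measurable_cong_sets[OF \<mu>(2) refl] by blast
    have "(\<integral>\<^sup>+c. r c \<partial>\<mu>) = 0"
      using bm(3)[OF iN] N by (simp add: r_def bm(2) Ns nn_integral_indicator null_sets_def)
    then have "AE c in \<mu>. r c = 0" using nn_integral_0_iff_AE[OF rm] by simp
    then have "AE c in distr \<nu> borel forget_marks. r c = 0" unfolding \<nu>(4) .
    moreover have fm: "forget_marks \<in> measurable \<nu> borel"
      using measurable_forget_marks measurable_cong_sets[OF \<nu>(2) refl] by blast
    moreover have "{c \<in> space borel. r c = 0} \<in> sets borel" using rb by measurable
    ultimately have ae: "AE c in \<nu>. r (forget_marks c) = 0" by (simp add: AE_distr_iff)
    have "csum k (indicator N) (rep c) = 0" if "r (forget_marks c) = 0" for c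
    proof -
      let ?X = "rep c"
      have "r (forget_marks c) = (\<Sum>K\<in>at_root k (?X\<lparr>esets := []\<rparr>). \<Sum>z\<in>K.
          ennreal (root_weight k (?X\<lparr>esets := []\<rparr>) K z) * indicator N (mark (?X\<lparr>esets := []\<rparr>) z K))"
        unfolding forget_marks_def r_def by (rule kern_rep_abs[OF local_weight_root iN wf_forget[OF wf_rep_rgraph]])
      also have "\<dots> = (\<Sum>K\<in>at_root k ?X. \<Sum>z\<in>K. ennreal (root_weight k ?X K z) * indicator N (mark ?X z K))"
        by (simp add: root_weight_def mark_def cong: if_cong)
      also have "\<dots> = ennreal (1 / real (card (at_root k ?X))) * rsum k (indicator N) ?X"
        by (rule root_weight_kern)
      finally have "ennreal (1 / real (card (at_root k ?X))) * rsum k (indicator N) ?X = 0" using that by simp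
      then have "rsum k (indicator N) ?X = (0 :: ennreal)"
        using card_at_root[OF k wf_rep_rgraph, of c] by (auto simp: divide_le_0_iff)
      then have "\<forall>K\<in>at_root k ?X. indicator N (rmark ?X K) = (0 :: ennreal)"
        unfolding rsum_def using finite_near[OF wf_rep_rgraph] by (simp add: sum_eq_0_iff)
      then show ?thesis unfolding csum_def by simp
    qed
    then have "AE c in \<nu>. csum k (indicator N) (rep c) = 0" using ae by auto
    then have "(\<integral>\<^sup>+c. csum k (indicator N) (rep c) \<partial>\<nu>) = (\<integral>\<^sup>+c. 0 \<partial>\<nu>)" by (rule nn_integral_cong_AE)
    then have "emeasure n N = 0" using int_n[OF iN] Ns bn(2) by simp
    then show "N \<in> null_sets n" using Ns bn(2) by auto
  qed
  have nm: "sets n = sets m" using bm(2) bn(2) by simp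
  obtain D where D: "D \<in> borel_measurable m" "AE d in m. RN_deriv m n d = ennreal (D d)"
    "AE d in n. 0 < D d" "\<And>d. 0 \<le> D d"
    using m.real_RN_deriv[OF n.finite_measure_axioms ac nm] by blast
  have Db: "D \<in> borel_measurable borel" using D(1) measurable_cong_sets[OF bm(2) refl] by blast
  have dens: "n = density m (\<lambda>d. ennreal (D d))"
    using m.density_RN_deriv[OF ac nm] density_cong[OF _ _ D(2)] D(1) by simp
  have in_D: "(\<integral>\<^sup>+d. F d \<partial>n) = (\<integral>\<^sup>+d. ennreal (D d) * F d \<partial>m)" if "F \<in> borel_measurable borel" for F
    unfolding dens
  proof (rule nn_integral_density)
    show "F \<in> borel_measurable m" using that measurable_cong_sets[OF bm(2) refl] by blast
  qed (use D(1) in simp)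
  have "(\<integral>\<^sup>+d. ennreal (D d) \<partial>m) < \<infinity>"
    using in_D[of "\<lambda>_. 1"] n.emeasure_finite[of UNIV] sets_eq_imp_space_eq[OF bn(2)]
    by (simp add: less_top)
  then have Dint: "integrable m D" using D(1,4) by (simp add: integrable_iff_bounded)
  obtain R0 q0 where q0: "\<And>c d. ball_iso c d R0 \<Longrightarrow> q0 c = q0 d" "integrable m q0"
      "(LINT c|m. \<bar>D c - q0 c\<bar>) < \<delta>"
    using local_approx[OF m.finite_measure_axioms bm(2) Dint \<delta>] by blast

  \<comment> \<open>Division by the number of small sets turns a density against the uniform choice
    into a density against the sum over all small sets. Truncating \<open>q0\<close> at 0 does not
    increase its distance to the nonnegative \<open>D\<close>.\<close>
  define p where "p d = ennreal (D d / real (nn d))" for d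
  define q where "q d = max 0 (q0 d) / real (nn d)" for d
  define e0 where "e0 d = ennreal (\<bar>D d - q0 d\<bar> / real (nn d))" for d
  have q0b: "q0 \<in> borel_measurable borel" by (rule measurable_local[of R0]) (use q0(1) in auto)
  have rn [measurable]: "(\<lambda>d. real (nn d)) \<in> borel_measurable borel" using nn_meas[of real] .
  note [measurable] = Db q0b
  have pb: "p \<in> borel_measurable borel" unfolding p_def by measurable
  have qb: "(\<lambda>d. ennreal (q d)) \<in> borel_measurable borel" unfolding q_def by measurable
  have eb: "e0 \<in> borel_measurable borel" unfolding e0_def by measurable
  have nn_div: "of_nat (nn d) * ennreal (a / real (nn d)) = ennreal a" if "0 \<le> a" for a d
    using nn_pos[of d] that by (simp add: ennreal_of_nat_eq_real_of_nat ennreal_mult[symmetric])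

  have pq: "p d \<le> ennreal (q d) + e0 d" "ennreal (q d) \<le> p d + e0 d" for d
  proof -
    have "D d / real (nn d) \<le> q d + \<bar>D d - q0 d\<bar> / real (nn d)"
      unfolding q_def add_divide_distrib[symmetric] by (rule divide_right_mono) (use D(4)[of d] in auto)
    then have "ennreal (D d / real (nn d)) \<le> ennreal (q d + \<bar>D d - q0 d\<bar> / real (nn d))"
      by (rule ennreal_leI)
    also have "\<dots> = ennreal (q d) + ennreal (\<bar>D d - q0 d\<bar> / real (nn d))"
      by (rule ennreal_plus) (auto simp: q_def)
    finally show "p d \<le> ennreal (q d) + e0 d" unfolding p_def e0_def .
    have "q d \<le> D d / real (nn d) + \<bar>D d - q0 d\<bar> / real (nn d)"
      unfolding q_def add_divide_distrib[symmetric] by (rule divide_right_mono) (use D(4)[of d] in auto)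
    then have "ennreal (q d) \<le> ennreal (D d / real (nn d) + \<bar>D d - q0 d\<bar> / real (nn d))"
      by (rule ennreal_leI)
    also have "\<dots> = ennreal (D d / real (nn d)) + ennreal (\<bar>D d - q0 d\<bar> / real (nn d))"
      by (rule ennreal_plus) (use D(4)[of d] in auto)
    finally show "ennreal (q d) \<le> p d + e0 d" unfolding p_def e0_def .
  qed
  have avg_le: "avg k F (rmark X K) \<le> avg k G (rmark X K) + avg k e0 (rmark X K)"
    if X: "wf_rgraph X" and K: "K \<in> at_root k X" and FG: "\<And>d. F d \<le> G d + e0 d"
      and Fb: "F \<in> borel_measurable borel" and Gb: "G \<in> borel_measurable borel" for F G X K
  proof -
    have K': "K \<in> small k X" "origin X \<in> K" using K by (auto simp: at_root_iff)
    have "(\<Sum>z\<in>K. F (mark X z K)) \<le> (\<Sum>z\<in>K. G (mark X z K)) + (\<Sum>z\<in>K. e0 (mark X z K))"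
      unfolding sum.distrib[symmetric] by (rule sum_mono) (rule FG)
    then show ?thesis
      unfolding avg_mark[OF X K' Fb] avg_mark[OF X K' Gb] avg_mark[OF X K' eb] distrib_left[symmetric]
      by (rule mult_left_mono) simp
  qed
  show ?thesis
  proof (rule that[of "max R0 Rn" q "avg k p" "avg k e0"])
    show "q c = q d" if "ball_iso c d (max R0 Rn)" for c d
      using q0(1)[OF ball_iso_mono[OF that]] Rn[OF ball_iso_mono[OF that]] by (simp add: q_def)
    show "0 \<le> q d" for d by (simp add: q_def)
    show "avg k p \<in> borel_measurable borel" by (rule measurable_avg[OF pb])
    show "avg k e0 \<in> borel_measurable borel" by (rule measurable_avg[OF eb])
    show "avg k (\<lambda>d. ennreal (q d)) (rmark X K) \<le>
        avg k p (rmark X K) + avg k e0 (rmark X K)"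
      if "wf_rgraph X" "K \<in> at_root k X" for X K
      using avg_le[OF that pq(2) qb pb] .
    show "avg k p (rmark X K) \<le>
        avg k (\<lambda>d. ennreal (q d)) (rmark X K) + avg k e0 (rmark X K)"
      if "wf_rgraph X" "K \<in> at_root k X" for X K
      using avg_le[OF that pq(1) pb qb] .
    show "(\<integral>\<^sup>+c. rsum k (avg k e0) (rep c) \<partial>\<mu>) \<le> ennreal \<delta>"
    proof -
      have one: "avg k (\<lambda>_. ennreal 1) (rmark X K) = 1" if X: "wf_rgraph X" and K: "K \<in> at_root k X" for X K
      proof -
        have K': "K \<in> small k X" "origin X \<in> K" using K by (auto simp: at_root_iff)
        then have "card K > 0" using small_finite by (auto simp: card_gt_0_iff)
        then show ?thesis
          unfolding avg_mark[OF X K' borel_measurable_const]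
          by (simp add: ennreal_of_nat_eq_real_of_nat ennreal_mult[symmetric])
      qed
      \<comment> \<open>Self-adjointness against the constant 1 shows that averaging preserves the
        integral; what remains is the L1 distance of \<open>D\<close> and \<open>q0\<close> under
        m.\<close>
      have "(\<integral>\<^sup>+c. rsum k (avg k e0) (rep c) \<partial>\<mu>) = (\<integral>\<^sup>+c. rsum k e0 (rep c) \<partial>\<mu>)"
        using avg_selfadjoint[OF \<mu>(3), of 0 "\<lambda>_. 1" e0 k] eb one[OF wf_rep_rgraph]
        by (simp add: rsum_def cong: sum.cong)
      also have "\<dots> = (\<integral>\<^sup>+d. of_nat (nn d) * e0 d \<partial>m)" by (rule im_nn[OF eb, symmetric])
      also have "\<dots> = (\<integral>\<^sup>+d. ennreal \<bar>D d - q0 d\<bar> \<partial>m)" unfolding e0_def by (simp add: nn_div)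
      also have "\<dots> = ennreal (LINT d|m. \<bar>D d - q0 d\<bar>)"
        by (rule nn_integral_eq_integral) (use Dint q0(2) in auto)
      also have "\<dots> \<le> ennreal \<delta>" using q0(3) by (intro ennreal_leI) simp
      finally show ?thesis .
    qed
    \<comment> \<open>Mass transport for \<open>\<nu>\<close> averages the test function over the component, and mass transport
      for \<open>\<mu>\<close> moves the averaging to the density.\<close>
    have neq: "n = density m (\<lambda>d. of_nat (nn d) * avg k p d)"
    proof (rule measure_eqI_cylinder[OF n.finite_measure_axioms bn(2)])
      show "sets (density m (\<lambda>d. of_nat (nn d) * avg k p d)) = sets borel" using bm(2) by simp
      fix R and C :: "rgraph set" assume C: "cylinder R C"
      have iC: "indicator C \<in> borel_measurable borel" using C by (auto intro: borel_measurable_indicator)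
      have iC': "(\<lambda>d. ennreal (indicator C d)) = indicator C" by (auto simp: indicator_def)
      have cyl: "indicator C c = (indicator C d :: real)" if "ball_iso c d R" for c d
        using cylinderD[OF C that] by (simp add: indicator_def)
      have aC: "avg k (indicator C) \<in> borel_measurable borel" by (rule measurable_avg[OF iC])
      have "emeasure n C = (\<integral>\<^sup>+d. indicator C d \<partial>n)" using C bn(2) by (auto intro!: nn_integral_indicator[symmetric])
      also have "\<dots> = (\<integral>\<^sup>+c. csum k (indicator C) (rep c) \<partial>\<nu>)" by (rule int_n[OF iC])
      also have "\<dots> = (\<integral>\<^sup>+c. csum k (avg k (indicator C)) (rep c) \<partial>\<nu>)"
        using avg_comp[OF \<nu>(3) iC] by (simp add: csum_def)
      also have "\<dots> = (\<integral>\<^sup>+d. avg k (indicator C) d \<partial>n)" by (rule int_n[OF aC, symmetric])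
      also have "\<dots> = (\<integral>\<^sup>+d. ennreal (D d) * avg k (indicator C) d \<partial>m)" by (rule in_D[OF aC])
      also have "\<dots> = (\<integral>\<^sup>+d. of_nat (nn d) * (avg k (indicator C) d * p d) \<partial>m)"
      proof (rule nn_integral_cong)
        fix d
        have "of_nat (nn d) * p d = ennreal (D d)" unfolding p_def by (rule nn_div[OF D(4)])
        then show "ennreal (D d) * avg k (indicator C) d = of_nat (nn d) * (avg k (indicator C) d * p d)"
          by (metis mult.commute mult.left_commute)
      qed
      also have "\<dots> = (\<integral>\<^sup>+c. rsum k (\<lambda>d. avg k (indicator C) d * p d) (rep c) \<partial>\<mu>)"
        by (rule im_nn) (use aC pb in measurable)
      also have "\<dots> = (\<integral>\<^sup>+c. rsum k (\<lambda>d. indicator C d * avg k p d) (rep c) \<partial>\<mu>)"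
        using avg_selfadjoint[where h="indicator C" and R=R and k=k, OF \<mu>(3) cyl _ pb] unfolding rsum_def iC' ennreal_indicator by simp
      also have "\<dots> = (\<integral>\<^sup>+d. of_nat (nn d) * (indicator C d * avg k p d) \<partial>m)"
        by (rule im_nn[symmetric]) (use iC measurable_avg[OF pb] in measurable)
      also have "\<dots> = (\<integral>\<^sup>+d. of_nat (nn d) * avg k p d * indicator C d \<partial>m)"
        by (simp add: mult_ac)
      also have "\<dots> = emeasure (density m (\<lambda>d. of_nat (nn d) * avg k p d)) C"
      proof (rule emeasure_density[symmetric])
        have "(\<lambda>d. of_nat (nn d) * avg k p d) \<in> borel_measurable borel"
          using nn_meas[of of_nat] measurable_avg[OF pb] by measurable
        then show "(\<lambda>d. of_nat (nn d) * avg k p d) \<in> borel_measurable m"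
          using measurable_cong_sets[OF bm(2) refl] by blast
      qed (use C bm(2) in auto)
      finally show "emeasure n C = emeasure (density m (\<lambda>d. of_nat (nn d) * avg k p d)) C" .
    qed
    show "(\<integral>\<^sup>+c. csum k h (rep c) \<partial>\<nu>) = (\<integral>\<^sup>+c. rsum k (\<lambda>d. h d * avg k p d) (rep c) \<partial>\<mu>)"
      if h: "h \<in> borel_measurable borel" for h
    proof -
      have 1: "(\<lambda>d. of_nat (nn d) * avg k p d) \<in> borel_measurable borel"
        using nn_meas[of of_nat] measurable_avg[OF pb] by measurable
      have "(\<integral>\<^sup>+c. csum k h (rep c) \<partial>\<nu>) = (\<integral>\<^sup>+d. h d \<partial>n)" by (rule int_n[OF h, symmetric])
      also have "\<dots> = (\<integral>\<^sup>+d. of_nat (nn d) * avg k p d * h d \<partial>m)"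
        unfolding neq by (rule nn_integral_density) (use 1 h measurable_cong_sets[OF bm(2) refl] in blast)+
      also have "\<dots> = (\<integral>\<^sup>+d. of_nat (nn d) * (h d * avg k p d) \<partial>m)" by (simp add: mult_ac)
      also have "\<dots> = (\<integral>\<^sup>+c. rsum k (\<lambda>d. h d * avg k p d) (rep c) \<partial>\<mu>)"
        by (rule im_nn) (use h measurable_avg[OF pb] in measurable)
      finally show ?thesis .
    qed
  qed
qed


section \<open>Measures obtained by random cutting\<close>

text \<open>The flag selects which of the two vertices comes first, so that one argument covers both
  sides of the mass transport principle.\<close>

definition pair_at :: "bool \<Rightarrow> pre_rgraph \<Rightarrow> nat \<Rightarrow> rgraph" where
  "pair_at b X y = abs_rgraph (X\<lparr>origin := (if b then origin X else y),
     vsets := [{if b then y else origin X}]\<rparr>)"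

lemma with_roots_pair_at:
  "with_roots c (origin (rep c)) y = pair_at True (rep c) y"
  "with_roots c x (origin (rep c)) = pair_at False (rep c) x"
  by (simp_all add: with_roots_def pair_at_def)

lemma ball_iso_two_roots:
  assumes X: "wf_rgraph X" and Y: "wf_rgraph Y" and iso: "ball_via f X Y R"
    and a: "a \<in> vball X r" "r + s \<le> R"
    and b: "b \<in> vball X R"
  shows "ball_iso (abs_rgraph (X\<lparr>origin := a, vsets := [{b}]\<rparr>))
    (abs_rgraph (Y\<lparr>origin := f a, vsets := [{f b}]\<rparr>)) s"
proof -
  let ?B = "vball X R" and ?C = "vball Y R"
  let ?X = "X\<lparr>origin := a\<rparr>" and ?Y = "Y\<lparr>origin := f a\<rparr>"
  have aB: "a \<in> ?B" using a ball_verts_mono[of r R] by auto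
  have V: "a \<in> verts X" "b \<in> verts X" using aB b ball_verts_wf[OF X] by blast+
  have fV: "f a \<in> verts Y" "f b \<in> verts Y"
    using imageI[OF aB, of f] imageI[OF b, of f] image_ball[OF X Y iso, of R] ball_verts_wf[OF Y, of R] by auto
  have i: "ball_via f ?X ?Y s" by (rule rball_reroot[OF X Y iso a])
  have e: "map (\<lambda>S. {e \<in> S. e \<subseteq> vball ?Y s}) (esets ?Y) =
      map (\<lambda>S. image f ` {e \<in> S. e \<subseteq> vball ?X s}) (esets ?X)"
    using i unfolding iso_via_def rball_simps map_map o_def by (elim conjE)
  \<comment> \<open>If b is outside the s-ball around a, both sides are empty; hence b may lie
    anywhere in the R-ball.\<close>
  have "{f b} \<inter> ball_verts (edges Y) (f a) s = f ` ({b} \<inter> ball_verts (edges X) a s)"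
    using inj_on_image_Int[OF inj_on_ball[OF X Y iso], of "{b}" "ball_verts (edges X) a s"]
      b ball_sub[OF X Y iso a] ball_transport[OF X Y iso a] by simp
  then have "iso_via f (rball (?X\<lparr>vsets := [{b}], esets := esets ?X\<rparr>) s)
      (rball (?Y\<lparr>vsets := [{f b}], esets := esets ?Y\<rparr>) s)"
    by (intro iso_via_remark[OF i _ e]) simp
  then show ?thesis
    unfolding ball_iso_abs[OF wf_two_roots[OF X V] wf_two_roots[OF Y fV]] by (auto simp: iso_rgraph_def)
qed

lemma ball_iso_pair_at:
  assumes X: "wf_rgraph X" and Y: "wf_rgraph Y" and iso: "ball_via f X Y R"
    and y: "y \<in> vball X r" "r + s \<le> R"
  shows "ball_iso (pair_at b X y) (pair_at b Y (f y)) s"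
proof (cases b)
  case True
  have "y \<in> vball X R" using y ball_verts_mono[of r R] by auto
  from ball_iso_two_roots[OF X Y iso ball_verts_center[of _ _ 0] _ this, of s]
  show ?thesis using True y origin_transport[OF X Y iso] by (simp add: pair_at_def)
next
  case False
  from ball_iso_two_roots[OF X Y iso y ball_verts_center]
  show ?thesis using False origin_transport[OF X Y iso] by (simp add: pair_at_def)
qed

text \<open>Confining the second vertex to the r-ball keeps the kernel finite and local; the sum
  over all vertices is recovered as a supremum over r.\<close>

definition pair_kern :: "nat \<Rightarrow> bool \<Rightarrow> pre_rgraph \<Rightarrow> rgraph measure" where
  "pair_kern r b X = distr (count_space (vball X r)) borel (pair_at b X)"

lemma nn_integral_pair_kern:
  assumes "wf_rgraph X" "g \<in> borel_measurable borel"
  shows "(\<integral>\<^sup>+d. g d \<partial>pair_kern r b X) = (\<Sum>y\<in>vball X r. g (pair_at b X y))"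
  unfolding pair_kern_def using assms finite_ball_verts[OF assms(1)]
  by (subst nn_integral_distr) (auto simp: nn_integral_count_space_finite)

lemma local_kernel_pair: "local_kernel (pair_kern r b)"
  unfolding local_kernel_def
proof (intro conjI allI impI)
  show "sets (pair_kern r b X) = sets borel" for X by (simp add: pair_kern_def)
  show "finite_measure (pair_kern r b X)" if X: "wf_rgraph X" for X
  proof
    show "emeasure (pair_kern r b X) (space (pair_kern r b X)) \<noteq> \<infinity>"
      using nn_integral_pair_kern[OF X, of "\<lambda>_. 1" r b] by (simp add: pair_kern_def)
  qed
  fix R
  have "emeasure (pair_kern r b X) C = emeasure (pair_kern r b Y) C"
    if X: "wf_rgraph X" and Y: "wf_rgraph Y" and iso: "ball_via f X Y (r + R)"
      and C: "cylinder R C" for X Y f C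
  proof -
    have Cs: "C \<in> sets borel" using C by blast
    have em: "emeasure (pair_kern r b Z) C =
        (\<Sum>y\<in>vball Z r. indicator C (pair_at b Z y))" if "wf_rgraph Z" for Z
      using nn_integral_pair_kern[OF that, of "indicator C" r b] Cs by (simp add: pair_kern_def)
    have im: "vball Y r = f ` vball X r"
      using image_ball[OF X Y iso, of r] by simp
    have inj: "inj_on f (vball X r)"
      by (rule inj_on_subset[OF inj_on_ball[OF X Y iso]]) (rule ball_verts_mono, simp)
    show ?thesis
      unfolding em[OF X] em[OF Y] im sum.reindex[OF inj] o_def
    proof (rule sum.cong[OF refl])
      fix y assume y: "y \<in> vball X r"
      from cylinderD[OF C ball_iso_pair_at[OF X Y iso y order_refl]]
      show "indicator C (pair_at b X y) = (indicator C (pair_at b Y (f y)) :: ennreal)"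
        by (simp add: indicator_def)
    qed
  qed
  then show "\<exists>R'. \<forall>X Y f. wf_rgraph X \<longrightarrow> wf_rgraph Y \<longrightarrow> iso_via f (rball X R') (rball Y R') \<longrightarrow>
      (\<forall>C. cylinder R C \<longrightarrow> emeasure (pair_kern r b X) C = emeasure (pair_kern r b Y) C)"
    by blast
qed

lemma nn_integral_verts:
  assumes "wf_rgraph X"
  shows "(\<integral>\<^sup>+y. g y \<partial>count_space (verts X)) = (SUP r. \<Sum>y\<in>vball X r. g y)"
proof -
  let ?B = "\<lambda>r. vball X r"
  have "(\<integral>\<^sup>+y. g y \<partial>count_space (verts X)) = (\<integral>\<^sup>+y. (SUP r. g y * indicator (?B r) y) \<partial>count_space (verts X))"
  proof (rule nn_integral_cong)
    fix y assume "y \<in> space (count_space (verts X))"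
    then obtain r where "y \<in> ?B r" using verts_in_ball[OF assms] by auto
    then show "g y = (SUP r. g y * indicator (?B r) y)"
      by (intro antisym SUP_upper2[of r] SUP_least) (auto simp: indicator_def)
  qed
  also have "\<dots> = (SUP r. \<integral>\<^sup>+y. g y * indicator (?B r) y \<partial>count_space (verts X))"
  proof (rule nn_integral_monotone_convergence_SUP)
    show "incseq (\<lambda>r y. g y * indicator (?B r) y)"
      unfolding incseq_def le_fun_def using ball_verts_mono by (fastforce simp: indicator_def)
  qed simp
  also have "\<dots> = (SUP r. \<Sum>y\<in>?B r. g y)"
  proof (rule SUP_cong[OF refl])
    fix r
    have "(\<integral>\<^sup>+y. g y * indicator (?B r) y \<partial>count_space (verts X)) = (\<Sum>y\<in>?B r. g y * indicator (?B r) y)"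
      by (rule nn_integral_count_space') (use finite_ball_verts[OF assms] ball_verts_wf[OF assms] in auto)
    then show "(\<integral>\<^sup>+y. g y * indicator (?B r) y \<partial>count_space (verts X)) = (\<Sum>y\<in>?B r. g y)"
      by (simp cong: sum.cong)
  qed
  finally show ?thesis .
qed

lemma nn_integral_pairs:
  assumes "wf_rgraph X" "g \<in> borel_measurable borel"
  shows "(\<integral>\<^sup>+y. g (pair_at b X y) \<partial>count_space (verts X)) = (SUP r. \<integral>\<^sup>+d. g d \<partial>pair_kern r b X)"
  unfolding nn_integral_verts[OF assms(1)] nn_integral_pair_kern[OF assms] ..

lemma measurable_pairs:
  assumes g: "g \<in> borel_measurable borel"
  shows "(\<lambda>c. \<integral>\<^sup>+y. g (pair_at b (rep c) y) \<partial>count_space (verts (rep c))) \<in> borel_measurable borel"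
  unfolding nn_integral_pairs[OF wf_rep_rgraph g] using local_kernel_measurable[OF local_kernel_pair g] by simp

lemma pairs_rep_abs:
  assumes X: "wf_rgraph X" and g: "g \<in> borel_measurable borel"
  shows "(\<integral>\<^sup>+y. g (pair_at b (rep (abs_rgraph X)) y) \<partial>count_space (verts (rep (abs_rgraph X)))) =
    (\<integral>\<^sup>+y. g (pair_at b X y) \<partial>count_space (verts X))"
  unfolding nn_integral_pairs[OF wf_rep_rgraph g] nn_integral_pairs[OF X g]
  by (simp add: local_kernel_rep_abs[OF local_kernel_pair X])

section \<open>Unimodularity of the cut graph\<close>

lemma unimodular_iff:
  "unimodular \<mu> \<longleftrightarrow> (\<forall>f\<in>borel_measurable borel.
     (\<integral>\<^sup>+c. (\<integral>\<^sup>+x. f (pair_at False (rep c) x) \<partial>count_space (verts (rep c))) \<partial>\<mu>) =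
     (\<integral>\<^sup>+c. (\<integral>\<^sup>+y. f (pair_at True (rep c) y) \<partial>count_space (verts (rep c))) \<partial>\<mu>))"
  unfolding unimodular_def with_roots_pair_at by blast

lemma cut_graph_update:
  "(cut_graph \<K> X \<omega>)\<lparr>origin := a, vsets := As\<rparr> = cut_graph \<K> (X\<lparr>origin := a, vsets := As\<rparr>) \<omega>"
  by (cases X) (simp add: cut_graph_def cut_edges_def)

text \<open>Neither the clocks nor the cut edges refer to the root, so cutting commutes with
  choosing two roots, for each realisation of the clocks.\<close>

lemma cut_graph_pair_at:
  fixes b :: bool and X :: pre_rgraph and y :: nat
  assumes "wf_rgraph X" "y \<in> verts X"
  defines "X' \<equiv> X\<lparr>origin := (if b then origin X else y), vsets := [{if b then y else origin X}]\<rparr>"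
  shows "wf_rgraph X'" "pair_at b (cut_graph (small k X) X \<omega>) y = abs_rgraph (cut_graph (small k X') X' \<omega>)"
    "ring_law k q X = ring_law k q X'" "pair_at b X y = abs_rgraph X'"
proof -
  have "origin X \<in> verts X" using assms(1) by (simp add: wf_rgraph_def)
  then show "wf_rgraph X'" unfolding X'_def using assms(1,2) by (intro wf_two_roots) simp_all
  have "origin (cut_graph (small k X) X \<omega>) = origin X" by (simp add: cut_graph_def)
  then show "pair_at b (cut_graph (small k X) X \<omega>) y = abs_rgraph (cut_graph (small k X') X' \<omega>)"
    unfolding pair_at_def X'_def by (simp add: cut_graph_update)
  show "ring_law k q X = ring_law k q X'" unfolding ring_law_def X'_def by simp
  show "pair_at b X y = abs_rgraph X'" unfolding pair_at_def X'_def ..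
qed

context
  fixes k :: nat and q :: "nat set \<Rightarrow> nat set set \<Rightarrow> nat set \<Rightarrow> real" and \<mu> :: "rgraph measure"
  assumes q: "local_rate k q" and \<mu>: "prob_space \<mu>" "sets \<mu> = sets borel"
begin

definition cut_measure :: "rgraph measure" where
  "cut_measure = \<mu> \<bind> (\<lambda>c. cut_law k q (rep c))"

lemma measurable_cut_law: "(\<lambda>c. cut_law k q (rep c)) \<in> measurable \<mu> (subprob_algebra borel)"
  by (rule local_kernel_measurable_subprob[OF local_kernel_cut_law[OF q] _ \<mu>(2)])
    (metis prob_space.emeasure_space_1 prob_space_cut_law space_cut_law order_refl)

lemma prob_space_cut_measure: "prob_space cut_measure"
  unfolding cut_measure_def
  by (rule prob_space.prob_space_bind[OF \<mu>(1) _ measurable_cut_law]) (simp add: prob_space_cut_law wf_rep_rgraph)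

lemma sets_cut_measure: "sets cut_measure = sets borel"
  unfolding cut_measure_def by (rule sets_bind[OF _ prob_space.not_empty[OF \<mu>(1)]]) simp

lemma nn_integral_cut_measure:
  assumes "g \<in> borel_measurable borel"
  shows "(\<integral>\<^sup>+d. g d \<partial>cut_measure) =
    (\<integral>\<^sup>+c. (\<integral>\<^sup>+\<omega>. g (abs_rgraph (cut_graph (small k (rep c)) (rep c) \<omega>)) \<partial>ring_law k q (rep c)) \<partial>\<mu>)"
  unfolding cut_measure_def nn_integral_bind[OF assms measurable_cut_law]
    nn_integral_cut_law[OF wf_rep_rgraph assms] ..

lemma AE_cut_measure:
  assumes P: "{d. P d} \<in> sets borel"
    and ae: "AE c in \<mu>. \<forall>\<omega>. P (abs_rgraph (cut_graph (small k (rep c)) (rep c) \<omega>))"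
  shows "AE d in cut_measure. P d"
proof -
  have "Measurable.pred borel P" using P by (simp add: pred_def)
  note * = AE_bind[OF measurable_cut_law this, folded cut_measure_def]
  have "AE c in \<mu>. AE d in cut_law k q (rep c). P d"
    using ae
  proof (rule eventually_mono)
    fix c assume c: "\<forall>\<omega>. P (abs_rgraph (cut_graph (small k (rep c)) (rep c) \<omega>))"
    have "AE \<omega> in ring_law k q (rep c). P (abs_rgraph (cut_graph (small k (rep c)) (rep c) \<omega>))"
      using c by simp
    then show "AE d in cut_law k q (rep c). P d"
      unfolding cut_law_def using P by (subst AE_distr_iff[OF measurable_cut_graph[OF wf_rep_rgraph]]) auto
  qed
  then show ?thesis using * by simp
qed

text \<open>Let g(G, x, y) be the mean of f(G, S, x, y) over the random cut set S. Since the law of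
  S does not depend on the root, each side of the principle for f under the cut measure equals the
  corresponding side for g under \<mu>.\<close>

lemma unimodular_cut_measure:
  assumes um: "unimodular \<mu>"
  shows "unimodular cut_measure"
  unfolding unimodular_iff
proof
  fix f :: "rgraph \<Rightarrow> ennreal" assume f: "f \<in> borel_measurable borel"
  define g where "g d = (\<integral>\<^sup>+d'. f d' \<partial>cut_law k q (rep d))" for d
  have g: "g \<in> borel_measurable borel"
    unfolding g_def by (rule local_kernel_measurable[OF local_kernel_cut_law[OF q] f])
  have "(\<integral>\<^sup>+c. (\<integral>\<^sup>+y. f (pair_at b (rep c) y) \<partial>count_space (verts (rep c))) \<partial>cut_measure) =
      (\<integral>\<^sup>+c. (\<integral>\<^sup>+y. g (pair_at b (rep c) y) \<partial>count_space (verts (rep c))) \<partial>\<mu>)" for b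
    unfolding nn_integral_cut_measure[OF measurable_pairs[OF f]]
  proof (rule nn_integral_cong)
    fix c
    let ?X = "rep c"
    let ?Z = "cut_graph (small k ?X) ?X"
    let ?B = "\<lambda>r. vball ?X r"
    note wf = wf_rep_rgraph[of c]
    have ms: "(\<lambda>\<omega>. f (pair_at b (?Z \<omega>) y)) \<in> borel_measurable (ring_law k q ?X)" if y: "y \<in> verts ?X" for y
      unfolding cut_graph_pair_at(2)[OF wf y] cut_graph_pair_at(3)[OF wf y, of k q b]
      by (rule measurable_compose[OF measurable_cut_graph[OF cut_graph_pair_at(1)[OF wf y]] f])
    have int: "(\<integral>\<^sup>+\<omega>. f (pair_at b (?Z \<omega>) y) \<partial>ring_law k q ?X) = g (pair_at b ?X y)" if y: "y \<in> verts ?X" for y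
      unfolding cut_graph_pair_at(2)[OF wf y] cut_graph_pair_at(3)[OF wf y, of k q b]
        nn_integral_cut_law[OF cut_graph_pair_at(1)[OF wf y] f, symmetric]
        cut_graph_pair_at(4)[OF wf y] g_def
        local_kernel_rep_abs[OF local_kernel_cut_law[OF q] cut_graph_pair_at(1)[OF wf y]] ..
    have BV: "y \<in> verts ?X" if "y \<in> ?B r" for y r using that ball_verts_wf[OF wf] by blast
    have "(\<integral>\<^sup>+\<omega>. (\<integral>\<^sup>+y. f (pair_at b (rep (abs_rgraph (?Z \<omega>))) y)
        \<partial>count_space (verts (rep (abs_rgraph (?Z \<omega>))))) \<partial>ring_law k q ?X) =
      (\<integral>\<^sup>+\<omega>. (SUP r. \<Sum>y\<in>?B r. f (pair_at b (?Z \<omega>) y)) \<partial>ring_law k q ?X)"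
      unfolding pairs_rep_abs[OF wf_cut_graph[OF wf] f] nn_integral_verts[OF wf_cut_graph[OF wf]]
      by (simp add: cut_graph_def)
    \<comment> \<open>The balls increase to the vertex set and do not depend on the clocks, so
      monotone convergence exchanges the sum over vertices with the mean over the clocks.\<close>
    also have "\<dots> = (SUP r. \<integral>\<^sup>+\<omega>. (\<Sum>y\<in>?B r. f (pair_at b (?Z \<omega>) y)) \<partial>ring_law k q ?X)"
    proof (rule nn_integral_monotone_convergence_SUP)
      show "incseq (\<lambda>r \<omega>. \<Sum>y\<in>?B r. f (pair_at b (?Z \<omega>) y))"
        unfolding incseq_def le_fun_def
        by (intro allI impI sum_mono2 finite_ball_verts[OF wf] ball_verts_mono) auto
      show "(\<lambda>\<omega>. \<Sum>y\<in>?B r. f (pair_at b (?Z \<omega>) y)) \<in> borel_measurable (ring_law k q ?X)" for r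
        by (intro borel_measurable_sum ms BV)
    qed
    also have "\<dots> = (SUP r. \<Sum>y\<in>?B r. g (pair_at b ?X y))"
    proof (rule SUP_cong[OF refl])
      fix r
      have "(\<integral>\<^sup>+\<omega>. (\<Sum>y\<in>?B r. f (pair_at b (?Z \<omega>) y)) \<partial>ring_law k q ?X) =
          (\<Sum>y\<in>?B r. \<integral>\<^sup>+\<omega>. f (pair_at b (?Z \<omega>) y) \<partial>ring_law k q ?X)"
        by (rule nn_integral_sum) (rule ms[OF BV])
      also have "\<dots> = (\<Sum>y\<in>?B r. g (pair_at b ?X y))" by (rule sum.cong[OF refl]) (rule int[OF BV])
      finally show "(\<integral>\<^sup>+\<omega>. (\<Sum>y\<in>?B r. f (pair_at b (?Z \<omega>) y)) \<partial>ring_law k q ?X) =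
          (\<Sum>y\<in>?B r. g (pair_at b ?X y))" .
    qed
    finally show "(\<integral>\<^sup>+\<omega>. (\<integral>\<^sup>+y. f (pair_at b (rep (abs_rgraph (?Z \<omega>))) y)
        \<partial>count_space (verts (rep (abs_rgraph (?Z \<omega>))))) \<partial>ring_law k q ?X) =
      (\<integral>\<^sup>+y. g (pair_at b ?X y) \<partial>count_space (verts ?X))"
      unfolding nn_integral_verts[OF wf] .
  qed
  then show "(\<integral>\<^sup>+c. (\<integral>\<^sup>+x. f (pair_at False (rep c) x) \<partial>count_space (verts (rep c))) \<partial>cut_measure) =
      (\<integral>\<^sup>+c. (\<integral>\<^sup>+y. f (pair_at True (rep c) y) \<partial>count_space (verts (rep c))) \<partial>cut_measure)"
    using um g unfolding unimodular_iff by simp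
qed

lemma distr_cut_measure:
  assumes rooted: "AE c in \<mu>. c \<in> rooted_graphs"
  shows "distr cut_measure borel forget_marks = \<mu>"
proof (rule measure_eqI)
  show "sets (distr cut_measure borel forget_marks) = sets \<mu>" using \<mu>(2) by simp
  fix A assume "A \<in> sets (distr cut_measure borel forget_marks)"
  then have A: "A \<in> sets borel" by simp
  have fm: "forget_marks \<in> measurable cut_measure borel"
    using measurable_forget_marks measurable_cong_sets[OF sets_cut_measure refl] by blast
  have iA: "(\<lambda>d. indicator A (forget_marks d) :: ennreal) \<in> borel_measurable borel" using A by measurable
  have "emeasure (distr cut_measure borel forget_marks) A = (\<integral>\<^sup>+d. indicator A d \<partial>distr cut_measure borel forget_marks)"
    using A by simp
  also have "\<dots> = (\<integral>\<^sup>+d. indicator A (forget_marks d) \<partial>cut_measure)"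
    by (rule nn_integral_distr[OF fm]) (use A in simp)
  also have "\<dots> = (\<integral>\<^sup>+c. indicator A c \<partial>\<mu>)"
    unfolding nn_integral_cut_measure[OF iA]
  proof (rule nn_integral_cong_AE, use rooted in \<open>rule eventually_mono\<close>)
    fix c assume "c \<in> rooted_graphs"
    then have "rep c\<lparr>esets := []\<rparr> = rep c" by (simp add: rooted_graphs_def)
    then have "forget_marks (abs_rgraph (cut_graph (small k (rep c)) (rep c) \<omega>)) = c" for \<omega>
      unfolding forget_marks_abs[OF wf_cut_graph[OF wf_rep_rgraph]] by (simp add: cut_graph_def abs_rep_rgraph)
    then show "(\<integral>\<^sup>+\<omega>. indicator A (forget_marks (abs_rgraph (cut_graph (small k (rep c)) (rep c) \<omega>)))
        \<partial>ring_law k q (rep c)) = indicator A c"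
      using prob_space.emeasure_space_1[OF prob_space_ring] by simp
  qed
  also have "\<dots> = emeasure \<mu> A" using A \<mu>(2) by simp
  finally show "emeasure (distr cut_measure borel forget_marks) A = emeasure \<mu> A" .
qed

end

text \<open>An isomorphism maps the lists of marks entry by entry, so already balls of radius 0
  reveal their lengths.\<close>

lemma local_fun_lengths: "local_fun (\<lambda>X. (length (vsets X), length (esets X)))"
  unfolding local_fun_def
proof (intro exI[of _ 0] allI impI)
  fix X Y f assume iso: "ball_via f X Y 0"
  have v: "map (\<lambda>A. A \<inter> vball Y 0) (vsets Y) =
      map (\<lambda>A. f ` (A \<inter> vball X 0)) (vsets X)"
    using iso unfolding iso_via_def rball_simps map_map o_def by (elim conjE)
  have e: "map (\<lambda>S. {e \<in> S. e \<subseteq> vball Y 0}) (esets Y) =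
      map (\<lambda>S. image f ` {e \<in> S. e \<subseteq> vball X 0}) (esets X)"
    using iso unfolding iso_via_def rball_simps map_map o_def by (elim conjE)
  show "(length (vsets X), length (esets X)) = (length (vsets Y), length (esets Y))"
    using arg_cong[OF v, of length] arg_cong[OF e, of length] by simp
qed

lemma local_fun_edge_marked: "local_fun (\<lambda>X. vsets X = [] \<and> length (esets X) = 1)"
  using local_fun_comp[OF local_fun_lengths, of "\<lambda>(a, b). a = 0 \<and> b = 1"] by simp

lemma edge_marked_abs: "wf_rgraph X \<Longrightarrow>
    abs_rgraph X \<in> edge_marked_graphs \<longleftrightarrow> vsets X = [] \<and> length (esets X) = 1"
  using local_fun_rep_abs[OF local_fun_edge_marked] by (simp add: edge_marked_graphs_def)

lemma sets_edge_marked: "edge_marked_graphs \<in> sets borel"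
  using measurable_local_fun[OF local_fun_edge_marked, where N="count_space UNIV"]
  by (simp add: edge_marked_graphs_def pred_def)


section \<open>The expected number of cut_edges edges at the root\<close>

definition cut_degree :: "pre_rgraph \<Rightarrow> nat" where
  "cut_degree X = card {e \<in> cutset X. origin X \<in> e}"

lemma cutset_sub: "wf_rgraph X \<Longrightarrow> cutset X \<subseteq> edges X"
  by (auto simp: wf_rgraph_def cutset_def)

lemma cut_degree_nbrs:
  "wf_rgraph X \<Longrightarrow> cut_degree X = card {v \<in> nbrs X. {origin X, v} \<in> cutset X}"
  unfolding cut_degree_def using incident_nbrs[OF _ cutset_sub] cutset_sub[of X]
  by (auto intro!: arg_cong[where f=card])

lemma local_fun_cut_degree: "local_fun cut_degree"
  unfolding local_fun_def
proof (intro exI[of _ 1] allI impI)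
  fix X Y f
  assume X: "wf_rgraph X" and Y: "wf_rgraph Y" and iso: "ball_via f X Y 1"
  let ?B = "vball X 1" and ?C = "vball Y 1"
  have bij: "bij_betw f (nbrs X) (nbrs Y)"
    using nbr_transport[OF X Y iso] by simp
  have "bij_betw f {v \<in> nbrs X. {origin X, v} \<in> cutset X}
      {v \<in> nbrs Y. {origin Y, v} \<in> cutset Y}"
  proof (rule bij_betw_Collect[OF bij])
    fix v assume "v \<in> nbrs X"
    then have e: "{origin X, v} \<subseteq> ?B" using nbr_in_ball ball_verts_center by auto
    have fe: "f ` {origin X, v} = {origin Y, f v}" using origin_transport[OF X Y iso] by simp
    have feC: "f ` {origin X, v} \<subseteq> ?C" using image_mono[OF e, of f] image_ball[OF X Y iso, of 1] by simp
    have "f ` {origin X, v} \<in> cutset Y \<longleftrightarrow> f ` {origin X, v} \<in> {e \<in> cutset Y. e \<subseteq> ?C}" using feC by blast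
    also have "\<dots> \<longleftrightarrow> f ` {origin X, v} \<in> image f ` {e \<in> cutset X. e \<subseteq> ?B}"
      unfolding cutset_transport[OF iso] ..
    also have "\<dots> \<longleftrightarrow> {origin X, v} \<in> {e \<in> cutset X. e \<subseteq> ?B}"
      by (rule inj_on_image_mem_iff[OF inj_on_image_Pow[OF inj_on_ball[OF X Y iso]]]) (use e in auto)
    also have "\<dots> \<longleftrightarrow> {origin X, v} \<in> cutset X" using e by blast
    finally show "{origin Y, f v} \<in> cutset Y \<longleftrightarrow> {origin X, v} \<in> cutset X" unfolding fe .
  qed
  then show "cut_degree X = cut_degree Y"
    unfolding cut_degree_nbrs[OF X] cut_degree_nbrs[OF Y] by (rule bij_betw_same_card)
qed

text \<open>Bounds the probability that the edge to v is cut on account of the root: a ringing set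
  contains the root but not v, or no ringing set contains the root.\<close>

definition outflow :: "nat \<Rightarrow> (nat set \<Rightarrow> nat set set \<Rightarrow> nat set \<Rightarrow> real) \<Rightarrow> pre_rgraph \<Rightarrow> nat \<Rightarrow> ennreal" where
  "outflow k q X v = (\<Sum>K\<in>{K \<in> at_root k X. v \<notin> K}. ennreal (q (verts X) (edges X) K)) +
     ennreal (exp (- (\<Sum>K\<in>at_root k X. q (verts X) (edges X) K)))"

text \<open>The edge is cut if a ringing set separates its endpoints or an endpoint is uncovered.
  These four events are grouped by endpoint; a union bound does the rest.\<close>

lemma cut_probability:
  assumes X: "wf_rgraph X" and q: "\<And>K. 0 \<le> q (verts X) (edges X) K" and uv: "{u, v} \<in> edges X"
  shows "{\<omega> \<in> space (ring_law k q X). {u, v} \<in> cut_edges (small k X) X \<omega>} \<in> sets (ring_law k q X)"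
    "emeasure (ring_law k q X) {\<omega> \<in> space (ring_law k q X). {u, v} \<in> cut_edges (small k X) X \<omega>} \<le>
      outflow k q (X\<lparr>origin := u\<rparr>) v + outflow k q (X\<lparr>origin := v\<rparr>) u"
proof -
  let ?P = "ring_law k q X"
  let ?S = "\<lambda>K. {\<omega> \<in> space ?P. \<omega> K}"
  let ?T = "\<lambda>u v. {K \<in> at_root k (X\<lparr>origin := u\<rparr>). v \<notin> K}"
  let ?U = "\<lambda>u. {\<omega> \<in> space ?P. \<forall>K\<in>at_root k (X\<lparr>origin := u\<rparr>). \<not> \<omega> K}"
  have V: "u \<in> verts X" "v \<in> verts X" using X uv by (auto simp: wf_rgraph_def)
  have fin: "finite (at_root k (X\<lparr>origin := w\<rparr>))" if "w \<in> verts X" for w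
    by (rule finite_near[OF wf_reroot[OF X that]])
  have sub: "at_root k (X\<lparr>origin := w\<rparr>) \<subseteq> small k X" for w by (auto simp: at_root_iff)
  have S: "?S K \<in> sets ?P" "emeasure ?P (?S K) \<le> ennreal (q (verts X) (edges X) K)"
    if "K \<in> at_root k (X\<lparr>origin := w\<rparr>)" for K w
    using emeasure_ring_single[of K k X q] that sub q by blast+
  have U: "?U w \<in> sets ?P"
    "emeasure ?P (?U w) = ennreal (exp (- (\<Sum>K\<in>at_root k (X\<lparr>origin := w\<rparr>). q (verts X) (edges X) K)))"
    if "w \<in> verts X" for w
    using emeasure_ring_none[OF sub fin[OF that], of q] q by blast+
  have T: "finite (?T w w')" if "w \<in> verts X" for w w' using fin[OF that] by simp
  have US: "(\<Union>K\<in>?T w w'. ?S K) \<in> sets ?P" if "w \<in> verts X" for w w'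
    using T[OF that] S(1) by (intro sets.finite_UN) auto
  have USb: "emeasure ?P (\<Union>K\<in>?T w w'. ?S K) \<le> (\<Sum>K\<in>?T w w'. ennreal (q (verts X) (edges X) K))"
    if "w \<in> verts X" for w w'
  proof -
    have "emeasure ?P (\<Union>K\<in>?T w w'. ?S K) \<le> (\<Sum>K\<in>?T w w'. emeasure ?P (?S K))"
      by (rule emeasure_subadditive_finite) (use T[OF that] S(1) in auto)
    also have "\<dots> \<le> (\<Sum>K\<in>?T w w'. ennreal (q (verts X) (edges X) K))"
      by (rule sum_mono) (use S(2) in auto)
    finally show ?thesis .
  qed
  have eq: "{\<omega> \<in> space ?P. {u, v} \<in> cut_edges (small k X) X \<omega>} =
      ((\<Union>K\<in>?T u v. ?S K) \<union> ?U u) \<union> ((\<Union>K\<in>?T v u. ?S K) \<union> ?U v)"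
    using uv by (auto simp: cut_edges_def at_root_iff)
  show "{\<omega> \<in> space ?P. {u, v} \<in> cut_edges (small k X) X \<omega>} \<in> sets ?P"
    unfolding eq using US U V by (intro sets.Un) auto
  have half: "emeasure ?P ((\<Union>K\<in>?T w w'. ?S K) \<union> ?U w) \<le> outflow k q (X\<lparr>origin := w\<rparr>) w'"
    if "w \<in> verts X" for w w'
  proof -
    have "emeasure ?P ((\<Union>K\<in>?T w w'. ?S K) \<union> ?U w) \<le> emeasure ?P (\<Union>K\<in>?T w w'. ?S K) + emeasure ?P (?U w)"
      by (rule emeasure_subadditive[OF US[OF that] U(1)[OF that]])
    also have "\<dots> \<le> outflow k q (X\<lparr>origin := w\<rparr>) w'"
      unfolding outflow_def using USb[OF that] U(2)[OF that] by (intro add_mono) auto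
    finally show ?thesis .
  qed
  have "emeasure ?P (((\<Union>K\<in>?T u v. ?S K) \<union> ?U u) \<union> ((\<Union>K\<in>?T v u. ?S K) \<union> ?U v)) \<le>
      emeasure ?P ((\<Union>K\<in>?T u v. ?S K) \<union> ?U u) + emeasure ?P ((\<Union>K\<in>?T v u. ?S K) \<union> ?U v)"
    by (rule emeasure_subadditive) (use US U V in \<open>auto intro: sets.Un\<close>)
  also have "\<dots> \<le> outflow k q (X\<lparr>origin := u\<rparr>) v + outflow k q (X\<lparr>origin := v\<rparr>) u"
    by (rule add_mono[OF half[OF V(1)] half[OF V(2)]])
  finally show "emeasure ?P {\<omega> \<in> space ?P. {u, v} \<in> cut_edges (small k X) X \<omega>} \<le>
      outflow k q (X\<lparr>origin := u\<rparr>) v + outflow k q (X\<lparr>origin := v\<rparr>) u" unfolding eq .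
qed

lemma measurable_cut_degree: "(\<lambda>d. of_nat (cut_degree (rep d)) :: ennreal) \<in> borel_measurable borel"
  by (rule measurable_local_fun[OF local_fun_comp[OF local_fun_cut_degree, where h=of_nat]]) simp

lemma cut_degree_abs: "wf_rgraph X \<Longrightarrow> cut_degree (rep (abs_rgraph X)) = cut_degree X"
  by (rule local_fun_rep_abs[OF local_fun_cut_degree])

lemma expected_cut_degree:
  assumes X: "wf_rgraph X" and q: "\<And>K. 0 \<le> q (verts X) (edges X) K"
  shows "(\<integral>\<^sup>+d. of_nat (cut_degree (rep d)) \<partial>cut_law k q X) \<le>
    (\<Sum>v\<in>nbrs X. outflow k q X v + outflow k q (X\<lparr>origin := v\<rparr>) (origin X))"
proof -
  let ?N = "nbrs X" and ?P = "ring_law k q X"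
  let ?A = "\<lambda>v. {\<omega> \<in> space ?P. {origin X, v} \<in> cut_edges (small k X) X \<omega>}"
  have fin: "finite ?N" by (rule finite_nbrs[OF X])
  have "(\<integral>\<^sup>+d. of_nat (cut_degree (rep d)) \<partial>cut_law k q X) =
      (\<integral>\<^sup>+\<omega>. of_nat (cut_degree (cut_graph (small k X) X \<omega>)) \<partial>?P)"
    unfolding nn_integral_cut_law[OF X measurable_cut_degree] cut_degree_abs[OF wf_cut_graph[OF X]] ..
  also have "\<dots> = (\<integral>\<^sup>+\<omega>. (\<Sum>v\<in>?N. indicator (?A v) \<omega>) \<partial>?P)"
  proof (rule nn_integral_cong)
    fix \<omega> assume \<omega>: "\<omega> \<in> space ?P"
    have "cut_degree (cut_graph (small k X) X \<omega>) = card {v \<in> ?N. {origin X, v} \<in> cut_edges (small k X) X \<omega>}"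
      unfolding cut_degree_nbrs[OF wf_cut_graph[OF X]] by (simp add: cut_graph_def cutset_def)
    also have "\<dots> = (\<Sum>v\<in>?N. of_bool ({origin X, v} \<in> cut_edges (small k X) X \<omega>))"
      using fin by (simp add: of_bool_def sum.If_cases Int_def)
    finally have "of_nat (cut_degree (cut_graph (small k X) X \<omega>)) =
        (\<Sum>v\<in>?N. of_bool ({origin X, v} \<in> cut_edges (small k X) X \<omega>) :: ennreal)" by simp
    then show "of_nat (cut_degree (cut_graph (small k X) X \<omega>)) = (\<Sum>v\<in>?N. indicator (?A v) \<omega> :: ennreal)"
      using \<omega> by (simp add: indicator_def of_bool_def)
  qed
  also have "\<dots> = (\<Sum>v\<in>?N. emeasure ?P (?A v))"
    using cut_probability(1)[where q=q, OF X q] by (subst nn_integral_sum) auto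
  also have "\<dots> \<le> (\<Sum>v\<in>?N. outflow k q X v + outflow k q (X\<lparr>origin := v\<rparr>) (origin X))"
    using cut_probability(2)[where q=q and k=k and u="origin X", OF X q] by (intro sum_mono) auto
  finally show ?thesis .
qed

text \<open>The mass that x sends to a neighbour y. Summing over the neighbours inside the marked
  set, which is {y} for (G, x, y), expresses it without naming y.\<close>

definition nbr_flow :: "nat \<Rightarrow> (nat set \<Rightarrow> nat set set \<Rightarrow> nat set \<Rightarrow> real) \<Rightarrow> pre_rgraph \<Rightarrow> ennreal" where
  "nbr_flow k q X = (\<Sum>v\<in>{v \<in> nbrs X. v \<in> \<Union>(set (vsets X))}. outflow k q X v)"

lemma local_fun_nbr_flow:
  assumes q: "local_rate k q"
  shows "local_fun (nbr_flow k q)"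
proof -
  obtain Rq where Rq: "\<And>X Y f R r K. wf_rgraph X \<Longrightarrow> wf_rgraph Y \<Longrightarrow> ball_via f X Y R \<Longrightarrow>
      r + Rq \<le> R \<Longrightarrow> K \<in> near k r X \<Longrightarrow> q (verts Y) (edges Y) (f ` K) = q (verts X) (edges X) K"
    using local_rate_near[OF q] by blast
  let ?R = "2 * (k * k) + 1 + Rq"
  show ?thesis
    unfolding local_fun_def
  proof (intro exI[of _ ?R] allI impI)
    fix X Y f
    assume X: "wf_rgraph X" and Y: "wf_rgraph Y" and iso: "ball_via f X Y ?R"
    have qq: "q (verts Y) (edges Y) (f ` K) = q (verts X) (edges X) K" if "K \<in> at_root k X" for K
      using Rq[OF X Y iso _ that] by simp
    have bijK: "bij_betw (image f) (at_root k X) (at_root k Y)"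
      using near_transport[OF X Y iso, of 0 k] by simp
    have bijN: "bij_betw f (nbrs X) (nbrs Y)"
      using nbr_transport[OF X Y iso] by simp
    have nB: "v \<in> vball X ?R" if "{origin X, v} \<in> edges X" for v
      using nbr_in_ball[OF that] ball_verts_mono[of 1 ?R "edges X" "origin X"] by auto
    have bijV: "bij_betw f {v \<in> nbrs X. v \<in> \<Union>(set (vsets X))}
        {v \<in> nbrs Y. v \<in> \<Union>(set (vsets Y))}"
      by (rule bij_betw_Collect[OF bijN], rule vsets_mem_transport[OF X Y iso nB]) simp
    have flow: "outflow k q Y (f v) = outflow k q X v" if v: "{origin X, v} \<in> edges X" for v
    proof -
      have mem: "f v \<notin> f ` K \<longleftrightarrow> v \<notin> K" if K: "K \<in> at_root k X" for K
      proof -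
        have "K \<subseteq> vball X ?R"
          using K_sub[OF X Y iso _ K] by simp
        then show ?thesis using inj_on_image_mem_iff[OF inj_on_ball[OF X Y iso] nB[OF v]] by simp
      qed
      have b: "bij_betw (image f) {K \<in> at_root k X. v \<notin> K} {L \<in> at_root k Y. f v \<notin> L}"
        by (rule bij_betw_Collect[OF bijK]) (rule mem)
      show ?thesis
        unfolding outflow_def sum.reindex_bij_betw[OF b, symmetric] sum.reindex_bij_betw[OF bijK, symmetric]
        using qq by simp
    qed
    show "nbr_flow k q X = nbr_flow k q Y"
      unfolding nbr_flow_def sum.reindex_bij_betw[OF bijV, symmetric]
      using flow by (intro sum.cong) auto
  qed
qed


lemma outflow_vsets [simp]: "outflow k q (X\<lparr>vsets := As\<rparr>) v = outflow k q X v"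
  by (simp add: outflow_def)

lemma nn_integral_nbrs:
  assumes X: "wf_rgraph X"
  shows "(\<integral>\<^sup>+y. (if {origin X, y} \<in> edges X then g y else 0) \<partial>count_space (verts X)) =
    (\<Sum>v\<in>nbrs X. g v)"
proof -
  have "(\<integral>\<^sup>+y. (if {origin X, y} \<in> edges X then g y else 0) \<partial>count_space (verts X)) =
      (\<Sum>y\<in>nbrs X. if {origin X, y} \<in> edges X then g y else 0)"
    by (rule nn_integral_count_space') (use X finite_nbrs[OF X] in \<open>auto simp: wf_rgraph_def\<close>)
  then show ?thesis by simp
qed

lemma nbr_flow_pair_at:
  assumes q: "local_rate k q" and X: "wf_rgraph X" and y: "y \<in> verts X"
  shows "nbr_flow k q (rep (pair_at True X y)) = (if {origin X, y} \<in> edges X then outflow k q X y else 0)"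
    "nbr_flow k q (rep (pair_at False X y)) =
      (if {origin X, y} \<in> edges X then outflow k q (X\<lparr>origin := y\<rparr>) (origin X) else 0)"
proof -
  have o: "origin X \<in> verts X" using X by (simp add: wf_rgraph_def)
  have *: "nbr_flow k q (rep (abs_rgraph (X\<lparr>origin := a, vsets := [{b}]\<rparr>))) =
      (if {a, b} \<in> edges X then outflow k q (X\<lparr>origin := a\<rparr>) b else 0)"
    if "a \<in> verts X" "b \<in> verts X" for a b
  proof -
    have "{v \<in> {v. {a, v} \<in> edges X}. v \<in> {b}} = (if {a, b} \<in> edges X then {b} else {})" by auto
    then show ?thesis
      unfolding local_fun_rep_abs[OF local_fun_nbr_flow[OF q] wf_two_roots[OF X that]]
      by (simp add: nbr_flow_def)
  qed
  show "nbr_flow k q (rep (pair_at True X y)) = (if {origin X, y} \<in> edges X then outflow k q X y else 0)"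
    using *[OF o y] by (simp add: pair_at_def)
  show "nbr_flow k q (rep (pair_at False X y)) =
      (if {origin X, y} \<in> edges X then outflow k q (X\<lparr>origin := y\<rparr>) (origin X) else 0)"
    using *[OF y o] by (simp add: pair_at_def insert_commute)
qed

text \<open>
  An edge may be cut_edges on behalf of either endpoint; mass transport makes the two contributions
  equal in expectation.
\<close>

lemma expected_flow:
  assumes q: "local_rate k q" and \<mu>: "sets \<mu> = sets borel" "unimodular \<mu>"
  shows "(\<integral>\<^sup>+c. (\<integral>\<^sup>+d. of_nat (cut_degree (rep d)) \<partial>cut_law k q (rep c)) \<partial>\<mu>) \<le>
    2 * (\<integral>\<^sup>+c. (\<Sum>v\<in>nbrs (rep c). outflow k q (rep c) v) \<partial>\<mu>)"
proof -
  let ?f = "\<lambda>d. nbr_flow k q (rep d)"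
  let ?N = "\<lambda>X. nbrs X"
  have f: "?f \<in> borel_measurable borel"
    by (rule measurable_local_fun[OF local_fun_nbr_flow[OF q]]) simp
  have out: "(\<integral>\<^sup>+y. ?f (pair_at True X y) \<partial>count_space (verts X)) = (\<Sum>v\<in>?N X. outflow k q X v)"
    and inn: "(\<integral>\<^sup>+y. ?f (pair_at False X y) \<partial>count_space (verts X)) =
      (\<Sum>v\<in>?N X. outflow k q (X\<lparr>origin := v\<rparr>) (origin X))" if X: "wf_rgraph X" for X
    unfolding nn_integral_nbrs[OF X, symmetric]
    by (rule nn_integral_cong, use nbr_flow_pair_at[OF q X] in simp)+
  have mo: "(\<lambda>c. \<Sum>v\<in>?N (rep c). outflow k q (rep c) v) \<in> borel_measurable \<mu>"
    "(\<lambda>c. \<Sum>v\<in>?N (rep c). outflow k q (rep c\<lparr>origin := v\<rparr>) (origin (rep c))) \<in> borel_measurable \<mu>"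
    using measurable_pairs[OF f, of True] measurable_pairs[OF f, of False] measurable_cong_sets[OF \<mu>(1) refl]
    unfolding out[OF wf_rep_rgraph] inn[OF wf_rep_rgraph] by blast+
  have eq: "(\<integral>\<^sup>+c. (\<Sum>v\<in>?N (rep c). outflow k q (rep c\<lparr>origin := v\<rparr>) (origin (rep c))) \<partial>\<mu>) =
      (\<integral>\<^sup>+c. (\<Sum>v\<in>?N (rep c). outflow k q (rep c) v) \<partial>\<mu>)"
    using \<mu>(2)[unfolded unimodular_iff, rule_format, OF f] unfolding out[OF wf_rep_rgraph] inn[OF wf_rep_rgraph] .
  have "(\<integral>\<^sup>+c. (\<integral>\<^sup>+d. of_nat (cut_degree (rep d)) \<partial>cut_law k q (rep c)) \<partial>\<mu>) \<le>
      (\<integral>\<^sup>+c. (\<Sum>v\<in>?N (rep c). outflow k q (rep c) v) +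
        (\<Sum>v\<in>?N (rep c). outflow k q (rep c\<lparr>origin := v\<rparr>) (origin (rep c))) \<partial>\<mu>)"
    unfolding sum.distrib[symmetric]
    by (intro nn_integral_mono expected_cut_degree wf_rep_rgraph) (use q in \<open>simp add: local_rate_def\<close>)
  also have "\<dots> = 2 * (\<integral>\<^sup>+c. (\<Sum>v\<in>?N (rep c). outflow k q (rep c) v) \<partial>\<mu>)"
    by (subst nn_integral_add[OF mo]) (simp add: eq mult_2)
  finally show ?thesis .
qed


section \<open>Stability of hyperfiniteness\<close>

text \<open>For a < 1 the inequality 1 + x \<le> exp x bounds the excess over exp (- t) by t (1 -
  a). This controls the probability of staying uncovered when the total rate at a vertex falls short
  of t.\<close>

lemma exp_perturb:
  fixes a t d :: real
  assumes "0 \<le> a" "0 \<le> t" "0 \<le> d" "1 \<le> a + d"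
  shows "exp (- (t * a)) \<le> exp (- t) + t * d"
proof (cases "1 \<le> a")
  case True
  then have "t \<le> t * a" using assms(2) by (simp add: mult_le_cancel_left1)
  then have "exp (- (t * a)) \<le> exp (- t)" by simp
  then show ?thesis using assms(2,3) by (simp add: add_increasing2)
next
  case False
  have "exp (- t) = exp (- (t * a)) * exp (- (t * (1 - a)))"
    by (simp add: exp_add[symmetric] algebra_simps)
  also have "\<dots> \<ge> exp (- (t * a)) * (1 + - (t * (1 - a)))"
    by (intro mult_left_mono exp_ge_add_one_self) simp
  finally have "exp (- (t * a)) \<le> exp (- t) + exp (- (t * a)) * (t * (1 - a))"
    by (simp add: algebra_simps)
  also have "exp (- (t * a)) * (t * (1 - a)) \<le> 1 * (t * (1 - a))"
    by (rule mult_right_mono) (use assms False in auto)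
  also have "\<dots> \<le> t * d" using assms by (simp add: mult_left_mono)
  finally show ?thesis by simp
qed

lemma bdeg_le_degree:
  assumes "wf_rgraph X"
  shows "card {v. {origin X, v} \<in> edges X \<and> v \<notin> K} \<le> card (nbrs X)"
  by (rule card_mono[OF finite_nbrs[OF assms]]) auto

lemma mark_unmark: "wf_rgraph X \<Longrightarrow> z \<in> verts X \<Longrightarrow> K \<subseteq> verts X \<Longrightarrow>
    unmark (mark X z K) = abs_rgraph (X\<lparr>origin := z, vsets := [], esets := []\<rparr>)"
  unfolding mark_def by (subst unmark_abs[OF wf_mark]) (auto intro: arg_cong[where f=abs_rgraph])

text \<open>A set K at the root is counted once for each neighbour outside K, which turns the
  ringing cost into the boundary degree. The error e enters twice with the factor t M, through rates
  that are too large and, by \<open>exp_perturb\<close>, through a total rate below t; hence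
  \<open>2 * t * real M\<close>.\<close>

lemma flow_bound:
  fixes s e :: "rgraph \<Rightarrow> ennreal"
  assumes X: "wf_rgraph X" and t: "0 < t" and M: "card (nbrs X) \<le> M"
    and q0: "\<And>K. 0 \<le> q (verts X) (edges X) K"
    and up: "\<And>K. K \<in> at_root k X \<Longrightarrow> ennreal (q (verts X) (edges X) K) \<le>
      ennreal t * (s (rmark X K) + e (rmark X K))"
    and lo: "\<And>K. K \<in> at_root k X \<Longrightarrow> ennreal t * s (rmark X K) \<le>
      ennreal (q (verts X) (edges X) K) + ennreal t * e (rmark X K)"
    and s: "rsum k s X = 1"
  shows "(\<Sum>v\<in>nbrs X. outflow k q X v) \<le>
    ennreal t * rsum k (\<lambda>d. of_nat (bdeg (rep d)) * s d) X +
    ennreal (2 * t * real M) * rsum k e X + ennreal (real M * exp (- t))"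
proof -
  let ?N = "nbrs X" and ?T = "at_root k X"
  let ?q = "\<lambda>K. q (verts X) (edges X) K" and ?m = "\<lambda>K. rmark X K"
  have fN: "finite ?N" and fT: "finite ?T" using finite_nbrs[OF X] finite_near[OF X] by blast+
  have "(\<Sum>v\<in>?N. \<Sum>K\<in>{K \<in> ?T. v \<notin> K}. ennreal (?q K)) =
      (\<Sum>v\<in>?N. \<Sum>K\<in>?T. if v \<notin> K then ennreal (?q K) else 0)"
    by (rule sum.cong[OF refl]) (rule sum.inter_filter[OF fT])
  also have "\<dots> = (\<Sum>K\<in>?T. \<Sum>v\<in>?N. if v \<notin> K then ennreal (?q K) else 0)" by (rule sum.swap)
  also have "\<dots> = (\<Sum>K\<in>?T. of_nat (card {v. {origin X, v} \<in> edges X \<and> v \<notin> K}) * ennreal (?q K))"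
  proof (rule sum.cong[OF refl])
    fix K
    have "(\<Sum>v\<in>?N. if v \<notin> K then ennreal (?q K) else 0) = (\<Sum>v\<in>{v \<in> ?N. v \<notin> K}. ennreal (?q K))"
      by (rule sum.inter_filter[OF fN, symmetric])
    then show "(\<Sum>v\<in>?N. if v \<notin> K then ennreal (?q K) else 0) =
        of_nat (card {v. {origin X, v} \<in> edges X \<and> v \<notin> K}) * ennreal (?q K)" by simp
  qed
  also have "\<dots> \<le> (\<Sum>K\<in>?T. ennreal t * (of_nat (bdeg (rep (?m K))) * s (?m K)) +
      ennreal (t * real M) * e (?m K))"
  proof (rule sum_mono)
    fix K assume K: "K \<in> ?T"
    let ?b = "card {v. {origin X, v} \<in> edges X \<and> v \<notin> K}"
    have "?b \<le> M" using bdeg_le_degree[OF X, of K] M by simp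
    have "of_nat ?b * ennreal (?q K) \<le> of_nat ?b * (ennreal t * (s (?m K) + e (?m K)))"
      by (rule mult_left_mono[OF up[OF K]]) simp
    also have "\<dots> = ennreal t * (of_nat ?b * s (?m K)) + ennreal t * of_nat ?b * e (?m K)"
      by (simp add: distrib_left mult_ac)
    also have "ennreal t * of_nat ?b = ennreal (t * real ?b)"
      using t by (simp add: ennreal_of_nat_eq_real_of_nat ennreal_mult)
    also have "ennreal t * (of_nat ?b * s (?m K)) + ennreal (t * real ?b) * e (?m K) \<le>
        ennreal t * (of_nat ?b * s (?m K)) + ennreal (t * real M) * e (?m K)"
      using \<open>?b \<le> M\<close> t by (intro add_left_mono mult_right_mono ennreal_leI) auto
    finally show "of_nat ?b * ennreal (?q K) \<le>
        ennreal t * (of_nat (bdeg (rep (?m K))) * s (?m K)) + ennreal (t * real M) * e (?m K)"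
      unfolding bdeg_mark[OF X K] .
  qed
  also have "\<dots> = ennreal t * rsum k (\<lambda>d. of_nat (bdeg (rep d)) * s d) X + ennreal (t * real M) * rsum k e X"
    unfolding rsum_def sum.distrib sum_distrib_left ..
  finally have 1: "(\<Sum>v\<in>?N. \<Sum>K\<in>{K \<in> ?T. v \<notin> K}. ennreal (?q K)) \<le>
      ennreal t * rsum k (\<lambda>d. of_nat (bdeg (rep d)) * s d) X + ennreal (t * real M) * rsum k e X" .
  let ?Q = "\<Sum>K\<in>?T. ?q K"
  have Q0: "0 \<le> ?Q" using q0 by (rule sum_nonneg)
  have lo': "ennreal t \<le> ennreal ?Q + ennreal t * rsum k e X"
  proof -
    have "ennreal t = (\<Sum>K\<in>?T. ennreal t * s (?m K))"
      using s by (simp add: rsum_def sum_distrib_left[symmetric])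
    also have "\<dots> \<le> (\<Sum>K\<in>?T. ennreal (?q K) + ennreal t * e (?m K))" by (rule sum_mono[OF lo])
    also have "\<dots> = ennreal ?Q + ennreal t * rsum k e X"
      using q0 by (simp add: sum.distrib rsum_def sum_distrib_left sum_ennreal)
    finally show ?thesis .
  qed
  have 2: "ennreal (exp (- ?Q)) \<le> ennreal (exp (- t)) + ennreal t * rsum k e X"
  proof (cases "rsum k e X")
    case (real d)
    have "ennreal t * rsum k e X = ennreal (t * d)" using real t by (simp add: ennreal_mult)
    then have "ennreal t \<le> ennreal (?Q + t * d)" using lo' Q0 real t by simp
    moreover have "0 \<le> ?Q + t * d" using Q0 real t by simp
    ultimately have "t \<le> ?Q + t * d" by (simp only: ennreal_le_iff)
    then have "1 \<le> ?Q / t + d" using t by (simp add: field_simps)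
    from exp_perturb[OF _ _ _ this, of t]
    have "exp (- ?Q) \<le> exp (- t) + t * d" using t Q0 real by simp
    then have "ennreal (exp (- ?Q)) \<le> ennreal (exp (- t) + t * d)" by (rule ennreal_leI)
    then show ?thesis using real t by (simp add: ennreal_mult)
  next
    case top
    then show ?thesis using t by (simp add: ennreal_mult_top)
  qed
  have "(\<Sum>v\<in>?N. outflow k q X v) =
      (\<Sum>v\<in>?N. \<Sum>K\<in>{K \<in> ?T. v \<notin> K}. ennreal (?q K)) + of_nat (card ?N) * ennreal (exp (- ?Q))"
    unfolding outflow_def by (simp add: sum.distrib)
  also have "\<dots> \<le> (ennreal t * rsum k (\<lambda>d. of_nat (bdeg (rep d)) * s d) X + ennreal (t * real M) * rsum k e X) +
      of_nat M * (ennreal (exp (- t)) + ennreal t * rsum k e X)"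
    using M by (intro add_mono 1 mult_mono 2) auto
  also have "\<dots> = ennreal t * rsum k (\<lambda>d. of_nat (bdeg (rep d)) * s d) X +
      (ennreal (t * real M) + ennreal (t * real M)) * rsum k e X + ennreal (real M * exp (- t))"
    using t by (simp add: ennreal_of_nat_eq_real_of_nat ennreal_mult distrib_left distrib_right mult_ac add_ac)
  also have "ennreal (t * real M) + ennreal (t * real M) = ennreal (2 * t * real M)"
    using t by (simp add: ennreal_plus[symmetric] del: ennreal_plus)
  finally show ?thesis .
qed

lemma degree_nbrs: "wf_rgraph X \<Longrightarrow> v \<in> verts X \<Longrightarrow> card {e \<in> edges X. v \<in> e} = card {w. {v, w} \<in> edges X}"
  using incident_nbrs[OF wf_reroot, of X v "edges X"] by simp

lemma rooted_degree:
  assumes "c \<in> rooted_graphs_deg M"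
  shows "card (nbrs (rep c)) \<le> M"
proof -
  have "origin (rep c) \<in> verts (rep c)" using wf_rep_rgraph[of c] by (simp add: wf_rgraph_def)
  then show ?thesis using assms degree_nbrs[OF wf_rep_rgraph] by (auto simp: rooted_graphs_deg_def)
qed

text \<open>The three summands are the boundary of the component, at most 2 \<epsilon> in
  expectation by hyperfiniteness, the local approximation, and the uncovered vertices. The outer
  factor 2 comes from \<open>expected_flow\<close>.\<close>

lemma hyperfinite_imp_cutting:
  fixes M k :: nat and \<epsilon> t \<delta> :: real
  assumes k: "0 < k" and t: "0 < t" and \<delta>: "0 < \<delta>" and \<epsilon>: "0 < \<epsilon>"
    and \<mu>: "\<mu> \<in> unimodular_measures_deg M" and hyp: "hyperfinite k \<epsilon> \<mu>"
  obtains q where "local_rate k q"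
    "(\<integral>\<^sup>+c. (\<integral>\<^sup>+d. of_nat (cut_degree (rep d)) \<partial>cut_law k q (rep c)) \<partial>\<mu>) \<le>
      ennreal (2 * (t * (2 * \<epsilon>) + 2 * t * real M * \<delta> + real M * exp (- t)))"
proof -
  have \<mu>': "prob_space \<mu>" "sets \<mu> = sets borel" "unimodular \<mu>" "AE c in \<mu>. c \<in> rooted_graphs_deg M"
    using \<mu> by (auto simp: unimodular_measures_deg_def unimodular_measures_def prob_measures_on_def)
  interpret \<mu>: prob_space \<mu> by (rule \<mu>'(1))
  obtain \<nu> where \<nu>: "prob_space \<nu>" "sets \<nu> = sets borel" "unimodular \<nu>" "distr \<nu> borel forget_marks = \<mu>"
    and \<nu>m: "AE c in \<nu>. c \<in> edge_marked_graphs"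
    and \<nu>c: "AE c in \<nu>. \<forall>C \<in> components (verts (rep c)) (edges (rep c) - marked_edges c).
           finite C \<and> card C \<le> k"
    and \<nu>d: "(\<integral>\<^sup>+c. ennreal (real (card {e \<in> marked_edges c. origin (rep c) \<in> e})) \<partial>\<nu>) \<le> ennreal (2 * \<epsilon>)"
    using hyp by (auto simp: hyperfinite_def prob_measures_on_def)
  have root_comp: "AE c in \<nu>. c \<in> edge_marked_graphs \<and> root_comp (rep c) \<in> at_root k (rep c)"
    using \<nu>m \<nu>c
  proof eventually_elim
    case (elim c)
    let ?X = "rep c"
    have ne: "esets ?X \<noteq> []" using elim(1) by (auto simp: edge_marked_graphs_def)
    have "comps_le k ?X" unfolding comps_le_components[OF ne] using elim(2) by (simp add: marked_edges_def)
    moreover have "origin ?X \<in> verts ?X" using wf_rep_rgraph[of c] by (simp add: wf_rgraph_def)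
    ultimately have "finite (root_comp (?X\<lparr>origin := origin ?X\<rparr>)) \<and> card (root_comp (?X\<lparr>origin := origin ?X\<rparr>)) \<le> k"
      unfolding comps_le_def by blast
    then show ?case using elim(1) comp_small[OF wf_rep_rgraph] by simp
  qed
  obtain q0 R s e where q0: "\<And>c d. ball_iso c d R \<Longrightarrow> q0 c = q0 d" "\<And>d. (0 :: real) \<le> q0 d"
    and sb: "s \<in> borel_measurable borel" and eb: "e \<in> borel_measurable borel"
    and up: "\<And>X K. wf_rgraph X \<Longrightarrow> K \<in> at_root k X \<Longrightarrow>
      avg k (\<lambda>d. ennreal (q0 d)) (rmark X K) \<le> s (rmark X K) + e (rmark X K)"
    and lo: "\<And>X K. wf_rgraph X \<Longrightarrow> K \<in> at_root k X \<Longrightarrow>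
      s (rmark X K) \<le> avg k (\<lambda>d. ennreal (q0 d)) (rmark X K) + e (rmark X K)"
    and e_int: "(\<integral>\<^sup>+c. rsum k e (rep c) \<partial>\<mu>) \<le> ennreal \<delta>"
    and frac: "\<And>h. h \<in> borel_measurable borel \<Longrightarrow>
      (\<integral>\<^sup>+c. csum k h (rep c) \<partial>\<nu>) = (\<integral>\<^sup>+c. rsum k (\<lambda>d. h d * s d) (rep c) \<partial>\<mu>)"
    by (rule fractional_partition[OF k \<mu>'(1-3) \<nu> \<delta>]) (rule that)
  have q0b: "(\<lambda>d. ennreal (q0 d)) \<in> borel_measurable borel"
    by (rule measurable_local[of R]) (use q0(1) in auto)
  have rs_meas: "(\<lambda>c. rsum k h (rep c)) \<in> borel_measurable \<mu>"
    if "h \<in> borel_measurable borel" for h :: "rgraph \<Rightarrow> ennreal"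
    using measurable_rsum[OF that] measurable_cong_sets[OF \<mu>'(2) refl] by blast

  \<comment> \<open>Tested with a function of (G, o) alone, the \<nu> side sees the single component
    and gives the integral of that function. So the total weight at the root and the constant 1 are
    densities of the same measure.\<close>
  have one: "AE c in \<mu>. rsum k s (rep c) = 1"
  proof (rule \<mu>.density_unique[OF rs_meas[OF sb]])
    show "density \<mu> (\<lambda>c. rsum k s (rep c)) = density \<mu> (\<lambda>_. 1)"
    proof (rule measure_eqI)
      fix A assume "A \<in> sets (density \<mu> (\<lambda>c. rsum k s (rep c)))"
      then have A: "A \<in> sets borel" "A \<in> sets \<mu>" using \<mu>'(2) by auto
      have h: "(\<lambda>d. indicator A (unmark d) :: ennreal) \<in> borel_measurable borel" using A(1) by measurable
      have un: "unmark (rmark (rep c) K) =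
          abs_rgraph (rep c\<lparr>vsets := [], esets := []\<rparr>)" if "K \<in> at_root k (rep c)" for c K
        using mark_unmark[OF wf_rep_rgraph _ small_verts[OF near_smallD[OF that]], of "origin (rep c)"]
          wf_rep_rgraph[of c] by (simp add: wf_rgraph_def)
      have "emeasure (density \<mu> (\<lambda>c. rsum k s (rep c))) A =
          (\<integral>\<^sup>+c. rsum k s (rep c) * indicator A c \<partial>\<mu>)"
        by (rule emeasure_density[OF rs_meas[OF sb] A(2)])
      also have "\<dots> = (\<integral>\<^sup>+c. rsum k (\<lambda>d. indicator A (unmark d) * s d) (rep c) \<partial>\<mu>)"
      proof (rule nn_integral_cong_AE, use \<mu>'(4) in \<open>rule eventually_mono\<close>)
        fix c assume "c \<in> rooted_graphs_deg M"
        then have "rep c\<lparr>vsets := [], esets := []\<rparr> = rep c"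
          by (simp add: rooted_graphs_deg_def rooted_graphs_def)
        then show "rsum k s (rep c) * indicator A c =
            rsum k (\<lambda>d. indicator A (unmark d) * s d) (rep c)"
          unfolding rsum_def sum_distrib_right
          by (intro sum.cong refl) (simp add: un abs_rep_rgraph mult.commute)
      qed
      also have "\<dots> = (\<integral>\<^sup>+c. csum k (\<lambda>d. indicator A (unmark d)) (rep c) \<partial>\<nu>)"
        by (rule frac[OF h, symmetric])
      also have "\<dots> = (\<integral>\<^sup>+c. indicator A (forget_marks c) \<partial>\<nu>)"
      proof (rule nn_integral_cong_AE, use root_comp in \<open>rule eventually_mono\<close>)
        fix c assume c: "c \<in> edge_marked_graphs \<and> root_comp (rep c) \<in> at_root k (rep c)"
        then have "rep c\<lparr>vsets := [], esets := []\<rparr> = rep c\<lparr>esets := []\<rparr>"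
          by (simp add: edge_marked_graphs_def)
        then show "csum k (\<lambda>d. indicator A (unmark d)) (rep c) = indicator A (forget_marks c)"
          using csum_comp[OF _ wf_rep_rgraph, of c k] un c by (simp add: forget_marks_def)
      qed
      also have "\<dots> = (\<integral>\<^sup>+c. indicator A c \<partial>distr \<nu> borel forget_marks)"
      proof (rule nn_integral_distr[symmetric])
        show "forget_marks \<in> measurable \<nu> borel"
          using measurable_forget_marks measurable_cong_sets[OF \<nu>(2) refl] by blast
      qed (use A(1) in simp)
      also have "\<dots> = emeasure (density \<mu> (\<lambda>_. 1)) A" unfolding \<nu>(4) using A(2) by (simp add: density_1)
      finally show "emeasure (density \<mu> (\<lambda>c. rsum k s (rep c))) A = emeasure (density \<mu> (\<lambda>_. 1)) A" .
    qed simp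
  qed simp

  let ?b = "\<lambda>d. of_nat (bdeg (rep d)) :: ennreal"
  have bb: "?b \<in> borel_measurable borel"
    by (rule measurable_local_fun[OF local_fun_comp[OF local_fun_bdeg, where h=of_nat]]) simp
  have bs: "(\<integral>\<^sup>+c. rsum k (\<lambda>d. ?b d * s d) (rep c) \<partial>\<mu>) \<le> ennreal (2 * \<epsilon>)"
  proof -
    have "(\<integral>\<^sup>+c. rsum k (\<lambda>d. ?b d * s d) (rep c) \<partial>\<mu>) = (\<integral>\<^sup>+c. csum k ?b (rep c) \<partial>\<nu>)"
      by (rule frac[OF bb, symmetric])
    also have "\<dots> \<le> (\<integral>\<^sup>+c. ennreal (real (card {e \<in> marked_edges c. origin (rep c) \<in> e})) \<partial>\<nu>)"
    proof (rule nn_integral_mono_AE, use root_comp in \<open>rule eventually_mono\<close>)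
      fix c assume c: "c \<in> edge_marked_graphs \<and> root_comp (rep c) \<in> at_root k (rep c)"
      let ?X = "rep c"
      note X = wf_rep_rgraph[of c]
      have mk: "marked_edges c = cutset ?X"
        using c by (auto simp: marked_edges_def cutset_def edge_marked_graphs_def)
      \<comment> \<open>A surviving edge at the root stays in the component, so an edge leaving it
        belongs to S.\<close>
      have "{v. {origin ?X, v} \<in> edges ?X \<and> v \<notin> root_comp ?X} \<subseteq> {v. {origin ?X, v} \<in> cutset ?X}"
        by (auto simp: root_comp_def adj_def)
      moreover have "finite {v. {origin ?X, v} \<in> cutset ?X}"
        by (rule finite_subset[OF _ finite_nbrs[OF X]]) (use cutset_sub[OF X] in auto)
      ultimately have "card {v. {origin ?X, v} \<in> edges ?X \<and> v \<notin> root_comp ?X} \<le> card {v. {origin ?X, v} \<in> cutset ?X}"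
        by (intro card_mono)
      also have "\<dots> = card {e \<in> marked_edges c. origin ?X \<in> e}"
        unfolding mk by (rule incident_nbrs[OF X cutset_sub[OF X], symmetric])
      finally show "csum k ?b ?X \<le> ennreal (real (card {e \<in> marked_edges c. origin ?X \<in> e}))"
        using csum_comp[OF _ X, of k ?b] c bdeg_mark[OF X, of "root_comp ?X" k]
        by (simp add: ennreal_of_nat_eq_real_of_nat ennreal_leI)
    qed
    also note \<nu>d
    finally show ?thesis .
  qed

  \<comment> \<open>The mean runs over all vertices of K, so q is root-free; the marked graph is
    rebuilt from V and E because no root is at hand.\<close>
  define q where "q V E K = t / real (card K) *
    (\<Sum>z\<in>K. q0 (abs_rgraph \<lparr>verts = V, edges = E, origin = z, vsets = [K], esets = []\<rparr>))" for V E K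
  have q_eq: "q (verts X) (edges X) K = t / real (card K) * (\<Sum>z\<in>K. q0 (mark X z K))" for X K
    unfolding q_def mark_def by (cases X) simp
  have q_nonneg: "0 \<le> q V E K" for V E K
    unfolding q_def using t q0(2) by (intro mult_nonneg_nonneg sum_nonneg) auto
  have q: "local_rate k q"
    unfolding local_rate_def
  proof (intro conjI allI impI q_nonneg exI[of _ "2 * (k * k) + 1 + R"])
    fix X Y f K
    let ?R = "2 * (k * k) + 1 + R"
    assume *: "wf_rgraph X" "wf_rgraph Y" "ball_via f X Y ?R" "K \<in> at_root k X"
    have le: "2 * (k * k) + 1 \<le> ?R" by simp
    have "(\<Sum>z\<in>f ` K. q0 (mark Y z (f ` K))) = (\<Sum>z\<in>K. q0 (mark X z K))"
      unfolding sum.reindex[OF K_inj[OF *(1-3) le *(4)]] o_def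
      by (intro sum.cong refl q0(1)[symmetric] K_mark[OF *(1-3) le *(4) order_refl])
    then show "q (verts Y) (edges Y) (f ` K) = q (verts X) (edges X) K"
      unfolding q_eq K_card[OF *(1-3) le *(4)] by simp
  qed
  have q_avg: "ennreal (q (verts X) (edges X) K) = ennreal t * avg k (\<lambda>d. ennreal (q0 d)) (rmark X K)"
    if X: "wf_rgraph X" and K: "K \<in> at_root k X" for X K
  proof -
    have K': "K \<in> small k X" "origin X \<in> K" using K by (auto simp: at_root_iff)
    have "ennreal (q (verts X) (edges X) K) = ennreal (t * (1 / real (card K) * (\<Sum>z\<in>K. q0 (mark X z K))))"
      unfolding q_eq by simp
    also have "\<dots> = ennreal t * (ennreal (1 / real (card K)) * ennreal (\<Sum>z\<in>K. q0 (mark X z K)))"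
    proof -
      have "0 \<le> (\<Sum>z\<in>K. q0 (mark X z K))" using q0(2) by (intro sum_nonneg)
      then show ?thesis using t by (simp only: ennreal_mult divide_nonneg_nonneg mult_nonneg_nonneg
            of_nat_0_le_iff zero_le_one less_imp_le)
    qed
    also have "ennreal (\<Sum>z\<in>K. q0 (mark X z K)) = (\<Sum>z\<in>K. ennreal (q0 (mark X z K)))"
      using q0(2) by (simp add: sum_ennreal)
    finally show ?thesis unfolding avg_mark[OF X K' q0b] .
  qed
  show ?thesis
  proof (rule that[OF q])
    let ?F = "\<lambda>c. \<Sum>v\<in>nbrs (rep c). outflow k q (rep c) v"
    have "AE c in \<mu>. ?F c \<le> ennreal t * rsum k (\<lambda>d. ?b d * s d) (rep c) +
        ennreal (2 * t * real M) * rsum k e (rep c) + ennreal (real M * exp (- t))"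
      using \<mu>'(4) one
    proof eventually_elim
      case (elim c)
      show ?case
      proof (rule flow_bound[OF wf_rep_rgraph t rooted_degree[OF elim(1)] q_nonneg _ _ elim(2)])
        fix K assume K: "K \<in> at_root k (rep c)"
        let ?m = "rmark (rep c) K"
        show "ennreal (q (verts (rep c)) (edges (rep c)) K) \<le> ennreal t * (s ?m + e ?m)"
          unfolding q_avg[OF wf_rep_rgraph K] by (rule mult_left_mono[OF up[OF wf_rep_rgraph K]]) simp
        show "ennreal t * s ?m \<le> ennreal (q (verts (rep c)) (edges (rep c)) K) + ennreal t * e ?m"
          unfolding q_avg[OF wf_rep_rgraph K] distrib_left[symmetric]
          by (rule mult_left_mono[OF lo[OF wf_rep_rgraph K]]) simp
      qed
    qed
    then have "(\<integral>\<^sup>+c. ?F c \<partial>\<mu>) \<le> (\<integral>\<^sup>+c. ennreal t * rsum k (\<lambda>d. ?b d * s d) (rep c) +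
        ennreal (2 * t * real M) * rsum k e (rep c) + ennreal (real M * exp (- t)) \<partial>\<mu>)"
      by (rule nn_integral_mono_AE)
    also have "\<dots> = ennreal t * (\<integral>\<^sup>+c. rsum k (\<lambda>d. ?b d * s d) (rep c) \<partial>\<mu>) +
        ennreal (2 * t * real M) * (\<integral>\<^sup>+c. rsum k e (rep c) \<partial>\<mu>) + ennreal (real M * exp (- t))"
    proof -
      have m1: "(\<lambda>c. rsum k (\<lambda>d. ?b d * s d) (rep c)) \<in> borel_measurable \<mu>"
        by (rule rs_meas) (use bb sb in measurable)
      note m2 = rs_meas[OF eb]
      show ?thesis
        using m1 m2 by (simp add: nn_integral_add nn_integral_cmult \<mu>.emeasure_space_1)
    qed
    also have "\<dots> \<le> ennreal t * ennreal (2 * \<epsilon>) + ennreal (2 * t * real M) * ennreal \<delta> + ennreal (real M * exp (- t))"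
      by (intro add_mono mult_left_mono bs e_int) auto
    also have "\<dots> = ennreal (t * (2 * \<epsilon>) + 2 * t * real M * \<delta> + real M * exp (- t))"
      using t \<epsilon> \<delta> by (simp add: ennreal_mult[symmetric] ennreal_plus[symmetric] del: ennreal_plus)
    finally have "2 * (\<integral>\<^sup>+c. ?F c \<partial>\<mu>) \<le> 2 * ennreal (t * (2 * \<epsilon>) + 2 * t * real M * \<delta> + real M * exp (- t))"
      by (rule mult_left_mono) simp
    also have "\<dots> = ennreal (2 * (t * (2 * \<epsilon>) + 2 * t * real M * \<delta> + real M * exp (- t)))"
      using t \<epsilon> \<delta> by (subst ennreal_mult) auto
    finally show "(\<integral>\<^sup>+c. (\<integral>\<^sup>+d. of_nat (cut_degree (rep d)) \<partial>cut_law k q (rep c)) \<partial>\<mu>) \<le>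
        ennreal (2 * (t * (2 * \<epsilon>) + 2 * t * real M * \<delta> + real M * exp (- t)))"
      using expected_flow[OF q \<mu>'(2,3)] by (rule order_trans[rotated])
  qed
qed

text \<open>Local rates are defined on every graph, whichever measure they were built from. The
  component bound is built into the cutting, so the expected number of cut edges is the quantity
  left to control.\<close>

lemma cutting_imp_hyperfinite:
  assumes k: "0 < k" and q: "local_rate k q" and \<mu>: "\<mu> \<in> unimodular_measures"
    and bound: "(\<integral>\<^sup>+c. (\<integral>\<^sup>+d. of_nat (cut_degree (rep d)) \<partial>cut_law k q (rep c)) \<partial>\<mu>) \<le> ennreal (2 * \<eta>)"
  shows "hyperfinite k \<eta> \<mu>"
proof -
  have \<mu>': "prob_space \<mu>" "sets \<mu> = sets borel" "unimodular \<mu>" "AE c in \<mu>. c \<in> rooted_graphs"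
    using \<mu> by (auto simp: unimodular_measures_def prob_measures_on_def)
  let ?\<nu> = "cut_measure k q \<mu>"
  let ?Z = "\<lambda>c \<omega>. cut_graph (small k (rep c)) (rep c) \<omega>"
  have marked: "AE d in ?\<nu>. d \<in> edge_marked_graphs"
  proof (rule AE_cut_measure[OF q \<mu>'(1,2)])
    show "{d. d \<in> edge_marked_graphs} \<in> sets borel" using sets_edge_marked by simp
    show "AE c in \<mu>. \<forall>\<omega>. abs_rgraph (?Z c \<omega>) \<in> edge_marked_graphs"
      using \<mu>'(4)
    proof (rule eventually_mono)
      fix c assume "c \<in> rooted_graphs"
      then show "\<forall>\<omega>. abs_rgraph (?Z c \<omega>) \<in> edge_marked_graphs"
        unfolding edge_marked_abs[OF wf_cut_graph[OF wf_rep_rgraph]]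
        by (simp add: cut_graph_def rooted_graphs_def)
    qed
  qed
  have comps: "AE d in ?\<nu>. comps_le k (rep d)"
  proof (rule AE_cut_measure[OF q \<mu>'(1,2) sets_comps_le])
    have "comps_le k (?Z c \<omega>)" for c \<omega>
      using cut_graph_components[OF k, of _ "rep c" \<omega>]
      by (auto simp: comps_le_def root_comp_def cutset_def cut_graph_def)
    then show "AE c in \<mu>. \<forall>\<omega>. comps_le k (rep (abs_rgraph (?Z c \<omega>)))"
      by (simp add: comps_le_rep_abs wf_cut_graph wf_rep_rgraph)
  qed
  have "AE d in ?\<nu>. \<forall>C \<in> components (verts (rep d)) (edges (rep d) - marked_edges d).
      finite C \<and> card C \<le> k"
    using marked comps
  proof eventually_elim
    case (elim d)
    have "esets (rep d) \<noteq> []" using elim(1) by (auto simp: edge_marked_graphs_def)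
    from comps_le_components[OF this, of k] show ?case using elim(2) by (simp add: marked_edges_def)
  qed
  moreover have "(\<integral>\<^sup>+d. ennreal (real (card {e \<in> marked_edges d. origin (rep d) \<in> e})) \<partial>?\<nu>) \<le> ennreal (2 * \<eta>)"
  proof -
    have "(\<integral>\<^sup>+d. ennreal (real (card {e \<in> marked_edges d. origin (rep d) \<in> e})) \<partial>?\<nu>) =
        (\<integral>\<^sup>+d. of_nat (cut_degree (rep d)) \<partial>?\<nu>)"
    proof (rule nn_integral_cong_AE, use marked in \<open>rule eventually_mono\<close>)
      fix d assume "d \<in> edge_marked_graphs"
      then have "marked_edges d = cutset (rep d)"
        by (auto simp: marked_edges_def cutset_def edge_marked_graphs_def)
      then show "ennreal (real (card {e \<in> marked_edges d. origin (rep d) \<in> e})) =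
          of_nat (cut_degree (rep d))"
        by (simp add: cut_degree_def ennreal_of_nat_eq_real_of_nat)
    qed
    also have "\<dots> = (\<integral>\<^sup>+c. (\<integral>\<^sup>+d. of_nat (cut_degree (rep d)) \<partial>cut_law k q (rep c)) \<partial>\<mu>)"
      unfolding nn_integral_cut_measure[OF q \<mu>'(1,2) measurable_cut_degree]
        nn_integral_cut_law[OF wf_rep_rgraph measurable_cut_degree] ..
    finally show ?thesis using bound by simp
  qed
  ultimately show ?thesis
    unfolding hyperfinite_def prob_measures_on_def
    using \<mu> marked prob_space_cut_measure[OF q \<mu>'(1,2)] sets_cut_measure[OF q \<mu>'(1,2)]
      unimodular_cut_measure[OF q \<mu>'(1-3)] distr_cut_measure[OF q \<mu>'(1,2,4)]
    by (intro conjI bexI[of _ ?\<nu>]) auto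
qed

text \<open>The degree bound is a countable intersection of conditions on balls. Its measurability
  makes the set integrals in the weak topology computable as Lebesgue integrals.\<close>

lemma sets_rooted_graphs_deg: "rooted_graphs_deg M \<in> sets borel"
proof -
  have loc: "local_fun (\<lambda>X. \<forall>v\<in>vball X r. card {w. {v, w} \<in> edges X} \<le> M)" for r
    unfolding local_fun_def
  proof (intro exI[of _ "r + 1"] allI impI)
    fix X Y f
    assume X: "wf_rgraph X" and Y: "wf_rgraph Y" and iso: "ball_via f X Y (r + 1)"
    have "card {w. {f v, w} \<in> edges Y} = card {w. {v, w} \<in> edges X}"
      if v: "v \<in> vball X r" for v
    proof -
      have "v \<in> verts X" using v ball_verts_wf[OF X] by blast
      then have X': "wf_rgraph (X\<lparr>origin := v\<rparr>)" by (rule wf_reroot[OF X])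
      have "f v \<in> verts Y" using v image_ball[OF X Y iso, of r] ball_verts_wf[OF Y, of r] by auto
      then have Y': "wf_rgraph (Y\<lparr>origin := f v\<rparr>)" by (rule wf_reroot[OF Y])
      show ?thesis
        using bij_betw_same_card[OF nbr_transport[OF X' Y' rball_reroot[OF X Y iso v order_refl] order_refl]] by simp
    qed
    moreover have "vball Y r = f ` vball X r"
      using image_ball[OF X Y iso, of r] by simp
    ultimately show "(\<forall>v\<in>vball X r. card {w. {v, w} \<in> edges X} \<le> M) =
        (\<forall>v\<in>vball Y r. card {w. {v, w} \<in> edges Y} \<le> M)" by simp
  qed
  have "(\<lambda>c. \<forall>v\<in>vball (rep c) r.
      card {w. {v, w} \<in> edges (rep c)} \<le> M) \<in> measurable borel (count_space UNIV)" for r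
    using measurable_local_fun[OF loc, where N="count_space UNIV"] by simp
  then have 1: "(\<lambda>c. \<forall>r. \<forall>v\<in>vball (rep c) r.
      card {w. {v, w} \<in> edges (rep c)} \<le> M) \<in> measurable borel (count_space UNIV)"
    by (rule pred_intros_countable(1))
  have 2: "(\<lambda>c. vsets (rep c) = [] \<and> esets (rep c) = []) \<in> measurable borel (count_space UNIV)"
    using measurable_local_fun[OF local_fun_comp[OF local_fun_lengths, of "\<lambda>(a, b). a = 0 \<and> b = 0"],
        where N="count_space UNIV"] by simp
  have "rooted_graphs_deg M = {c. (vsets (rep c) = [] \<and> esets (rep c) = []) \<and>
      (\<forall>r. \<forall>v\<in>vball (rep c) r.
        card {w. {v, w} \<in> edges (rep c)} \<le> M)}"
  proof -
    have "(\<forall>v\<in>verts (rep c). card {e \<in> edges (rep c). v \<in> e} \<le> M) \<longleftrightarrow>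
        (\<forall>r. \<forall>v\<in>vball (rep c) r.
          card {w. {v, w} \<in> edges (rep c)} \<le> M)" for c
    proof -
      have "verts (rep c) = (\<Union>r. vball (rep c) r)"
      proof (intro equalityI subsetI)
        fix v assume "v \<in> verts (rep c)"
        from verts_in_ball[OF wf_rep_rgraph this]
        show "v \<in> (\<Union>r. vball (rep c) r)" by simp
      next
        fix v assume "v \<in> (\<Union>r. vball (rep c) r)"
        then obtain r where "v \<in> vball (rep c) r" by (elim UN_E)
        then show "v \<in> verts (rep c)" using ball_verts_wf[OF wf_rep_rgraph] by (rule subsetD[rotated])
      qed
      moreover have "(\<forall>v\<in>verts (rep c). card {e \<in> edges (rep c). v \<in> e} \<le> M) \<longleftrightarrow>
          (\<forall>v\<in>verts (rep c). card {w. {v, w} \<in> edges (rep c)} \<le> M)"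
        by (rule ball_cong[OF refl]) (simp add: degree_nbrs[OF wf_rep_rgraph])
      ultimately show ?thesis by simp
    qed
    then show ?thesis by (simp add: rooted_graphs_deg_def rooted_graphs_def)
  qed
  then show ?thesis using pred_intros_logic(3)[OF 2 1] by (simp add: pred_def)
qed

theorem theorem1p2:
  fixes M k :: nat and \<epsilon> :: real and \<mu> :: "rgraph measure"
  assumes "0 < M" and "0 < \<epsilon>" and "\<epsilon> < 1" and "0 < k"
    and "\<mu> \<in> unimodular_measures_deg M"
    and "hyperfinite k \<epsilon> \<mu>"
  shows "\<exists>W. openin (weak_topology (rooted_graphs_deg M)) W \<and> \<mu> \<in> W \<and>
    (\<forall>\<mu>' \<in> W \<inter> unimodular_measures_deg M.
       hyperfinite k (3 * ln (2 * real M / \<epsilon>) * \<epsilon>) \<mu>')"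
proof -
  let ?A = "rooted_graphs_deg M"
  define t where "t = ln (2 * real M / \<epsilon>)"
  have M1: "1 \<le> real M" using assms(1) by simp
  have "2 \<le> 2 * real M / \<epsilon>" using assms M1 by (simp add: field_simps)
  then have "ln 2 \<le> t" unfolding t_def by (subst ln_le_cancel_iff) auto
  then have t: "1 / 2 < t" using ln2_ge_two_thirds by simp
  have exp_t: "real M * exp (- t) = \<epsilon> / 2"
    using assms M1 by (simp add: t_def exp_minus inverse_eq_divide)
  \<comment> \<open>The local approximation is allowed exactly half of the margin (2 t - 1)
    \<epsilon>; the other half keeps the bound strict, as an open neighbourhood requires.\<close>
  define \<delta> where "\<delta> = (2 * t - 1) * \<epsilon> / (8 * t * real M)"
  have \<delta>: "0 < \<delta>" unfolding \<delta>_def using t assms M1 by simp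
  have \<delta>': "4 * t * real M * \<delta> = (2 * t - 1) * \<epsilon> / 2" unfolding \<delta>_def using t M1 by (simp add: field_simps)
  have t0: "0 < t" using t by simp
  obtain q where q: "local_rate k q" and
    b: "(\<integral>\<^sup>+c. (\<integral>\<^sup>+d. of_nat (cut_degree (rep d)) \<partial>cut_law k q (rep c)) \<partial>\<mu>) \<le>
      ennreal (2 * (t * (2 * \<epsilon>) + 2 * t * real M * \<delta> + real M * exp (- t)))"
    using hyperfinite_imp_cutting[OF assms(4) t0 \<delta> assms(2,5,6)] by metis
  have "2 * (t * (2 * \<epsilon>) + 2 * t * real M * \<delta> + real M * exp (- t)) = 4 * t * \<epsilon> + 4 * t * real M * \<delta> + \<epsilon>"
    using exp_t by (simp add: algebra_simps)
  also have "\<dots> = 5 * (t * \<epsilon>) + \<epsilon> / 2" unfolding \<delta>' by (simp add: field_simps)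
  also have "\<dots> < 6 * (t * \<epsilon>)" using mult_strict_right_mono[OF t assms(2)] by (simp add: algebra_simps)
  finally have lt: "2 * (t * (2 * \<epsilon>) + 2 * t * real M * \<delta> + real M * exp (- t)) < 6 * (t * \<epsilon>)" .

  define D where "D c = (\<integral>\<^sup>+d. of_nat (cut_degree (rep d)) \<partial>cut_law k q (rep c))" for c
  obtain R1 where R1: "\<And>c d. ball_iso c d R1 \<Longrightarrow> cut_degree (rep c) = cut_degree (rep d)"
    using local_fun_ball_iso[OF local_fun_cut_degree] by blast
  obtain R2 where R2: "\<And>c d C. ball_iso c d R2 \<Longrightarrow> cylinder R1 C \<Longrightarrow>
      emeasure (cut_law k q (rep c)) C = emeasure (cut_law k q (rep d)) C"
    using local_kernel_ball_iso[OF local_kernel_cut_law[OF q]] by blast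
  \<comment> \<open>\<open>cut_degree\<close> reads the cut graph up to radius R1, and the law of
    the cut graph up to R1 is determined by the input up to R2. This is the continuity of
    \<open>D\<close>.\<close>
  have D_local: "D c = D d" if "ball_iso c d R2" for c d
    unfolding D_def
    by (rule nn_integral_local_kernel_cong[OF prob_space.finite_measure prob_space.finite_measure _ _ R2[OF that] R1])
      (simp_all add: prob_space_cut_law wf_rep_rgraph)
  have D_le: "D c \<le> of_nat M" if c: "c \<in> ?A" for c
  proof -
    let ?X = "rep c"
    note X = wf_rep_rgraph[of c]
    have "cut_degree (cut_graph (small k ?X) ?X \<omega>) \<le> M" for \<omega>
    proof -
      have "cut_degree (cut_graph (small k ?X) ?X \<omega>) \<le> card (nbrs ?X)"
        unfolding cut_degree_nbrs[OF wf_cut_graph[OF X]]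
        by (rule card_mono) (use finite_nbrs[OF X] in \<open>auto simp: cut_graph_def\<close>)
      then show ?thesis using rooted_degree[OF c] by simp
    qed
    then have "D c \<le> (\<integral>\<^sup>+\<omega>. of_nat M \<partial>ring_law k q ?X)"
      unfolding D_def nn_integral_cut_law[OF X measurable_cut_degree] cut_degree_abs[OF wf_cut_graph[OF X]]
      by (intro nn_integral_mono) simp
    then show ?thesis using prob_space.emeasure_space_1[OF prob_space_ring] by simp
  qed
  have D_meas: "D \<in> borel_measurable borel" by (rule measurable_local[OF D_local]) auto
  define f where "f c = enn2real (D c)" for c
  have f_meas: "f \<in> borel_measurable borel" unfolding f_def using D_meas by measurable
  have f_cont: "continuous_on ?A f" by (rule continuous_on_local[of R2]) (simp add: f_def D_local)
  have D_f: "D c = ennreal (f c)" if "c \<in> ?A" for c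
  proof -
    have "D c < \<top>" using D_le[OF that] of_nat_less_top by (rule order_le_less_trans)
    then show ?thesis by (simp add: f_def)
  qed
  have "norm (f c) \<le> real M" if "c \<in> ?A" for c
  proof -
    have "ennreal (f c) \<le> ennreal (real M)"
      using D_le[OF that] unfolding D_f[OF that] by (simp add: ennreal_of_nat_eq_real_of_nat)
    then have "f c \<le> real M" by (simp add: ennreal_le_iff)
    moreover have "0 \<le> f c" by (simp add: f_def)
    ultimately show ?thesis by simp
  qed
  then have f_bdd: "bounded (f ` ?A)" by (intro boundedI) auto
  \<comment> \<open>A subbasic open set: one bounded continuous test function and an open
    half-line.\<close>
  define W where "W = {\<mu>' \<in> prob_measures_on ?A. (LINT c:?A|\<mu>'. f c) \<in> {..< 6 * (t * \<epsilon>)}}"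
  have LINT: "ennreal (LINT c:?A|\<mu>'. f c) = (\<integral>\<^sup>+c. D c \<partial>\<mu>')" if \<mu>': "\<mu>' \<in> prob_measures_on ?A" for \<mu>'
  proof -
    have p: "prob_space \<mu>'" "sets \<mu>' = sets borel" "AE c in \<mu>'. c \<in> ?A"
      using \<mu>' by (auto simp: prob_measures_on_def)
    have "(\<lambda>c. indicator ?A c *\<^sub>R f c) \<in> borel_measurable borel"
      using f_meas sets_rooted_graphs_deg by (intro borel_measurable_scaleR borel_measurable_indicator)
    then have meas: "(\<lambda>c. indicator ?A c *\<^sub>R f c) \<in> borel_measurable \<mu>'"
      using measurable_cong_sets[OF p(2) refl] by blast
    have eq: "(\<integral>\<^sup>+c. ennreal (indicator ?A c *\<^sub>R f c) \<partial>\<mu>') = (\<integral>\<^sup>+c. D c \<partial>\<mu>')"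
      by (rule nn_integral_cong_AE, use p(3) in \<open>rule eventually_mono\<close>) (simp add: D_f)
    have "(\<integral>\<^sup>+c. D c \<partial>\<mu>') \<le> (\<integral>\<^sup>+c. of_nat M \<partial>\<mu>')"
      by (rule nn_integral_mono_AE, use p(3) in \<open>rule eventually_mono\<close>) (rule D_le)
    also have "\<dots> < \<infinity>" using prob_space.emeasure_space_1[OF p(1)] by (simp add: of_nat_less_top)
    finally have fin: "(\<integral>\<^sup>+c. D c \<partial>\<mu>') < \<infinity>" .
    have "(LINT c:?A|\<mu>'. f c) = enn2real (\<integral>\<^sup>+c. ennreal (indicator ?A c *\<^sub>R f c) \<partial>\<mu>')"
      unfolding set_lebesgue_integral_def
      by (rule integral_eq_nn_integral[OF meas]) (auto simp: f_def)
    then show ?thesis unfolding eq using fin by simp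
  qed
  have "openin (weak_topology ?A) W"
    unfolding weak_topology_def W_def
  proof (rule topology_generated_by_Basis, intro CollectI exI conjI)
    show "{\<mu>' \<in> prob_measures_on ?A. (LINT c:?A|\<mu>'. f c) \<in> {..< 6 * (t * \<epsilon>)}} =
        {\<mu>' \<in> prob_measures_on ?A. (LINT c:?A|\<mu>'. f c) \<in> {..< 6 * (t * \<epsilon>)}}" ..
  qed (use f_cont f_bdd in auto)
  moreover have "\<mu> \<in> W"
  proof -
    have \<mu>: "\<mu> \<in> prob_measures_on ?A" using assms(5) by (simp add: unimodular_measures_deg_def)
    have "ennreal (LINT c:?A|\<mu>. f c) < ennreal (6 * (t * \<epsilon>))"
      unfolding LINT[OF \<mu>] D_def
    proof (rule order_le_less_trans[OF b], rule ennreal_lessI[OF _ lt])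
      show "0 < 6 * (t * \<epsilon>)" using t0 assms(2) by simp
    qed
    then have "(LINT c:?A|\<mu>. f c) < 6 * (t * \<epsilon>)"
      using t0 assms(2) by (metis ennreal_leI leD not_le_imp_less)
    then show ?thesis using \<mu> by (simp add: W_def)
  qed
  moreover have "hyperfinite k (3 * ln (2 * real M / \<epsilon>) * \<epsilon>) \<mu>'" if "\<mu>' \<in> W \<inter> unimodular_measures_deg M" for \<mu>'
  proof (rule cutting_imp_hyperfinite[OF assms(4) q])
    show "\<mu>' \<in> unimodular_measures" using that by (simp add: unimodular_measures_deg_def)
    have "ennreal (LINT c:?A|\<mu>'. f c) \<le> ennreal (6 * (t * \<epsilon>))" using that by (intro ennreal_leI) (simp add: W_def)
    then show "(\<integral>\<^sup>+c. (\<integral>\<^sup>+d. of_nat (cut_degree (rep d)) \<partial>cut_law k q (rep c)) \<partial>\<mu>') \<le>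
        ennreal (2 * (3 * ln (2 * real M / \<epsilon>) * \<epsilon>))"
      using LINT[of \<mu>'] that by (simp add: W_def D_def t_def)
  qed
  ultimately show ?thesis by blast
qed

end
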